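(* Let $G$ be a connected subcubic graph on $n$ vertices and $m$ edges. Then $\gamma(G) \leq \frac{4n-m}{6}+ \frac{1}{2}$, with equality if and only if $G$ is isomorphic to $K_{3,3}$. Moreover, if $G$ is not cubic then $\gamma(G) \leq \frac{4n-m}{6}$.
   Context: All graphs are finite, undirected and simple. A graph is subcubic if its maximum degree is at most $3$, and cubic if it is $3$-regular. A matching is a set of pairwise non-adjacent edges; a maximal matching is a matching not contained in any larger matching. For a graph $G$, $\gamma(G)$ denotes the minimum size of a maximal matching of $G$. *)

theory Defs
  imports Complex_Main
begin

record 'a ugraph =
  verts :: "'a set"
  edges :: "'a set set"

definition simple_graph :: "'a ugraph \<Rightarrow> bool" where
  "simple_graph G \<longleftrightarrow> finite (verts G) \<and> (\<forall>e\<in>edges G. e \<subseteq> verts G \<and> card e = 2)"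

definition degree :: "'a ugraph \<Rightarrow> 'a \<Rightarrow> nat" where
  "degree G v = card {e \<in> edges G. v \<in> e}"

definition subcubic :: "'a ugraph \<Rightarrow> bool" where
  "subcubic G \<longleftrightarrow> (\<forall>v\<in>verts G. degree G v \<le> 3)"

definition cubic :: "'a ugraph \<Rightarrow> bool" where
  "cubic G \<longleftrightarrow> (\<forall>v\<in>verts G. degree G v = 3)"

(* A connected graph has at least one vertex. *)
definition connected_graph :: "'a ugraph \<Rightarrow> bool" where
  "connected_graph G \<longleftrightarrow>
     verts G \<noteq> {} \<and> (\<forall>u\<in>verts G. \<forall>v\<in>verts G. (u, v) \<in> {(x, y). {x, y} \<in> edges G}\<^sup>*)"

definition matching :: "'a ugraph \<Rightarrow> 'a set set \<Rightarrow> bool" where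
  "matching G M \<longleftrightarrow> M \<subseteq> edges G \<and> (\<forall>e\<in>M. \<forall>f\<in>M. e \<noteq> f \<longrightarrow> e \<inter> f = {})"

definition maximal_matching :: "'a ugraph \<Rightarrow> 'a set set \<Rightarrow> bool" where
  "maximal_matching G M \<longleftrightarrow> matching G M \<and> \<not> (\<exists>M'. matching G M' \<and> M \<subset> M')"

definition min_maximal_matching :: "'a ugraph \<Rightarrow> nat" (\<open>\<gamma>\<close>) where
  "\<gamma> G = Min (card ` {M. maximal_matching G M})"

(* The minimum above is over a finite nonempty set. *)
lemma maximal_matchings_finite_nonempty:
  assumes "simple_graph G"
  shows "finite {M. maximal_matching G M}" "{M. maximal_matching G M} \<noteq> {}"
proof -
  have "edges G \<subseteq> Pow (verts G)" "finite (verts G)"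
    using assms by (auto simp: simple_graph_def)
  then have "finite (edges G)"
    using finite_subset by blast
  then have fin: "finite {M. matching G M}"
    by (rule finite_subset[rotated, OF finite_Pow_iff[THEN iffD2]]) (auto simp: matching_def)
  then show "finite {M. maximal_matching G M}"
    by (rule finite_subset[rotated]) (auto simp: maximal_matching_def)
  have "{M. matching G M} \<noteq> {}"
    by (auto simp: matching_def intro: exI[of _ "{}"])
  with fin obtain M where "M \<in> {M. matching G M}" "\<forall>M'\<in>{M. matching G M}. M \<subseteq> M' \<longrightarrow> M = M'"
    by (metis finite_has_maximal)
  then show "{M. maximal_matching G M} \<noteq> {}"
    by (auto simp: maximal_matching_def)
qed

definition graph_isomorphic :: "'a ugraph \<Rightarrow> 'b ugraph \<Rightarrow> bool" where
  "graph_isomorphic G H \<longleftrightarrow>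
     (\<exists>f. bij_betw f (verts G) (verts H) \<and>
          (\<forall>u\<in>verts G. \<forall>v\<in>verts G. {u, v} \<in> edges G \<longleftrightarrow> {f u, f v} \<in> edges H))"

definition complete_bipartite :: "nat \<Rightarrow> nat \<Rightarrow> (nat + nat) ugraph" where
  "complete_bipartite p q =
     \<lparr> verts = {..<p} <+> {..<q}, edges = {{Inl i, Inr j} | i j. i < p \<and> j < q} \<rparr>"

end

(*
  Write phi G = 4 n - m. The core is the bound 6 \<gamma>(G) \<le> phi G for every subcubic graph in which each
  component has a vertex of degree at most 2; this class is closed under induced subgraphs. A minimal
  counterexample is restricted by two kinds of reduction. Matching t pairs of adjacent vertices and
  deleting them together with k vertices isolated by this changes phi by 8 t + 4 k minus the number of
  deleted edges, which settles the matter when at most 2 t + 4 k edges are deleted. Alternatively, for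
  an edge a a' with x adjacent to a and y adjacent to a', delete a, a' and add the edge x y: a maximal
  matching of the new graph yields one of the old graph with one more edge. The new graph is smaller
  but may have a cubic component; in that case the vertices x, y sit in components of the deleted
  graph that are attached to it by a single edge, and computing phi of such a component modulo 6 for
  two different deletions gives a contradiction. The case analysis starts at a vertex of degree 2.

  In a connected cubic graph every proper induced subgraph belongs to the class above, and rewiring at
  an edge gives 6 \<gamma>(G) \<le> phi G + 2 unless all candidates for x and y are equal or adjacent, which
  forces K4 or K33. Only K33 violates the bound, with 6 \<gamma> = phi + 3.
*)

theory Submission
  imports Defs
begin

definition nbr :: "'a ugraph \<Rightarrow> 'a \<Rightarrow> 'a set" where
  "nbr G v = {u. {v, u} \<in> edges G}"

definition phi :: "'a ugraph \<Rightarrow> int" where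
  "phi G = 4 * int (card (verts G)) - int (card (edges G))"

definition covering_matching :: "'a ugraph \<Rightarrow> 'a set set \<Rightarrow> bool" where
  "covering_matching G M \<longleftrightarrow> matching G M \<and> (\<forall>e\<in>edges G. e \<inter> \<Union>M \<noteq> {})"

definition bnd :: "'a ugraph \<Rightarrow> int \<Rightarrow> bool" where
  "bnd G z \<longleftrightarrow> (\<exists>M. covering_matching G M \<and> 6 * int (card M) \<le> z)"

lemma bnd_mono: "bnd G z \<Longrightarrow> z \<le> z' \<Longrightarrow> bnd G z'"
  unfolding bnd_def by force

lemma bnd_minus_mod: "bnd G z \<Longrightarrow> bnd G (z - z mod 6)"
proof -
  assume "bnd G z"
  then obtain M where M: "covering_matching G M" "6 * int (card M) \<le> z"
    by (auto simp: bnd_def)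
  then have "6 * int (card M) \<le> z - z mod 6" by presburger
  with M show ?thesis by (auto simp: bnd_def)
qed

definition ind :: "'a ugraph \<Rightarrow> 'a set \<Rightarrow> 'a ugraph" where
  "ind G S = \<lparr> verts = S, edges = {e \<in> edges G. e \<subseteq> S} \<rparr>"

definition adj_rel :: "'a ugraph \<Rightarrow> ('a \<times> 'a) set" where
  "adj_rel G = {(x, y). {x, y} \<in> edges G}"

definition deficient :: "'a ugraph \<Rightarrow> bool" where
  "deficient G \<longleftrightarrow> (\<forall>u\<in>verts G. \<exists>w\<in>verts G. (u, w) \<in> (adj_rel G)\<^sup>* \<and> degree G w \<le> 2)"

definition meet :: "'a ugraph \<Rightarrow> 'a set \<Rightarrow> nat" where
  "meet G S = card {e \<in> edges G. e \<inter> S \<noteq> {}}"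

lemma verts_ind [simp]: "verts (ind G S) = S"
  and edges_ind [simp]: "edges (ind G S) = {e \<in> edges G. e \<subseteq> S}"
  by (simp_all add: ind_def)

lemma bnd_ind_empty:
  assumes "simple_graph G"
  shows "bnd (ind G {}) 0"
proof -
  have "{e \<in> edges G. e \<subseteq> {}} = {}" using assms by (auto simp: simple_graph_def)
  then have "covering_matching (ind G {}) {}" by (simp add: covering_matching_def matching_def)
  then show ?thesis unfolding bnd_def by (intro exI[of _ "{}"]) simp
qed

lemma nbr_sym: "u \<in> nbr G v \<longleftrightarrow> v \<in> nbr G u"
  by (simp add: nbr_def insert_commute)

lemma nbr_symD: "u \<in> nbr G v \<Longrightarrow> v \<in> nbr G u"
  by (simp add: nbr_def insert_commute)

lemma nbr_ind: "v \<in> S \<Longrightarrow> nbr (ind G S) v = nbr G v \<inter> S"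
  by (auto simp: nbr_def)

lemma adj_rel_iff: "(x, y) \<in> adj_rel G \<longleftrightarrow> y \<in> nbr G x"
  by (simp add: adj_rel_def nbr_def)

lemma sym_adj_rel_rtrancl: "sym ((adj_rel G)\<^sup>*)"
  by (rule sym_rtrancl) (auto simp: sym_def adj_rel_iff nbr_sym)

lemma reach_sym: "(x, y) \<in> (adj_rel G)\<^sup>* \<Longrightarrow> (y, x) \<in> (adj_rel G)\<^sup>*"
  using sym_adj_rel_rtrancl by (metis symE)

lemma edge_pair:
  assumes "simple_graph G" "e \<in> edges G"
  obtains u w where "e = {u, w}" "u \<noteq> w" "u \<in> verts G" "w \<in> verts G" "w \<in> nbr G u"
proof -
  from assms have "e \<subseteq> verts G" "card e = 2" by (auto simp: simple_graph_def)
  then obtain u w where "e = {u, w}" "u \<noteq> w" by (auto simp: card_2_iff)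
  with \<open>e \<subseteq> verts G\<close> assms(2) that show thesis by (auto simp: nbr_def)
qed

lemma finite_edges: "simple_graph G \<Longrightarrow> finite (edges G)"
  by (rule finite_subset[of _ "Pow (verts G)"]) (auto simp: simple_graph_def)

lemma nbr_props:
  assumes "simple_graph G"
  shows "u \<in> nbr G v \<Longrightarrow> u \<noteq> v" "u \<in> nbr G v \<Longrightarrow> u \<in> verts G"
    "u \<in> nbr G v \<Longrightarrow> v \<in> verts G"
    "finite (nbr G v)"
proof -
  have *: "u \<noteq> v \<and> u \<in> verts G \<and> v \<in> verts G" if "u \<in> nbr G v" for u
    using assms that by (force simp: nbr_def simple_graph_def)
  then show "u \<in> nbr G v \<Longrightarrow> u \<noteq> v" "u \<in> nbr G v \<Longrightarrow> u \<in> verts G"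
    "u \<in> nbr G v \<Longrightarrow> v \<in> verts G"
    by auto
  show "finite (nbr G v)"
    by (rule finite_subset[of _ "verts G"]) (use * assms in \<open>auto simp: simple_graph_def\<close>)
qed

lemma degree_nbr:
  assumes "simple_graph G"
  shows "degree G v = card (nbr G v)"
proof -
  have "bij_betw (\<lambda>u. {v, u}) (nbr G v) {e \<in> edges G. v \<in> e}"
  proof (rule bij_betwI')
    fix x y assume "x \<in> nbr G v" "y \<in> nbr G v"
    then show "({v, x} = {v, y}) = (x = y)" by (metis doubleton_eq_iff)
  next
    fix x assume "x \<in> nbr G v"
    then show "{v, x} \<in> {e \<in> edges G. v \<in> e}" by (simp add: nbr_def)
  next
    fix e assume e: "e \<in> {e \<in> edges G. v \<in> e}"
    then obtain u w where uw: "e = {u, w}" "w \<in> nbr G u" using assms by (auto elim: edge_pair)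
    with e have "v = u \<or> v = w" by auto
    then show "\<exists>x\<in>nbr G v. e = {v, x}"
      using uw by (metis insert_commute nbr_sym)
  qed
  then show ?thesis by (simp add: degree_def bij_betw_same_card)
qed

lemma simple_ind: "simple_graph G \<Longrightarrow> S \<subseteq> verts G \<Longrightarrow> simple_graph (ind G S)"
  by (auto simp: simple_graph_def dest: finite_subset)

lemma subcubic_nbr: "simple_graph G \<Longrightarrow> subcubic G \<longleftrightarrow> (\<forall>v. card (nbr G v) \<le> 3)"
proof -
  assume G: "simple_graph G"
  have "card (nbr G v) \<le> 3" if "v \<notin> verts G" for v
    using nbr_props(3)[OF G] that by (metis card.empty equals0I le0)
  then show ?thesis using degree_nbr[OF G] by (metis subcubic_def)
qed

lemma degree_ind_le:
  assumes "simple_graph G" "S \<subseteq> verts G"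
  shows "degree (ind G S) v \<le> degree G v"
  unfolding degree_def using finite_edges[OF assms(1)] by (intro card_mono) auto

lemma subcubic_ind: "simple_graph G \<Longrightarrow> subcubic G \<Longrightarrow> S \<subseteq> verts G \<Longrightarrow> subcubic (ind G S)"
  unfolding subcubic_def using degree_ind_le by (metis dual_order.trans subsetD verts_ind)

lemma deficient_ind:
  assumes G: "simple_graph G" "subcubic G" "deficient G" and S: "S \<subseteq> verts G"
  shows "deficient (ind G S)"
  unfolding deficient_def
proof
  fix u assume "u \<in> verts (ind G S)"
  then have u: "u \<in> S" by simp
  with G S obtain w where w: "(u, w) \<in> (adj_rel G)\<^sup>*" "w \<in> verts G" "degree G w \<le> 2"
    by (auto simp: deficient_def)
  have sI: "simple_graph (ind G S)" using G S simple_ind by blast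
  from w(1) u have "(w \<in> S \<and> (u, w) \<in> (adj_rel (ind G S))\<^sup>*) \<or>
    (\<exists>z\<in>S. (u, z) \<in> (adj_rel (ind G S))\<^sup>* \<and> degree (ind G S) z \<le> 2)"
  proof (induction rule: rtrancl_induct)
    case base
    then show ?case by simp
  next
    case (step y z)
    show ?case
    proof (cases "y \<in> S \<and> (u, y) \<in> (adj_rel (ind G S))\<^sup>*")
      case True
      show ?thesis
      proof (cases "z \<in> S")
        case True
        with \<open>y \<in> S \<and> _\<close> step(2) have "(y, z) \<in> adj_rel (ind G S)"
          by (auto simp: adj_rel_iff nbr_ind)
        with True \<open>y \<in> S \<and> _\<close> show ?thesis by (meson rtrancl.rtrancl_into_rtrancl)
      next
        case False
        have "nbr G y \<inter> S \<subset> nbr G y" using step(2) False by (auto simp: adj_rel_iff)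
        then have "card (nbr G y \<inter> S) < card (nbr G y)"
          using nbr_props(4)[OF G(1)] by (meson psubset_card_mono)
        moreover have "card (nbr G y) \<le> 3" using G subcubic_nbr by blast
        ultimately have "degree (ind G S) y \<le> 2"
          using True degree_nbr[OF sI] by (simp add: nbr_ind)
        with True show ?thesis by blast
      qed
    next
      case False
      with step.IH step.prems show ?thesis by blast
    qed
  qed
  then show "\<exists>w\<in>verts (ind G S). (u, w) \<in> (adj_rel (ind G S))\<^sup>* \<and> degree (ind G S) w \<le> 2"
    using w(3) degree_ind_le[OF G(1) S, of w] by (metis le_trans verts_ind)
qed

lemma meet_empty [simp]: "meet G {} = 0"
  by (simp add: meet_def)

lemma meet_mono: "simple_graph G \<Longrightarrow> S \<subseteq> S' \<Longrightarrow> meet G S \<le> meet G S'"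
  unfolding meet_def using finite_edges by (intro card_mono) auto

lemma meet_insert:
  assumes "simple_graph G"
  shows "meet G (insert x S) \<le> meet G S + card (nbr G x - S)"
proof -
  have "{e \<in> edges G. e \<inter> insert x S \<noteq> {}} \<subseteq>
      {e \<in> edges G. e \<inter> S \<noteq> {}} \<union> (\<lambda>u. {x, u}) ` (nbr G x - S)"
  proof
    fix e assume e: "e \<in> {e \<in> edges G. e \<inter> insert x S \<noteq> {}}"
    show "e \<in> {e \<in> edges G. e \<inter> S \<noteq> {}} \<union> (\<lambda>u. {x, u}) ` (nbr G x - S)"
    proof (cases "e \<inter> S = {}")
      case True
      with e have "x \<in> e" "e \<in> edges G" by auto
      then obtain u where "e = {x, u}"
        using assms by (metis edge_pair insertE insert_commute singletonD)
      with True \<open>e \<in> edges G\<close> show ?thesis by (auto simp: nbr_def)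
    qed (use e in auto)
  qed
  then have "meet G (insert x S) \<le> card ({e \<in> edges G. e \<inter> S \<noteq> {}} \<union> (\<lambda>u. {x, u}) ` (nbr G x - S))"
    unfolding meet_def using finite_edges[OF assms] nbr_props(4)[OF assms]
    by (intro card_mono) auto
  also have "\<dots> \<le> meet G S + card ((\<lambda>u. {x, u}) ` (nbr G x - S))"
    unfolding meet_def by (rule card_Un_le)
  also have "\<dots> \<le> meet G S + card (nbr G x - S)"
    using nbr_props(4)[OF assms] by (simp add: card_image_le)
  finally show ?thesis .
qed

lemma covering_matching_Un:
  assumes G: "simple_graph G"
    and M0: "matching G M0" "\<Union>M0 = X"
    and K: "covering_matching (ind G K) MK" "K \<inter> X = {}"
    and Q: "covering_matching (ind G Q) MO" "Q \<inter> X = {}" "K \<inter> Q = {}"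
    and E: "\<And>e. e \<in> edges G \<Longrightarrow> e \<inter> X \<noteq> {} \<or> e \<subseteq> K \<or> e \<subseteq> Q"
  shows "covering_matching G (M0 \<union> MK \<union> MO)"
proof -
  have sub: "\<Union>MK \<subseteq> K" "\<Union>MO \<subseteq> Q" "MK \<subseteq> edges G" "MO \<subseteq> edges G"
    and dj: "\<And>e f. e \<in> MK \<Longrightarrow> f \<in> MK \<Longrightarrow> e \<noteq> f \<Longrightarrow> e \<inter> f = {}"
      "\<And>e f. e \<in> MO \<Longrightarrow> f \<in> MO \<Longrightarrow> e \<noteq> f \<Longrightarrow> e \<inter> f = {}"
      "\<And>e f. e \<in> M0 \<Longrightarrow> f \<in> M0 \<Longrightarrow> e \<noteq> f \<Longrightarrow> e \<inter> f = {}"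
    using K(1) Q(1) M0 by (auto simp: covering_matching_def matching_def)
  have x1: "e \<inter> f = {}" if "e \<in> M0" "f \<in> MK" for e f
    using that sub(1) M0(2) K(2) by blast
  have x2: "e \<inter> f = {}" if "e \<in> M0" "f \<in> MO" for e f
    using that sub(2) M0(2) Q(2) by blast
  have x3: "e \<inter> f = {}" if "e \<in> MK" "f \<in> MO" for e f
    using that sub Q(3) by blast
  have "matching G (M0 \<union> MK \<union> MO)"
    unfolding matching_def
  proof (intro conjI ballI impI)
    show "M0 \<union> MK \<union> MO \<subseteq> edges G" using sub M0 by (auto simp: matching_def)
    fix e f assume "e \<in> M0 \<union> MK \<union> MO" "f \<in> M0 \<union> MK \<union> MO" "e \<noteq> f"
    then show "e \<inter> f = {}"
      using dj[of e f] x1[of e f] x1[of f e] x2[of e f] x2[of f e] x3[of e f] x3[of f e] by auto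
  qed
  moreover have "e \<inter> \<Union>(M0 \<union> MK \<union> MO) \<noteq> {}" if "e \<in> edges G" for e
  proof -
    have "e \<inter> \<Union>MK \<noteq> {}" if "e \<subseteq> K"
      using K(1) \<open>e \<in> edges G\<close> that by (simp add: covering_matching_def)
    moreover have "e \<inter> \<Union>MO \<noteq> {}" if "e \<subseteq> Q"
      using Q(1) \<open>e \<in> edges G\<close> that by (simp add: covering_matching_def)
    ultimately show ?thesis using E[OF that] M0(2) by auto
  qed
  ultimately show ?thesis by (simp add: covering_matching_def)
qed

text \<open>Supplies every disequality in both orientations to the simplifier.\<close>

lemma distinct_both: "distinct xs \<Longrightarrow> distinct xs \<and> distinct (rev xs)"
  by simp

section \<open>Deleting matched pairs\<close>

fun flat :: "('a \<times> 'a) list \<Rightarrow> 'a list" where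
  "flat [] = []"
| "flat ((a, b) # ps) = a # b # flat ps"

text \<open>The pairs \<open>ps\<close> are put into the matching; the vertices \<open>js\<close> become isolated once they are deleted.\<close>

definition config :: "'a ugraph \<Rightarrow> ('a \<times> 'a) list \<Rightarrow> 'a list \<Rightarrow> bool" where
  "config G ps js \<longleftrightarrow> distinct (flat ps @ js) \<and> (\<forall>(a, b)\<in>set ps. b \<in> nbr G a) \<and>
     (\<forall>i\<in>set js. i \<in> verts G \<and> nbr G i \<subseteq> set (flat ps))"

abbreviation pair_edges :: "('a \<times> 'a) list \<Rightarrow> 'a set set" where
  "pair_edges ps \<equiv> (\<lambda>(a, b). {a, b}) ` set ps"

lemma set_flat: "set (flat ps) = \<Union>(pair_edges ps)"
  by (induction ps rule: flat.induct) auto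

lemma length_flat: "length (flat ps) = 2 * length ps"
  by (induction ps rule: flat.induct) auto

lemma pair_edges_disjoint:
  "distinct (flat ps) \<Longrightarrow> e \<in> pair_edges ps \<Longrightarrow> f \<in> pair_edges ps \<Longrightarrow> e \<noteq> f \<Longrightarrow> e \<inter> f = {}"
proof (induction ps arbitrary: e f rule: flat.induct)
  case (2 a b ps)
  have *: "g \<inter> {a, b} = {}" if "g \<in> pair_edges ps" for g
  proof -
    have "g \<subseteq> set (flat ps)" using that by (auto simp: set_flat)
    then show ?thesis using 2(2) by auto
  qed
  show ?case using 2(2-) * 2(1)[of e f] by auto
qed simp

locale split_config =
  fixes G :: "'a ugraph" and ps js K Q
  assumes G: "simple_graph G" and c: "config G ps js"
    and KQ: "K \<union> Q = verts G - set (flat ps) - set js" "K \<inter> Q = {}"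
    and sep: "\<And>u. u \<in> K \<Longrightarrow> nbr G u \<inter> Q = {}"
begin

lemma flat_subset: "set (flat ps) \<subseteq> verts G"
  using c nbr_props(2,3)[OF G] by (fastforce simp: set_flat config_def)

lemma edge_cases:
  assumes "e \<in> edges G"
  shows "e \<inter> set (flat ps) \<noteq> {} \<or> e \<subseteq> K \<or> e \<subseteq> Q"
proof -
  obtain u w where uw: "e = {u, w}" "u \<in> verts G" "w \<in> verts G" "w \<in> nbr G u" "u \<in> nbr G w"
    by (rule edge_pair[OF G assms]) (use nbr_symD in \<open>metis that\<close>)
  have js: "z \<in> set (flat ps)" if "i \<in> set js" "z \<in> nbr G i" for i z
    using c that by (auto simp: config_def)
  show ?thesis
  proof (cases "u \<in> set (flat ps) \<or> w \<in> set (flat ps)")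
    case False
    then have "u \<notin> set js" "w \<notin> set js" using js uw by auto
    then have "u \<in> K \<union> Q" "w \<in> K \<union> Q" using False KQ(1) uw by auto
    then show ?thesis using sep[of u] sep[of w] uw by auto
  qed (use uw in auto)
qed

lemma bnd_split:
  assumes "bnd (ind G K) zK" "bnd (ind G Q) zQ"
  shows "bnd G (6 * int (length ps) + zK + zQ)"
proof -
  obtain MK MQ where M: "covering_matching (ind G K) MK" "6 * int (card MK) \<le> zK"
    "covering_matching (ind G Q) MQ" "6 * int (card MQ) \<le> zQ"
    using assms by (auto simp: bnd_def)
  have "matching G (pair_edges ps)"
    using c pair_edges_disjoint[of ps] by (auto simp: matching_def config_def nbr_def)
  then have "covering_matching G (pair_edges ps \<union> MK \<union> MQ)"
    using KQ by (intro covering_matching_Un[OF G, of _ "set (flat ps)" K _ Q])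
      (use edge_cases in \<open>auto simp: set_flat[symmetric] M\<close>)
  moreover have "card (pair_edges ps \<union> MK \<union> MQ) \<le> length ps + card MK + card MQ"
    by (meson add_le_mono card_Un_le card_image_le card_length finite_set le_refl le_trans)
  ultimately show ?thesis using M unfolding bnd_def
    by (intro exI[of _ "pair_edges ps \<union> MK \<union> MQ"]) auto
qed

lemma phi_split:
  "phi G = phi (ind G K) + phi (ind G Q) + 8 * int (length ps) + 4 * int (length js) - int (meet G (set (flat ps)))"
proof -
  let ?X = "set (flat ps)"
  have fin: "finite (verts G)" using G by (simp add: simple_graph_def)
  have Vjs: "verts G = K \<union> Q \<union> (set (flat ps) \<union> set js)"
    using KQ flat_subset c by (auto simp: config_def)
  have d: "distinct (flat ps @ js)" using c by (simp add: config_def)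
  have "card (set (flat ps) \<union> set js) = 2 * length ps + length js"
    using distinct_card[OF d] by (simp add: length_flat)
  moreover have "card (verts G) = card K + card Q + card (set (flat ps) \<union> set js)"
    using fin KQ unfolding Vjs by (subst card_Un_disjoint; (subst card_Un_disjoint)?) auto
  ultimately have n: "card (verts G) = card K + card Q + (2 * length ps + length js)" by simp
  have K: "K \<inter> ?X = {}" and Q: "Q \<inter> ?X = {}" using KQ by auto
  let ?E1 = "{e \<in> edges G. e \<inter> ?X \<noteq> {}}" and ?E2 = "{e \<in> edges G. e \<subseteq> K}"
    and ?E3 = "{e \<in> edges G. e \<subseteq> Q}"
  have ne: "e \<noteq> {}" if "e \<in> edges G" for e using edge_pair[OF G that] by blast
  have "edges G = ?E1 \<union> ?E2 \<union> ?E3" using edge_cases by auto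
  moreover have "?E1 \<inter> ?E2 = {}" "?E1 \<inter> ?E3 = {}" "?E2 \<inter> ?E3 = {}"
    using K Q KQ(2) ne by (blast+)
  ultimately have "card (edges G) = card ?E1 + card ?E2 + card ?E3"
    using finite_edges[OF G] card_Un_disjoint[of ?E1 ?E2] card_Un_disjoint[of "?E1 \<union> ?E2" ?E3]
    by (simp add: Int_Un_distrib2)
  with n show ?thesis by (simp add: phi_def meet_def)
qed

end

section \<open>Rewiring at an edge\<close>

definition rewire :: "'a ugraph \<Rightarrow> 'a \<Rightarrow> 'a \<Rightarrow> 'a \<Rightarrow> 'a \<Rightarrow> 'a ugraph" where
  "rewire G a a' x y = \<lparr> verts = verts G - {a, a'},
     edges = insert {x, y} {e \<in> edges G. e \<inter> {a, a'} = {}} \<rparr>"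

lemma matching_insert:
  "matching G M \<Longrightarrow> e \<in> edges G \<Longrightarrow> (\<And>f. f \<in> M \<Longrightarrow> e \<inter> f = {}) \<Longrightarrow> matching G (insert e M)"
  by (simp add: matching_def Int_commute)

locale rewiring =
  fixes G :: "'a ugraph" and a a' x y
  assumes G: "simple_graph G"
    and ad: "a' \<in> nbr G a" "x \<in> nbr G a" "y \<in> nbr G a'"
    and ne: "x \<noteq> a'" "y \<noteq> a" "x \<noteq> y" "y \<notin> nbr G x"
begin

lemma ne': "a \<noteq> a'" "x \<noteq> a" "y \<noteq> a'" "x \<in> verts G" "y \<in> verts G" "a \<in> verts G"
  "a' \<in> verts G"
  using nbr_props[OF G] ad by blast+

lemma simple: "simple_graph (rewire G a a' x y)"
  using G ne ne' by (auto simp: simple_graph_def rewire_def)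

lemma nbr_rewire:
  "nbr (rewire G a a' x y) w =
    (if w \<in> {a, a'} then {} else (nbr G w - {a, a'}) \<union> (if w = x then {y} else {}) \<union> (if w = y then {x} else {}))"
  using ne ne' by (auto simp: nbr_def rewire_def doubleton_eq_iff)

lemma finite_nbr: "finite (nbr G w)"
  using nbr_props(4)[OF G] .

lemma card_diff_pair:
  "a \<in> nbr G w \<or> a' \<in> nbr G w \<Longrightarrow> card (nbr G w - {a, a'}) + 1 \<le> card (nbr G w)"
  "a \<in> nbr G w \<Longrightarrow> a' \<in> nbr G w \<Longrightarrow> card (nbr G w - {a, a'}) + 2 = card (nbr G w)"
proof -
  assume "a \<in> nbr G w \<or> a' \<in> nbr G w"
  then have "nbr G w - {a, a'} \<subset> nbr G w" by blast
  from psubset_card_mono[OF finite_nbr this]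
  show "card (nbr G w - {a, a'}) + 1 \<le> card (nbr G w)" by simp
next
  assume "a \<in> nbr G w" "a' \<in> nbr G w"
  then have "card {a, a'} = 2" "{a, a'} \<subseteq> nbr G w" using ne'(1) by auto
  then show "card (nbr G w - {a, a'}) + 2 = card (nbr G w)"
    using card_Diff_subset[of "{a, a'}" "nbr G w"] card_mono[OF finite_nbr[of w], of "{a, a'}"] by simp
qed

lemma card_nbr_rewire:
  "card (nbr (rewire G a a' x y) x) \<le> card (nbr G x - {a, a'}) + 1"
  "card (nbr (rewire G a a' x y) y) \<le> card (nbr G y - {a, a'}) + 1"
  "w \<noteq> x \<Longrightarrow> w \<noteq> y \<Longrightarrow> card (nbr (rewire G a a' x y) w) \<le> card (nbr G w - {a, a'})"
proof -
  have "nbr (rewire G a a' x y) x = insert y (nbr G x - {a, a'})"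
    "nbr (rewire G a a' x y) y = insert x (nbr G y - {a, a'})"
    using ne(1-3) ne'(1-3) by (simp_all add: nbr_rewire)
  then show "card (nbr (rewire G a a' x y) x) \<le> card (nbr G x - {a, a'}) + 1"
    "card (nbr (rewire G a a' x y) y) \<le> card (nbr G y - {a, a'}) + 1"
    using finite_nbr[of x] finite_nbr[of y] by (simp_all add: card_insert_if)
  assume "w \<noteq> x" "w \<noteq> y"
  then have "nbr (rewire G a a' x y) w \<subseteq> nbr G w - {a, a'}" by (simp add: nbr_rewire)
  then show "card (nbr (rewire G a a' x y) w) \<le> card (nbr G w - {a, a'})"
    using finite_nbr[of w] by (simp add: card_mono)
qed

lemma card_nbr_rewire_le: "card (nbr (rewire G a a' x y) w) \<le> card (nbr G w)"
proof -
  consider "w = x" | "w = y" | "w \<noteq> x" "w \<noteq> y" by blast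
  then show ?thesis
  proof cases
    case 1
    then show ?thesis using card_nbr_rewire(1) card_diff_pair(1)[of x] nbr_symD[OF ad(2)] by simp
  next
    case 2
    then show ?thesis using card_nbr_rewire(2) card_diff_pair(1)[of y] nbr_symD[OF ad(3)] by simp
  next
    case 3
    from card_nbr_rewire(3)[OF 3] card_mono[OF finite_nbr Diff_subset] show ?thesis by (rule le_trans)
  qed
qed

lemma card_nbr_rewire_less:
  assumes "w \<in> nbr G a' \<and> w \<noteq> y \<or> w \<in> nbr G a \<and> w \<noteq> x"
  shows "card (nbr (rewire G a a' x y) w) < card (nbr G w)"
proof -
  have w: "a \<in> nbr G w \<or> a' \<in> nbr G w" using assms nbr_symD by metis
  consider "w = x" | "w = y" | "w \<noteq> x" "w \<noteq> y" by blast
  then show ?thesis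
  proof cases
    case 1
    then have "a' \<in> nbr G x" using assms nbr_symD by metis
    then show ?thesis using 1 card_nbr_rewire(1) card_diff_pair(2)[of x] nbr_symD[OF ad(2)] by simp
  next
    case 2
    then have "a \<in> nbr G y" using assms nbr_symD by metis
    then show ?thesis using 2 card_nbr_rewire(2) card_diff_pair(2)[of y] nbr_symD[OF ad(3)] by simp
  next
    case 3
    from card_nbr_rewire(3)[OF 3] card_diff_pair(1)[OF w] show ?thesis by simp
  qed
qed

lemma bnd_rewire:
  assumes "bnd (rewire G a a' x y) z"
  shows "bnd G (z + 6)"
proof -
  let ?H = "rewire G a a' x y"
  obtain M where M: "covering_matching ?H M" "6 * int (card M) \<le> z"
    using assms by (auto simp: bnd_def)
  have ME: "e \<in> M \<Longrightarrow> e = {x, y} \<or> (e \<in> edges G \<and> e \<inter> {a, a'} = {})"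
    and Md: "e \<in> M \<Longrightarrow> f \<in> M \<Longrightarrow> e \<noteq> f \<Longrightarrow> e \<inter> f = {}" for e f
    using M(1) by (auto simp: covering_matching_def matching_def rewire_def)
  have cov: "e \<inter> \<Union>M \<noteq> {}" if "e \<in> edges G" "e \<inter> {a, a'} = {}" for e
    using M(1) that by (simp add: covering_matching_def rewire_def)
  have finM: "finite M"
    using M(1) finite_subset[OF _ finite_edges[OF simple]] by (simp add: covering_matching_def matching_def)
  have eG: "{a, a'} \<in> edges G" "{a, x} \<in> edges G" "{a', y} \<in> edges G" "{x, y} \<notin> edges G"
    using ad ne by (auto simp: nbr_def)
  define M' where "M' = (if {x, y} \<in> M then insert {a, x} (insert {a', y} (M - {{x, y}})) else insert {a, a'} M)"
  have U: "\<Union>M' = \<Union>M \<union> {a, a'}"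
  proof (cases "{x, y} \<in> M")
    case True
    then have "\<Union>M = {x, y} \<union> \<Union>(M - {{x, y}})" by blast
    then show ?thesis using True by (auto simp: M'_def)
  next
    case False
    then show ?thesis by (auto simp: M'_def)
  qed
  have av: "e \<inter> {a, a'} = {}" if "e \<in> M" for e
  proof (cases "e = {x, y}")
    case True
    show ?thesis unfolding True using ne(1,2) ne'(2,3) by blast
  next
    case False
    then show ?thesis using ME[OF that] by blast
  qed
  have xy: "e \<inter> {x, y} = {}" if "{x, y} \<in> M" "e \<in> M" "e \<noteq> {x, y}" for e
    using Md[OF that(2,1,3)] .
  have "matching G M'"
  proof (cases "{x, y} \<in> M")
    case True
    have sub: "M - {{x, y}} \<subseteq> edges G"
    proof
      fix e assume "e \<in> M - {{x, y}}"
      then show "e \<in> edges G" using ME[of e] by blast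
    qed
    have m1: "matching G (M - {{x, y}})"
      unfolding matching_def using sub Md by simp
    have fr: "f \<inter> {a, a'} = {} \<and> f \<inter> {x, y} = {}" if "f \<in> M - {{x, y}}" for f
      using that av[of f] xy[OF True, of f] by simp
    have "{a', y} \<inter> f = {}" if "f \<in> M - {{x, y}}" for f
      using fr[OF that] by blast
    from matching_insert[OF m1 eG(3) this]
    have m2: "matching G (insert {a', y} (M - {{x, y}}))" .
    have "{a, x} \<inter> {a', y} = {}" using ne(1-3) ne'(1-3) by blast
    then have "{a, x} \<inter> f = {}" if "f \<in> insert {a', y} (M - {{x, y}})" for f
      using fr[of f] that by blast
    from matching_insert[OF m2 eG(2) this] show ?thesis using True by (simp add: M'_def)
  next
    case False
    have "e \<in> edges G" if "e \<in> M" for e using ME[OF that] that False by blast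
    then have m: "matching G M" unfolding matching_def using Md by blast
    have "{a, a'} \<inter> f = {}" if "f \<in> M" for f using av[OF that] by (simp add: Int_commute)
    from matching_insert[OF m eG(1) this] show ?thesis using False by (simp add: M'_def)
  qed
  moreover have "e \<inter> \<Union>M' \<noteq> {}" if "e \<in> edges G" for e
  proof (cases "e \<inter> {a, a'} = {}")
    case True
    from cov[OF that True] show ?thesis unfolding U by blast
  next
    case False
    then show ?thesis unfolding U by blast
  qed
  moreover have "card M' \<le> card M + 1"
  proof -
    have c: "card (insert e S) \<le> card S + 1" if "finite S" for e and S :: "'a set set"
      using that by (simp add: card_insert_if)
    show ?thesis
    proof (cases "{x, y} \<in> M")
      case True
      have f: "finite (M - {{x, y}})" "finite (insert {a', y} (M - {{x, y}}))" using finM by simp_all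
      have "card (M - {{x, y}}) + 1 = card M" using card_Suc_Diff1[OF finM True] by simp
      then show ?thesis using c[OF f(2), of "{a, x}"] c[OF f(1), of "{a', y}"] True by (simp add: M'_def)
    next
      case False
      then show ?thesis using c[OF finM] by (simp add: M'_def)
    qed
  qed
  ultimately have "covering_matching G M'" "6 * int (card M') \<le> z + 6"
    using M(2) unfolding covering_matching_def by simp_all
  then show ?thesis unfolding bnd_def by blast
qed

lemma subcubic_rewire: "subcubic G \<Longrightarrow> subcubic (rewire G a a' x y)"
  unfolding subcubic_nbr[OF G] subcubic_nbr[OF simple] using le_trans[OF card_nbr_rewire_le] by blast

end

lemma phi_empty [simp]: "simple_graph G \<Longrightarrow> phi (ind G {}) = 0"
proof -
  assume G: "simple_graph G"
  have "{e \<in> edges G. e \<subseteq> {}} = {}" using G by (auto simp: simple_graph_def)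
  then show ?thesis by (simp add: phi_def)
qed

lemma phi_remove:
  assumes G: "simple_graph G" and x: "x \<in> K" and K: "K \<subseteq> verts G"
  shows "phi (ind G K) = phi (ind G (K - {x})) + 4 - int (card (nbr G x \<inter> K))"
proof -
  have fin: "finite K" using G K by (auto simp: simple_graph_def dest: finite_subset)
  have "{e \<in> edges G. e \<subseteq> K} = {e \<in> edges G. e \<subseteq> K - {x}} \<union> (\<lambda>u. {x, u}) ` (nbr G x \<inter> K)" (is "?A = ?B \<union> ?C")
  proof
    show "?A \<subseteq> ?B \<union> ?C"
    proof
      fix e assume e: "e \<in> ?A"
      show "e \<in> ?B \<union> ?C"
      proof (cases "x \<in> e")
        case True
        obtain u w where uw: "e = {u, w}" "w \<in> nbr G u" using e by (auto elim: edge_pair[OF G])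
        then have "e = {x, w} \<and> w \<in> nbr G x \<or> e = {x, u} \<and> u \<in> nbr G x"
          using True nbr_symD[OF uw(2)] by (auto simp: insert_commute)
        then show ?thesis using e by blast
      qed (use e in auto)
    qed
    show "?B \<union> ?C \<subseteq> ?A" using x by (auto simp: nbr_def)
  qed
  moreover have "?B \<inter> ?C = {}" by auto
  moreover have "card ?C = card (nbr G x \<inter> K)"
    by (rule card_image) (auto simp: inj_on_def doubleton_eq_iff)
  ultimately have "card ?A = card ?B + card (nbr G x \<inter> K)"
    using finite_edges[OF G] nbr_props(4)[OF G] by (simp add: card_Un_disjoint)
  moreover have "card K = card (K - {x}) + 1"
    using card_Suc_Diff1[OF fin x] by simp
  ultimately show ?thesis by (simp add: phi_def)
qed

text \<open>Counts each edge meeting the list at its first end in the list.\<close>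

primrec budget :: "'a ugraph \<Rightarrow> 'a set \<Rightarrow> 'a list \<Rightarrow> nat" where
  "budget G S [] = 0"
| "budget G S (x # xs) = card (nbr G x - S) + budget G (insert x S) xs"

lemma meet_budget: "simple_graph G \<Longrightarrow> meet G (S \<union> set xs) \<le> meet G S + budget G S xs"
proof (induction xs arbitrary: S)
  case (Cons x xs)
  have "meet G (insert x S \<union> set xs) \<le> meet G (insert x S) + budget G (insert x S) xs"
    using Cons by blast
  also have "meet G (insert x S) \<le> meet G S + card (nbr G x - S)"
    by (rule meet_insert[OF Cons.prems])
  finally show ?case by simp
qed simp

lemma meet_le_budget: "simple_graph G \<Longrightarrow> meet G (set xs) \<le> budget G {} xs"
  using meet_budget[of G "{}" xs] by simp

definition add_edges :: "'a ugraph \<Rightarrow> 'a set \<Rightarrow> 'a set set \<Rightarrow> 'a ugraph" where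
  "add_edges G W T = \<lparr> verts = W, edges = T \<union> {e \<in> edges G. e \<subseteq> W} \<rparr>"

lemma adj_rel_ind_mono: "adj_rel (ind G W) \<subseteq> adj_rel (add_edges G W T)"
  by (auto simp: adj_rel_def add_edges_def)

lemma reach_add: "(x, y) \<in> (adj_rel (ind G W))\<^sup>* \<Longrightarrow> (x, y) \<in> (adj_rel (add_edges G W T))\<^sup>*"
  using rtrancl_mono[OF adj_rel_ind_mono] by blast

lemma degree_add_other: "w \<notin> \<Union>T \<Longrightarrow> degree (add_edges G W T) w = degree (ind G W) w"
proof -
  assume "w \<notin> \<Union>T"
  then have "{e \<in> edges (add_edges G W T). w \<in> e} = {e \<in> edges (ind G W). w \<in> e}"
    by (auto simp: add_edges_def)
  then show ?thesis by (simp add: degree_def)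
qed

lemma deficient_add:
  assumes W: "deficient (ind G W)"
    and T: "\<And>u. u \<in> \<Union>T \<Longrightarrow> \<exists>z\<in>W. (u, z) \<in> (adj_rel (add_edges G W T))\<^sup>* \<and> degree (add_edges G W T) z \<le> 2"
  shows "deficient (add_edges G W T)"
  unfolding deficient_def
proof
  let ?F = "add_edges G W T"
  fix u assume "u \<in> verts ?F"
  then have "u \<in> W" by (simp add: add_edges_def)
  then obtain w where w: "w \<in> W" "(u, w) \<in> (adj_rel (ind G W))\<^sup>*" "degree (ind G W) w \<le> 2"
    using W by (auto simp: deficient_def)
  from reach_add[OF w(2)] have r: "(u, w) \<in> (adj_rel ?F)\<^sup>*" .
  show "\<exists>w\<in>verts ?F. (u, w) \<in> (adj_rel ?F)\<^sup>* \<and> degree ?F w \<le> 2"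
  proof (cases "w \<in> \<Union>T")
    case True
    from T[OF this] r show ?thesis by (auto simp: add_edges_def intro: rtrancl_trans)
  next
    case False
    then show ?thesis using w r degree_add_other[OF False, of G W] by (auto simp: add_edges_def)
  qed
qed

section \<open>Minimal counterexamples\<close>

locale min_counterexample =
  fixes G :: "'a ugraph"
  assumes G: "simple_graph G" and sc: "subcubic G" and dG: "deficient G"
    and no_bnd: "\<not> bnd G (phi G)"
    and IH: "\<And>H :: 'a ugraph. simple_graph H \<Longrightarrow> subcubic H \<Longrightarrow> deficient H \<Longrightarrow>
      card (verts H) < card (verts G) \<Longrightarrow> bnd H (phi H)"
begin

abbreviation N :: "'a \<Rightarrow> 'a set" where "N \<equiv> nbr G"

lemma finite_verts: "finite (verts G)"
  using G by (simp add: simple_graph_def)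

lemma fin: "finite (N v)"
  using nbr_props(4)[OF G] .

lemma card3: "card (N v) \<le> 3"
  using sc subcubic_nbr[OF G] by blast

lemma sym: "u \<in> N v \<Longrightarrow> v \<in> N u"
  by (rule nbr_symD)

lemma inV: "u \<in> N v \<Longrightarrow> u \<in> verts G"
  using nbr_props[OF G] by blast

lemma irr [simp]: "v \<notin> N v"
  using nbr_props(1)[OF G] by blast

lemma ind_bnd:
  assumes "W \<subset> verts G"
  shows "bnd (ind G W) (phi (ind G W) - phi (ind G W) mod 6)"
proof -
  have "card W < card (verts G)" using assms finite_verts psubset_card_mono by blast
  then have "bnd (ind G W) (phi (ind G W))"
    using IH[of "ind G W"] simple_ind[OF G] subcubic_ind[OF G sc] deficient_ind[OF G sc dG] assms by auto
  then show ?thesis by (rule bnd_minus_mod)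
qed

lemma parity:
  assumes c: "config G ps js" and ne: "ps \<noteq> [] \<or> js \<noteq> []"
    and KQ: "K \<union> Q = verts G - set (flat ps) - set js" "K \<inter> Q = {}"
    and sep: "\<And>u. u \<in> K \<Longrightarrow> N u \<inter> Q = {}"
  shows "phi (ind G K) mod 6 + phi (ind G Q) mod 6 <
    int (meet G (set (flat ps))) - 2 * int (length ps) - 4 * int (length js)"
proof (rule ccontr)
  assume n: "\<not> ?thesis"
  interpret split_config G ps js K Q
    using G c KQ sep by unfold_locales
  obtain z where z: "z \<in> set (flat ps) \<union> set js"
    using ne by (cases ps; cases js) fastforce+
  then have "z \<in> verts G" using flat_subset c by (auto simp: config_def)
  then have "K \<subset> verts G" "Q \<subset> verts G" using KQ z by blast+
  from bnd_split[OF ind_bnd[OF this(1)] ind_bnd[OF this(2)]]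
  have "bnd G (phi G)" by (rule bnd_mono) (use n phi_split in linarith)
  with no_bnd show False by blast
qed

lemma no_reduction:
  assumes c: "config G ps js" and ne: "ps \<noteq> [] \<or> js \<noteq> []"
    and m: "budget G {} (flat ps) \<le> 2 * length ps + 4 * length js"
  shows False
proof -
  have "0 \<le> phi (ind G (verts G - set (flat ps) - set js)) mod 6" by simp
  then show False
    using parity[OF c ne, of "verts G - set (flat ps) - set js" "{}"] meet_le_budget[OF G, of "flat ps"] m G
    by simp
qed

text \<open>Deleting one more vertex of degree 2 from \<open>K\<close> changes \<open>phi\<close> by 2, so the two residues bounded by
  \<open>parity\<close> cannot both be small.\<close>

lemma swap_parity:
  assumes c: "config G ps js" "ps \<noteq> [] \<or> js \<noteq> []"
    and KQ: "K \<union> Q = verts G - set (flat ps) - set js" "K \<inter> Q = {}"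
    "\<And>u. u \<in> K \<Longrightarrow> N u \<inter> Q = {}"
    and m: "meet G (set (flat ps)) \<le> 2 * length ps + 4 * length js + 2"
    and c': "config G ps' js'" "ps' \<noteq> [] \<or> js' \<noteq> []"
    and KQ': "(K - {x}) \<union> Q' = verts G - set (flat ps') - set js'" "(K - {x}) \<inter> Q' = {}"
      "\<And>u. u \<in> K - {x} \<Longrightarrow> N u \<inter> Q' = {}"
    and m': "meet G (set (flat ps')) \<le> 2 * length ps' + 4 * length js' + 4"
    and x: "x \<in> K" "card (N x \<inter> K) = 2"
  shows False
proof -
  have "K \<subseteq> verts G" using KQ by blast
  then have p: "phi (ind G K) = phi (ind G (K - {x})) + 2" using phi_remove[OF G x(1)] x(2) by simp
  have "phi (ind G Q) mod 6 \<ge> 0" "phi (ind G Q') mod 6 \<ge> 0" by simp_all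
  then have "phi (ind G K) mod 6 < 2" "phi (ind G (K - {x})) mod 6 < 4"
    using parity[OF c KQ] m parity[OF c' KQ'] m' by linarith+
  with p show False by presburger
qed

lemma le2: "u \<in> N x \<Longrightarrow> u \<in> S \<Longrightarrow> card (N x - S) \<le> 2"
proof -
  assume "u \<in> N x" "u \<in> S"
  then have "N x - S \<subset> N x" by blast
  from psubset_card_mono[OF fin this] card3[of x] show ?thesis by simp
qed

lemma le3: "card (N x - S) \<le> 3"
  using card_mono[OF fin Diff_subset, of x S] card3[of x] by simp

lemma le1: "u \<in> N x \<Longrightarrow> w \<in> N x \<Longrightarrow> u \<noteq> w \<Longrightarrow> u \<in> S \<Longrightarrow> w \<in> S \<Longrightarrow> card (N x - S) \<le> 1"
proof -
  assume a: "u \<in> N x" "w \<in> N x" "u \<noteq> w" "u \<in> S" "w \<in> S"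
  then have "N x - S \<subseteq> N x - {u, w}" by blast
  then have "card (N x - S) \<le> card (N x - {u, w})" using fin by (simp add: card_mono)
  also have "\<dots> = card (N x) - card {u, w}" using a by (intro card_Diff_subset) auto
  finally show ?thesis using a card3[of x] by simp
qed

text \<open>The vertices of \<open>js\<close> stay in the graph until the last step, as isolated vertices.\<close>
lemma one_edge:
  assumes c: "config G ((a, a') # ps) js"
    and xy: "x \<in> N a" "y \<in> N a'" "x \<noteq> y" "y \<notin> N x"
    and W: "W = verts G - set (flat ((a, a') # ps)) - set js" "x \<in> W" "y \<in> W"
    and m: "meet G (set (flat ((a, a') # ps))) \<le> 2 * length ps + 4 * length js + 3"
  shows "\<not> deficient (add_edges G W {{x, y}})"
proof
  let ?F = "add_edges G W {{x, y}}"
  assume dF: "deficient ?F"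
  have d: "distinct (a # a' # flat ps @ js)" and aa': "a' \<in> N a"
    and js: "\<And>i. i \<in> set js \<Longrightarrow> N i \<subseteq> {a, a'} \<union> set (flat ps)"
    using c by (auto simp: config_def)
  interpret A: split_config G "(a, a') # ps" js W "{}"
    using G c W by unfold_locales auto
  let ?K = "verts G - set (flat ps)"
  interpret B: split_config G ps "[]" ?K "{}"
    using G c by unfold_locales (auto simp: config_def)
  let ?H = "ind G ?K"
  have H: "simple_graph ?H" using simple_ind[OF G] by blast
  have inK: "a \<in> ?K" "a' \<in> ?K" "x \<in> ?K" "y \<in> ?K"
    using d W A.flat_subset by auto
  interpret R: rewiring ?H a a' x y
    using H aa' xy W d inK by unfold_locales (auto simp: nbr_ind)
  let ?R = "rewire ?H a a' x y"
  have eR: "edges ?R = insert {x, y} {e \<in> edges G. e \<subseteq> ?K \<and> e \<inter> {a, a'} = {}}"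
    by (auto simp: rewire_def)
  have js': "N i \<inter> (?K - {a, a'}) = {}" if "i \<in> set js" for i using js[OF that] by blast
  have eW: "{e \<in> edges G. e \<subseteq> ?K \<and> e \<inter> {a, a'} = {}} = {e \<in> edges G. e \<subseteq> W}"
  proof (intro equalityI subsetI)
    fix e assume e: "e \<in> {e \<in> edges G. e \<subseteq> ?K \<and> e \<inter> {a, a'} = {}}"
    obtain u w where uw: "e = {u, w}" "w \<in> N u" using e edge_pair[OF G, of e]
      by (metis (lifting) mem_Collect_eq)
    with e have "u \<notin> set js" "w \<notin> set js" using js'[of u] js'[of w] sym[OF uw(2)] by auto
    then show "e \<in> {e \<in> edges G. e \<subseteq> W}" using e uw W by auto
  qed (use W in auto)
  interpret C: split_config ?R "[]" js W "{}"
  proof unfold_locales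
    show "simple_graph ?R" by (rule R.simple)
    have "nbr ?R i = {}" "i \<in> verts ?R" if i: "i \<in> set js" for i
    proof -
      have iK: "i \<in> ?K - {a, a'}" and ixy: "i \<noteq> x" "i \<noteq> y" using i d c W
        by (auto simp: config_def)
      then show "i \<in> verts ?R" by (simp add: rewire_def)
      have "nbr ?H i - {a, a'} = {}" using js'[OF i] nbr_ind[of i ?K G] iK by blast
      then show "nbr ?R i = {}" unfolding R.nbr_rewire using ixy iK by simp
    qed
    then show "config ?R [] js" using d by (simp add: config_def)
    show "W \<union> {} = verts ?R - set (flat []) - set js" using W by (auto simp: rewire_def)
  qed auto
  have "{e \<in> edges ?R. e \<subseteq> W} = {{x, y}} \<union> {e \<in> edges G. e \<subseteq> W}"
    using W(2,3) unfolding eR eW by blast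
  then have RF: "ind ?R W = ?F"
    by (simp only: ind_def[of ?R W] add_edges_def)
  have WR: "W \<subseteq> verts ?R" using W by (auto simp: rewire_def)
  have FF: "simple_graph ?F" "subcubic ?F"
    using simple_ind[OF R.simple WR] subcubic_ind[OF R.simple _ WR] R.subcubic_rewire[OF subcubic_ind[OF G sc]]
    unfolding RF by blast+
  have "card W < card (verts G)"
    using W A.flat_subset finite_verts by (intro psubset_card_mono) auto
  then have bF: "bnd (ind ?R W) (phi ?F)"
    using IH[OF FF dF] unfolding RF by (simp add: add_edges_def)
  from C.bnd_split[OF bF bnd_ind_empty[OF R.simple]] have "bnd ?R (phi ?F)" by simp
  from R.bnd_rewire[OF this] have "bnd ?H (phi ?F + 6)" .
  from B.bnd_split[OF this bnd_ind_empty[OF G]] have b: "bnd G (6 * int (length ps) + (phi ?F + 6) + 0)" .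
  have "{x, y} \<notin> edges G" using xy by (simp add: nbr_def)
  then have "phi ?F = phi (ind G W) - 1"
    using W(2,3) finite_edges[OF G] by (simp add: phi_def add_edges_def)
  then have "6 * int (length ps) + (phi ?F + 6) + 0 \<le> phi G"
    using A.phi_split m G by simp
  with b bnd_mono no_bnd show False by blast
qed

lemma one_edge_reach:
  assumes c: "config G ((a, a') # ps) js"
    and xy: "x \<in> N a" "y \<in> N a'" "x \<noteq> y" "y \<notin> N x"
    and W: "W = verts G - set (flat ((a, a') # ps)) - set js" "x \<in> W" "y \<in> W"
    and m: "meet G (set (flat ((a, a') # ps))) \<le> 2 * length ps + 4 * length js + 3"
    and r: "(x, z) \<in> (adj_rel (ind G W))\<^sup>* \<or> (y, z) \<in> (adj_rel (ind G W))\<^sup>*"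
    and z: "z \<in> W"
  shows "card (N z \<inter> W) = (if z = x \<or> z = y then 2 else 3)"
proof -
  let ?F = "add_edges G W {{x, y}}"
  have WV: "W \<subseteq> verts G" using W by blast
  have F: "\<not> deficient ?F" using one_edge[OF c xy W m] .
  have xyF: "(x, y) \<in> adj_rel ?F" "(y, x) \<in> adj_rel ?F"
    by (auto simp: adj_rel_def add_edges_def insert_commute)
  have "degree ?F z \<ge> 3"
  proof (rule ccontr)
    assume d: "\<not> degree ?F z \<ge> 3"
    have "(x, z) \<in> (adj_rel ?F)\<^sup>*" "(y, z) \<in> (adj_rel ?F)\<^sup>*"
      using r reach_add[of _ z G W "{{x, y}}"] xyF by (meson converse_rtrancl_into_rtrancl)+
    then have "deficient ?F"
      by (intro deficient_add deficient_ind[OF G sc dG WV]) (use d z in auto)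
    with F show False by blast
  qed
  have sF: "simple_graph ?F"
    using G W xy finite_subset[OF WV finite_verts] by (auto simp: simple_graph_def add_edges_def)
  have nF: "nbr ?F z = (N z \<inter> W) \<union> (if z = x then {y} else if z = y then {x} else {})"
    using W z xy(3) by (auto simp: nbr_def add_edges_def doubleton_eq_iff)
  have c3: "card (nbr ?F z) \<ge> 3" using \<open>degree ?F z \<ge> 3\<close> degree_nbr[OF sF] by simp
  have ax: "a \<in> N x" "a' \<in> N y" using xy sym by blast+
  have aW: "a \<notin> W" "a' \<notin> W" using W by auto
  have "card (N z \<inter> W) \<le> 3" using card_mono[OF fin Int_lower1, of z W] card3[of z] by simp
  moreover have "card (N z \<inter> W) \<le> 2" if "u \<in> N z" "u \<notin> W" for u
  proof -
    have "N z \<inter> W \<subset> N z" using that by blast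
    from psubset_card_mono[OF fin this] card3[of z] show ?thesis by simp
  qed
  moreover have "card (nbr ?F z) \<le> card (N z \<inter> W) + (if z = x \<or> z = y then 1 else 0)"
    unfolding nF using fin[of z] by (auto simp: card_insert_if)
  ultimately have "card (N z \<inter> W) \<le> 3"
    "z = x \<or> z = y \<Longrightarrow> card (N z \<inter> W) \<le> 2"
    "card (N z \<inter> W) + (if z = x \<or> z = y then 1 else 0) \<ge> 3"
    using c3 ax aW by (blast, blast, linarith)
  then show ?thesis by (cases "z = x \<or> z = y") auto
qed

lemma reach_step:
  assumes "(x, z) \<in> (adj_rel (ind G W))\<^sup>*" "z \<in> W" "u \<in> N z" "u \<in> W"
  shows "(x, u) \<in> (adj_rel (ind G W))\<^sup>*"
proof -
  have "(z, u) \<in> adj_rel (ind G W)" using assms(3,4) nbr_ind[OF assms(2), of G] by (simp add: adj_rel_iff)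
  with assms(1) show ?thesis by (rule rtrancl_into_rtrancl)
qed

lemma neq: "u \<in> N v \<Longrightarrow> u \<noteq> v"
  by auto

lemma deg_pos: "v \<in> verts G \<Longrightarrow> N v \<noteq> {}"
  using no_reduction[of "[]" "[v]"] by (auto simp: config_def)

lemma deg_ge2:
  assumes "v \<in> verts G"
  shows "2 \<le> card (N v)"
proof (rule ccontr)
  assume "\<not> 2 \<le> card (N v)"
  moreover have "card (N v) \<noteq> 0" using deg_pos[OF assms] fin by simp
  ultimately have "card (N v) = 1" by simp
  then obtain w where w: "N v = {w}" by (auto simp: card_1_singleton_iff)
  then have vw: "v \<in> N w" "w \<in> N v" using sym by blast+
  show False
  proof (cases "N w = {v}")
    case True
    show ?thesis by (rule no_reduction[of "[(v, w)]" "[]"]) (use w True neq[OF vw(1)] in \<open>auto simp: config_def\<close>)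
  next
    case False
    then obtain a where a: "a \<in> N w" "a \<noteq> v" using vw by blast
    have "card (N w) \<le> 3" "card (N a - {w}) \<le> 2" using card3 le2[OF sym[OF a(1)]] by simp_all
    then show ?thesis
      using no_reduction[of "[(w, a)]" "[v]"] w a vw neq[OF a(1)] neq[OF vw(1)] assms by (auto simp: config_def)
  qed
qed

lemma one_known:
  assumes "u \<in> N x"
  obtains t where "N x = {u, t}" "t \<noteq> u" | t s where "N x = {u, t, s}" "t \<noteq> u" "s \<noteq> u"
    "s \<noteq> t"
proof -
  have "2 \<le> card (N x)" "card (N x) \<le> 3" using deg_ge2[of x] inV[OF sym[OF assms]] card3 by auto
  moreover have c: "card (N x) = card (N x - {u}) + 1" using card_Suc_Diff1[OF fin assms] by simp
  ultimately consider "card (N x - {u}) = 1" | "card (N x - {u}) = 2" by linarith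
  then show thesis
  proof cases
    case 1
    then obtain t where "N x - {u} = {t}" by (auto simp: card_1_singleton_iff)
    then have "N x = {u, t}" "t \<noteq> u" using assms by auto
    then show ?thesis using that(1) by blast
  next
    case 2
    then obtain t s where "N x - {u} = {t, s}" "t \<noteq> s" by (auto simp: card_2_iff)
    then have "N x = {u, t, s}" "t \<noteq> u" "s \<noteq> u" "s \<noteq> t" using assms by auto
    then show ?thesis using that(2) by blast
  qed
qed

lemma two_known:
  assumes "u \<in> N x" "w \<in> N x" "u \<noteq> w"
  obtains "N x = {u, w}" | t where "N x = {u, w, t}" "t \<noteq> u" "t \<noteq> w"
proof (rule one_known[OF assms(1)])
  fix t assume "N x = {u, t}"
  with assms have "N x = {u, w}" by auto
  then show thesis using that by blast
next
  fix t s assume t: "N x = {u, t, s}" "t \<noteq> u" "s \<noteq> u" "s \<noteq> t"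
  with assms have "w = t \<or> w = s" by auto
  then show thesis using that(2)[of s] that(2)[of t] t by (auto simp: insert_commute)
qed

lemma three_known:
  assumes "u \<in> N x" "w \<in> N x" "t \<in> N x" "u \<noteq> w" "t \<noteq> u" "t \<noteq> w"
  shows "N x = {u, w, t}"
  by (rule two_known[OF assms(1,2,4)]) (use assms in auto)

lemma no_triangle_deg2:
  assumes v: "N v = {a, b}" "a \<noteq> b"
  shows "b \<notin> N a"
proof
  assume ab: "b \<in> N a"
  have va: "v \<in> N a" "v \<in> N b" using v sym by blast+
  have "card (N a) \<le> 3" "card (N b - {a}) \<le> 2" using card3 le2[OF sym[OF ab]] by simp_all
  then show False
    using no_reduction[of "[(a, b)]" "[v]"] v ab va neq[OF va(1)] neq[OF va(2)] inV by (auto simp: config_def)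
qed

lemma square_deg2_aux:
  assumes v: "N v = {a, b}" "a \<noteq> b" and w: "w \<noteq> v" "w \<in> N a" "w \<in> N b"
    and b: "N b = {v, w, b'}" "b' \<noteq> v" "b' \<noteq> w"
  shows "card (N a) = 3 \<and> card (N w) = 3 \<and> card (N b') = 3 \<and> a \<notin> N b' \<and> w \<notin> N b'"
proof (rule ccontr)
  assume n: "\<not> ?thesis"
  have va: "v \<in> N a" "v \<in> N b" and ab: "b \<notin> N a" "a \<notin> N b"
    using v sym no_triangle_deg2[OF v] by blast+
  have wa: "a \<in> N w" "b \<in> N w" "b \<in> N b'" using w b sym by blast+
  have d: "distinct [a, w, b, b', v]"
    using v w b ab va neq by auto
  have 1: "card (N w - {a}) = card (N w) - 1" using wa fin by simp
  have 2: "card (N b - {w, a}) \<le> 2" by (rule le2[of w]) (use w in auto)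
  have 3: "card (N b' - {b, w, a}) \<le> card (N b') - 1"
  proof -
    have "N b' - {b, w, a} \<subseteq> N b' - {b}" by blast
    then have "card (N b' - {b, w, a}) \<le> card (N b' - {b})" using fin by (simp add: card_mono)
    then show ?thesis using wa fin by simp
  qed
  have 4: "card (N b' - {b, w, a}) \<le> 1" if "a \<in> N b' \<or> w \<in> N b'"
    using that le1[of b b' a "{b, w, a}"] le1[of b b' w "{b, w, a}"] wa d by auto
  have 5: "card (N a) \<le> 3" "card (N w) \<le> 3" "card (N b') \<le> 3" "2 \<le> card (N a)"
    "2 \<le> card (N w)" "2 \<le> card (N b')"
    using card3 deg_ge2 inV[OF va(1)] inV[OF sym[OF va(1)]] inV[OF sym[OF wa(1)]] inV[OF sym[OF wa(3)]] by auto
  have "budget G {} [a, w, b, b'] \<le> 8"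
    using 1 2 3 4 5 n by auto
  then show False
    using no_reduction[of "[(a, w), (b, b')]" "[v]"] d w b v inV[OF va(1)] by (auto simp: config_def)
qed

lemma square_deg2_rewire:
  assumes v: "N v = {a, b}" "a \<noteq> b" and w: "w \<noteq> v" "N w = {a, b, w'}" "w' \<noteq> a" "w' \<noteq> b"
    and a: "N a = {v, w, a'}" "a' \<noteq> v" "a' \<noteq> w"
    and b: "N b = {v, w, b'}" "b' \<noteq> v" "b' \<noteq> w"
    and o: "a' \<noteq> b'" "w' \<noteq> a'" "w' \<noteq> b'" "w \<notin> N b'" "w \<notin> N a'"
    "a \<notin> N b'" "b \<notin> N a'"
  shows "w' \<in> N a'"
proof (rule ccontr)
  assume n: "w' \<notin> N a'"
  have mem: "v \<in> N a" "w \<in> N a" "a' \<in> N a" "v \<in> N b" "w \<in> N b" "b' \<in> N b" "w' \<in> N w"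
    using w a b by simp_all
  have ab: "b \<notin> N a" using no_triangle_deg2[OF v] .
  then have ba: "a \<notin> N b" using sym by blast
  have ad: "v \<in> N a" "v \<in> N b" "a \<in> N a'" "b \<in> N b'" "w \<in> N w'" using mem sym by blast+
  have dd: "a' \<noteq> b" "b' \<noteq> a" using ab ba mem by blast+
  have d: "distinct [a, w, b, b', v]" "distinct [a, a', b, w, v]"
    using v(2) w(1) a(2,3) b(2,3) dd neq[OF mem(1)] neq[OF mem(2)] neq[OF mem(3)] neq[OF mem(4)] neq[OF mem(5)]
      neq[OF mem(6)] by simp_all
  have w'v: "w' \<noteq> v"
  proof
    assume "w' = v"
    with ad(5) v(1) d show False by simp
  qed
  let ?W = "verts G - set (flat [(a, w), (b, b')]) - set [v]"
  have vV: "v \<in> verts G" using inV[OF ad(1)] .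
  have c: "config G [(a, w), (b, b')] [v]" "config G [(a, a'), (b, w)] [v]"
    using d mem v(1) vV by (simp_all add: config_def)
  note c' = c(2) and c = c(1)
  have m: "meet G (set (flat [(a, w), (b, b')])) \<le> 9"
  proof -
    have "card (N a) \<le> 3" "card (N w - {a}) \<le> 2" "card (N b - {w, a}) \<le> 2"
      "card (N b' - {b, w, a}) \<le> 2"
      using card3 le2[of a w] le2[of w b] le2[of b b'] w(2) b(1) ad by simp_all
    then show ?thesis using meet_le_budget[OF G, of "flat [(a, w), (b, b')]"] by simp
  qed
  have m': "meet G (set (flat [(a, a'), (b, w)])) \<le> 12"
    using meet_le_budget[OF G, of "flat [(a, a'), (b, w)]"] le3[of a "{}"] le3[of a' "{a}"] le3[of b "{a', a}"]
    le3[of w "{b, a', a}"] by simp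
  have xW: "a' \<in> ?W" "w' \<in> ?W"
    using inV[OF mem(3)] inV[OF mem(7)] d dd(1) o(1-3) w'v w(3,4) a(2,3) neq[OF mem(7)] by auto
  note R = one_edge_reach[OF c _ _ _ n refl xW]
  define K where "K = {z \<in> ?W. (a', z) \<in> (adj_rel (ind G ?W))\<^sup>* \<or> (w', z) \<in> (adj_rel (ind G ?W))\<^sup>*}"
  have KW: "K \<subseteq> ?W" by (auto simp: K_def)
  have aK: "a' \<in> K" "w' \<in> K" using xW by (auto simp: K_def)
  have Kcl: "u \<in> K" if "z \<in> K" "u \<in> N z" "u \<in> ?W" for u z
    using that reach_step[of _ z ?W u] unfolding K_def by blast
  have cK: "card (N z \<inter> ?W) = (if z = a' \<or> z = w' then 2 else 3)" if "z \<in> K" for z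
    using R[of z] that m mem o(2) unfolding K_def by simp
  have full: "N z \<subseteq> ?W" if "z \<in> K" "z \<noteq> a'" "z \<noteq> w'" for z
  proof -
    have "N z \<inter> ?W = N z" using cK[OF that(1)] that card3[of z] fin
      by (intro card_seteq) auto
    then show ?thesis by blast
  qed
  have w'3: "N w' \<subseteq> insert w ?W"
  proof (rule ccontr)
    assume "\<not> ?thesis"
    then obtain u where u: "u \<in> N w'" "u \<noteq> w" "u \<notin> ?W" by blast
    have "N w' \<inter> ?W \<subseteq> N w' - {u, w}" using u by auto
    then have "card (N w' \<inter> ?W) \<le> card (N w' - {u, w})" using fin by (simp add: card_mono)
    also have "\<dots> \<le> 1" using le1[of u w' w "{u, w}"] u ad by simp
    finally show False using cK[OF aK(2)] by simp
  qed
  have b'W: "b' \<in> verts G" using inV[OF mem(6)] .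
  show False
  proof (rule swap_parity[OF c _ _ _ _ _ c', of K "?W - K" a' "insert b' (?W - K)"])
    show "u \<in> K \<Longrightarrow> N u \<inter> (?W - K) = {}" for u using Kcl[of u] by blast
    show "(K - {a'}) \<union> insert b' (?W - K) = verts G - set (flat [(a, a'), (b, w)]) - set [v]"
      using KW aK o d dd b'W b by auto
    show "(K - {a'}) \<inter> insert b' (?W - K) = {}" using KW by auto
    fix u assume u: "u \<in> K - {a'}"
    have "b' \<notin> N u"
    proof (cases "u = w'")
      case True
      then show ?thesis using w'3 d by auto
    next
      case False
      then show ?thesis using full[of u] u by auto
    qed
    then show "N u \<inter> insert b' (?W - K) = {}" using Kcl[of u] u by blast
  next
    have "N a' \<inter> K = N a' \<inter> ?W" using Kcl[OF aK(1)] KW by blast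
    then show "card (N a' \<inter> K) = 2" using cK[OF aK(1)] by simp
  qed (use KW aK m m' in auto)
qed

lemma no_square_deg2:
  assumes v: "N v = {a, b}" "a \<noteq> b" and w: "w \<noteq> v" "w \<in> N a" "w \<in> N b"
  shows False
proof -
  have ad: "v \<in> N a" "v \<in> N b" "a \<in> N w" "b \<in> N w" and ab: "b \<notin> N a" "a \<notin> N b"
    using v w sym no_triangle_deg2[OF v] by blast+
  have vV: "v \<in> verts G" using inV[OF ad(1)] .
  have d: "distinct [v, a, w, b]"
    using v(2) w(1) neq[OF ad(1)] neq[OF ad(2)] neq[OF ad(3)] neq[OF ad(4)] by simp
  show False
  proof (cases "N a = {v, w} \<and> N b = {v, w}")
    case True
    show False
    proof (rule two_known[OF ad(3,4) v(2)])
      assume "N w = {a, b}"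
      then show False using no_reduction[of "[(v, a), (w, b)]" "[]"] True d v
        by (auto simp: config_def insert_Diff_if)
    next
      fix t assume t: "N w = {a, b, t}" "t \<noteq> a" "t \<noteq> b"
      have tw: "w \<in> N t" using sym[of t w] t(1) by simp
      have "w \<notin> N v" using v d by auto
      with tw have tv: "t \<noteq> v" by blast
      have "card (N w) \<le> 3" "card (N t - {w}) \<le> 2" "card (N v - {t, w}) \<le> 2"
        "card (N a - {v, t, w}) = 0"
        using card3 le2[OF tw] card_mono[of "{a, b}" "{a, b} - {t, w}"] v True by simp_all
      moreover have "config G [(w, t), (v, a)] [b]"
        using d tv t(2,3) True t(1) v neq[OF tw] inV[OF ad(4)] by (auto simp: config_def)
      ultimately show False using no_reduction[of "[(w, t), (v, a)]" "[b]"] by simp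
    qed
  next
    case False
    have *: "\<exists>a' b' w'. N a = {v, w, a'} \<and> N b = {v, w, b'} \<and> N w = {a, b, w'} \<and> a' \<noteq> v \<and> a' \<noteq> w \<and> b' \<noteq> v \<and> b' \<noteq> w \<and>
       w' \<noteq> a \<and> w' \<noteq> b \<and> card (N a') = 3 \<and> card (N b') = 3 \<and> a \<notin> N b' \<and> w \<notin> N b' \<and> b \<notin> N a' \<and> w \<notin> N a'"
    proof -
      have w3: "\<exists>w'. N w = {a, b, w'} \<and> w' \<noteq> a \<and> w' \<noteq> b" if "card (N w) = 3"
        by (rule two_known[OF ad(3,4) v(2)]) (use that v in auto)
      have v': "N v = {b, a}" "b \<noteq> a" using v by auto
      have A: "\<exists>a'. N a = {v, w, a'} \<and> a' \<noteq> v \<and> a' \<noteq> w" if "card (N a) = 3"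
        by (rule two_known[OF ad(1) w(2)]) (use that w in auto)
      have B: "\<exists>b'. N b = {v, w, b'} \<and> b' \<noteq> v \<and> b' \<noteq> w" if "card (N b) = 3"
        by (rule two_known[OF ad(2) w(3)]) (use that w in auto)
      have "card (N a) = 3 \<or> card (N b) = 3"
        by (rule two_known[OF ad(1) w(2)]; rule two_known[OF ad(2) w(3)]) (use False w in auto)
      then have 3: "card (N a) = 3" "card (N b) = 3"
        using A B square_deg2_aux[OF v w] square_deg2_aux[OF v' w(1,3,2)] by metis+
      obtain a' where a': "N a = {v, w, a'}" "a' \<noteq> v" "a' \<noteq> w" using A 3 by blast
      obtain b' where b': "N b = {v, w, b'}" "b' \<noteq> v" "b' \<noteq> w" using B 3 by blast
      show ?thesis
        using square_deg2_aux[OF v w b'] square_deg2_aux[OF v' w(1,3,2) a'] a' b' w3 by blast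
    qed
    then obtain a' b' w' where a: "N a = {v, w, a'}" "a' \<noteq> v" "a' \<noteq> w" and b: "N b = {v, w, b'}"
      "b' \<noteq> v" "b' \<noteq> w"
      and w': "N w = {a, b, w'}" "w' \<noteq> a" "w' \<noteq> b" and c: "card (N a') = 3" "card (N b') = 3"
      and o: "a \<notin> N b'" "w \<notin> N b'" "b \<notin> N a'" "w \<notin> N a'" by blast
    have mem: "a' \<in> N a" "b' \<in> N b" "w' \<in> N w" using a b w' by simp_all
    then have ad': "a \<in> N a'" "b \<in> N b'" "w \<in> N w'" using sym by blast+
    have o': "a' \<noteq> b'" "w' \<noteq> a'" "w' \<noteq> b'" using ad' o by metis+
    have "w' \<in> N a'" by (rule square_deg2_rewire[OF v w(1) w' a b]) (use o o' in simp_all)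
    moreover have "w' \<in> N b'"
      by (rule square_deg2_rewire[of v b a w w' b' a'])
        (use v w w' a b o o' in \<open>simp_all add: insert_commute\<close>)
    ultimately have w'n: "a' \<in> N w'" "b' \<in> N w'" using sym by blast+
    have Nw': "N w' = {w, a', b'}" using three_known[OF ad'(3) w'n] a(3) b(3) o'(1) by simp
    have "w \<notin> N v" using v d by auto
    then have "w' \<noteq> v" using ad'(3) by blast
    moreover have "a' \<noteq> b" "b' \<noteq> a" using ab mem by blast+
    ultimately have dd: "distinct [a, w, b, b', a', w', v]"
      using d a(2,3) b(2,3) w'(2,3) o' neq[OF mem(1)] neq[OF mem(2)] neq[OF mem(3)] by auto
    show False
    proof (cases "b' \<in> N a'")
      case True
      have n: "N a' = {a, w', b'}" "N b' = {b, w', a'}"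
        using three_known[of a a' w' b'] three_known[of b b' w' a'] ad' sym[OF w'n(1)] sym[OF w'n(2)] True
        sym[OF True] distinct_both[OF dd] by simp_all
      show False
        using no_reduction[of "[(a, w), (b, b'), (a', w')]" "[v]"] distinct_both[OF dd] v a b w' Nw' n vV
        by (simp add: config_def insert_Diff_if)
    next
      case False
      have "\<exists>\<alpha>. N a' = {a, w', \<alpha>} \<and> \<alpha> \<noteq> a \<and> \<alpha> \<noteq> w'"
        by (rule two_known[of a a' w']) (use ad' sym[OF w'n(1)] dd c in auto)
      then obtain \<alpha> where al: "N a' = {a, w', \<alpha>}" "\<alpha> \<noteq> a" "\<alpha> \<noteq> w'"
        by blast
      have al': "a' \<in> N \<alpha>" using al sym by blast
      have d2: "distinct [a, w, b, b', a', \<alpha>, v, w']"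
      proof -
        have "\<alpha> \<in> N a'" using al by simp
        then have "\<alpha> \<noteq> w" "\<alpha> \<noteq> b" "\<alpha> \<noteq> b'" "\<alpha> \<noteq> a'"
          using o False neq by blast+
        moreover have "a' \<notin> N v" using v dd by auto
        then have "\<alpha> \<noteq> v" using al' by blast
        ultimately show ?thesis using dd al(2,3) by auto
      qed
      have "card (N b' - {b, w, a}) \<le> 2" "card (N \<alpha> - {a', b', b, w, a}) \<le> 2"
        using le2[OF ad'(2)] le2[OF al'] by simp_all
      then show False
        using no_reduction[of "[(a, w), (b, b'), (a', \<alpha>)]" "[v, w']"] distinct_both[OF d2]
        v a b w' Nw' al vV inV[OF mem(3)]
        by (simp add: config_def insert_Diff_if)
    qed
  qed
qed

text \<open>If the rewired graph is not deficient, then the component of \<open>x\<close> is attached by one edge only, and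
  the pair \<open>(b, b')\<close> can be exchanged for \<open>(b, x)\<close>.\<close>

lemma one_side_aux:
  assumes c: "config G ((b, b') # ps) js" and js: "\<And>i. i \<in> set js \<Longrightarrow> b' \<notin> N i"
    and N: "x \<in> N b" "y \<in> N b'" "z \<in> N b'" "y \<noteq> z"
    and W: "W = verts G - set (flat ((b, b') # ps)) - set js" "x \<in> W" "y \<in> W" "z \<in> W"
    and ok: "y \<noteq> x" "y \<notin> N x"
    and m: "meet G (set (flat ((b, b') # ps))) \<le> 2 * length ps + 4 * length js + 3"
  shows False
proof -
  let ?r = "\<lambda>u w. (u, w) \<in> (adj_rel (ind G W))\<^sup>*"
  have xy: "x \<noteq> y" using ok by simp
  note R = one_edge_reach[OF c N(1,2) xy ok(2) W(1,2,3) m]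
  have sy: "b \<in> N x" "b' \<in> N y" "b' \<in> N z" using N sym by blast+
  have bW: "b \<notin> W" "b' \<notin> W" "b \<noteq> b'" using W c by (auto simp: config_def)
  have lt: "card (N w \<inter> W) \<le> 2" if "u \<in> N w" "u \<notin> W" for u w
  proof -
    have "N w \<inter> W \<subset> N w" using that by blast
    from psubset_card_mono[OF fin this] card3[of w] show ?thesis by simp
  qed
  have "z \<noteq> x"
  proof
    assume "z = x"
    then have "N x \<inter> W \<subseteq> N x - {b, b'}" using bW by blast
    then have "card (N x \<inter> W) \<le> card (N x - {b, b'})" using fin by (simp add: card_mono)
    also have "\<dots> \<le> 1" using sy bW \<open>z = x\<close> by (intro le1[of b x b']) auto
    finally show False using R[of x] W by simp
  qed
  have nz: "\<not> ?r x z"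
  proof
    assume "?r x z"
    then show False using R[of z] W lt[OF sy(3) bW(2)] \<open>z \<noteq> x\<close> N(4) by simp
  qed
  have ny: "\<not> ?r x y"
  proof
    assume r: "?r x y"
    have "z \<notin> N x" using nz reach_step[of x x W z] W by blast
    from one_edge_reach[OF c N(1,3) \<open>z \<noteq> x\<close>[symmetric] this W(1,2,4) m, of y] r
    show False using W lt[OF sy(2) bW(2)] xy N(4) by simp
  qed
  define K where "K = {w \<in> W. ?r x w}"
  have KW: "K \<subseteq> W" "x \<in> K" "y \<notin> K" "z \<notin> K" using W ny nz by (auto simp: K_def)
  have Kcl: "u \<in> K" if "w \<in> K" "u \<in> N w" "u \<in> W" for u w
    using that reach_step[of x w W u] unfolding K_def by blast
  have cK: "card (N w \<inter> W) = (if w = x \<or> w = y then 2 else 3)" if "w \<in> K" for w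
    using R[of w] that unfolding K_def by blast
  have full: "N w \<subseteq> W" if "w \<in> K" "w \<noteq> x" for w
  proof -
    have "w \<noteq> y" using that KW by blast
    then have "N w \<inter> W = N w" using cK[OF that(1)] that card3[of w] fin by (intro card_seteq) auto
    then show ?thesis by blast
  qed
  have bV: "b' \<in> verts G" using inV[OF sym[OF N(2)]] .
  have d: "distinct (b # b' # flat ps @ js)" using c by (simp add: config_def)
  have c': "config G ((b, x) # ps) js"
    unfolding config_def
  proof (intro conjI)
    show "distinct (flat ((b, x) # ps) @ js)" using d W by auto
    show "\<forall>(a, b)\<in>set ((b, x) # ps). b \<in> N a" using c N by (simp add: config_def)
    show "\<forall>i\<in>set js. i \<in> verts G \<and> N i \<subseteq> set (flat ((b, x) # ps))"
    proof
      fix i assume i: "i \<in> set js"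
      then have "i \<in> verts G" "N i \<subseteq> insert b (insert b' (set (flat ps)))" using c
        by (auto simp: config_def)
      with js[OF i] show "i \<in> verts G \<and> N i \<subseteq> set (flat ((b, x) # ps))"
        by (simp add: subset_insert insert_commute) blast
    qed
  qed
  have m': "meet G (set (flat ((b, x) # ps))) \<le> 2 * length ((b, x) # ps) + 4 * length js + 4"
  proof -
    have "set (flat ((b, x) # ps)) = insert x (set (b # flat ps))" by auto
    then have "meet G (set (flat ((b, x) # ps))) \<le> meet G (set (b # flat ps)) + card (N x - set (b # flat ps))"
      using meet_insert[OF G, of x "set (b # flat ps)"] by presburger
    also have "meet G (set (b # flat ps)) \<le> meet G (set (flat ((b, b') # ps)))"
      by (rule meet_mono[OF G]) auto
    finally show ?thesis using m le3[of x "set (b # flat ps)"] by simp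
  qed
  show False
  proof (rule swap_parity[OF c _ _ _ _ _ c', of K "W - K" x "insert b' (W - K)"])
    show "u \<in> K \<Longrightarrow> N u \<inter> (W - K) = {}" for u using Kcl[of u] by blast
    show "(K - {x}) \<union> insert b' (W - K) = verts G - set (flat ((b, x) # ps)) - set js"
      using KW W bV d by auto
    show "(K - {x}) \<inter> insert b' (W - K) = {}" using KW bW by auto
    show "N u \<inter> insert b' (W - K) = {}" if "u \<in> K - {x}" for u
      using Kcl[of u] full[of u] that bW by blast
    have "N x \<inter> K = N x \<inter> W" using Kcl[OF KW(2)] KW by blast
    then show "card (N x \<inter> K) = 2" using cK[OF KW(2)] by simp
  qed (use KW W m m' in auto)
qed

lemma one_side:
  assumes c: "config G ((b, b') # ps) js" and js: "\<And>i. i \<in> set js \<Longrightarrow> b' \<notin> N i"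
    and N: "x \<in> N b" "y \<in> N b'" "z \<in> N b'" "y \<noteq> z"
    and W: "x \<notin> set (flat ((b, b') # ps)) \<union> set js"
    "y \<notin> set (flat ((b, b') # ps)) \<union> set js"
      "z \<notin> set (flat ((b, b') # ps)) \<union> set js"
    and ok: "y \<noteq> x \<and> y \<notin> N x \<or> z \<noteq> x \<and> z \<notin> N x"
    and m: "budget G {} (flat ((b, b') # ps)) \<le> 2 * length ps + 4 * length js + 3"
  shows False
proof -
  have W': "x \<in> verts G - set (flat ((b, b') # ps)) - set js"
    "y \<in> verts G - set (flat ((b, b') # ps)) - set js"
    "z \<in> verts G - set (flat ((b, b') # ps)) - set js"
    using W inV[OF N(1)] inV[OF N(2)] inV[OF N(3)] by blast+
  have m': "meet G (set (flat ((b, b') # ps))) \<le> 2 * length ps + 4 * length js + 3"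
    using m meet_le_budget[OF G, of "flat ((b, b') # ps)"] by linarith
  show False
    using ok one_side_aux[OF c js N refl W' _ _ m']
      one_side_aux[OF c js N(1,3,2) N(4)[symmetric] refl W'(1,3,2) _ _ m'] by blast
qed

lemma no_diamond:
  assumes v: "N v = {a, b}" "a \<noteq> b" and b: "N b = {v, r, s}" "r \<noteq> v" "s \<noteq> v" "r \<noteq> s"
    and r: "N r = {b, s, d}" "d \<noteq> b" "d \<noteq> s" and d: "d \<in> N s"
  shows False
proof -
  have mem: "v \<in> N b" "r \<in> N b" "s \<in> N b" "d \<in> N r" "b \<in> N v" using v b r by simp_all
  have ab: "a \<notin> N b" using no_triangle_deg2[OF v] sym by blast
  then have "a \<noteq> r" using mem by blast
  then have "r \<notin> N v" using v neq[OF mem(2)] by auto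
  then have "d \<noteq> v" using sym[OF mem(4)] by blast
  then have D: "distinct [b, v, s, d, r]"
    using b r neq[OF mem(1)] neq[OF mem(2)] neq[OF mem(3)] neq[OF mem(4)] by auto
  have "card (N b) \<le> 3" "card (N v - {b}) \<le> 1" "card (N s - {v, b}) \<le> 2"
    "card (N d - {s, v, b}) \<le> 2"
    using card3 le2[OF sym[OF mem(3)]] le2[OF sym[OF d]] v by simp_all
  moreover have "config G [(b, v), (s, d)] [r]"
    using distinct_both[OF D] mem d r(1) inV[OF mem(2)] by (simp add: config_def)
  ultimately show False using no_reduction[of "[(b, v), (s, d)]" "[r]"] by simp
qed

lemma twin_distinct:
  assumes v: "N v = {a, b}" "a \<noteq> b" and b: "N b = {v, r, s}" "r \<noteq> v" "s \<noteq> v" "r \<noteq> s"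
    and rs: "N r = {b, d1, d2}" "N s = {b, d1, d2}" "d1 \<noteq> b" "d2 \<noteq> b" "d1 \<noteq> d2"
  shows "distinct [v, a, b, r, s, d1, d2]"
proof -
  have mem: "v \<in> N b" "r \<in> N b" "s \<in> N b" "d1 \<in> N r" "d2 \<in> N r" "d1 \<in> N s"
    "d2 \<in> N s" "a \<in> N v"
    using v b rs by simp_all
  have ab: "a \<notin> N b" using no_triangle_deg2[OF v] sym by blast
  then have ars: "a \<noteq> r" "a \<noteq> s" using mem by blast+
  then have "r \<notin> N v" using v neq[OF mem(2)] by auto
  then have dv: "d1 \<noteq> v" "d2 \<noteq> v" using sym[OF mem(4)] sym[OF mem(5)] by blast+
  have "r \<notin> N a" using no_square_deg2[OF v b(2) _ mem(2)] by blast
  then have "a \<noteq> d1" "a \<noteq> d2" using sym[OF mem(4)] sym[OF mem(5)] by blast+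
  then show ?thesis
    using v(2) b(2-) rs(3-) ars dv neq[OF mem(1)] neq[OF mem(2)] neq[OF mem(3)] neq[OF mem(4)] neq[OF mem(5)]
      neq[OF mem(6)] neq[OF mem(7)] neq[OF mem(8)] by auto
qed

lemma twin_chain:
  assumes v: "N v = {a, b}" "a \<noteq> b" and b: "N b = {v, r, s}" "r \<noteq> v" "s \<noteq> v" "r \<noteq> s"
    and rs: "N r = {b, d1, d2}" "N s = {b, d1, d2}" "d1 \<noteq> b" "d2 \<noteq> b" "d1 \<noteq> d2"
  shows "\<exists>f h. N d1 = {r, s, f} \<and> N d2 = {r, s, f} \<and> N f = {d1, d2, h} \<and> distinct [v, a, b, r, s, d1, d2, f, h]"
proof -
  have D: "distinct [v, a, b, r, s, d1, d2]" by (rule twin_distinct[OF assms])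
  note Db = distinct_both[OF D]
  have mem: "v \<in> N b" "r \<in> N b" "s \<in> N b" "r \<in> N d1" "r \<in> N d2" "s \<in> N d1"
    "s \<in> N d2" "a \<in> N v" "d1 \<in> N r" "d2 \<in> N r" "d1 \<in> N s" "d2 \<in> N s"
    using v b rs sym by auto
  have vV: "v \<in> verts G" "r \<in> verts G" "s \<in> verts G" "d2 \<in> verts G" using inV mem by blast+
  obtain e1 where e1: "N d1 = {r, s, e1}" "e1 \<noteq> r" "e1 \<noteq> s"
    by (rule two_known[OF mem(4,6) b(4)]) (use no_square_deg2[of d1 r s b] D b rs in auto)
  obtain e2 where e2: "N d2 = {r, s, e2}" "e2 \<noteq> r" "e2 \<noteq> s"
    by (rule two_known[OF mem(5,7) b(4)]) (use no_square_deg2[of d2 r s b] D b rs in auto)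
  have e1d: "d1 \<in> N e1" "d2 \<in> N e2" using e1 e2 sym by blast+
  have d2d1: "d2 \<notin> N d1"
  proof
    assume "d2 \<in> N d1"
    then have "config G [(b, v), (d1, d2)] [r, s]"
      using Db v b rs vV by (simp add: config_def)
    moreover have "budget G {} [b, v, d1, d2] \<le> 12"
      using le3[of b "{}"] le3[of v "{b}"] le3[of d1 "{v, b}"] le3[of d2 "{d1, v, b}"] by simp
    ultimately show False using no_reduction[of "[(b, v), (d1, d2)]" "[r, s]"] by simp
  qed
  have d1bv: "d1 \<notin> N b" "d1 \<notin> N v" "d2 \<notin> N b" "d2 \<notin> N v" using v b Db by simp_all
  have e1n: "e1 \<noteq> b" "e1 \<noteq> v" "e1 \<noteq> d2" "e1 \<noteq> d1" "e2 \<noteq> b" "e2 \<noteq> v"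
    "e2 \<noteq> d1" "e2 \<noteq> d2"
    using d1bv e1d d2d1 sym[of d2 d1] e1 e2 by (metis irr insertCI)+
  have "e1 = e2"
  proof (rule ccontr)
    assume "e1 \<noteq> e2"
    then have "distinct [b, v, d1, e1, d2, e2, r, s]" using D e1n e1 e2 by auto
    then have "config G [(b, v), (d1, e1), (d2, e2)] [r, s]"
      using Db v b rs vV e1 e2 by (simp add: config_def)
    moreover have "card (N b) \<le> 3" "card (N v - {b}) \<le> 1" "card (N d1 - {v, b}) \<le> 3"
      "card (N e1 - {d1, v, b}) \<le> 2"
      "card (N d2 - {e1, d1, v, b}) \<le> 3" "card (N e2 - {d2, e1, d1, v, b}) \<le> 2"
      using card3 le3 v le2[OF e1d(1)] le2[OF e1d(2)] by simp_all
    ultimately show False using no_reduction[of "[(b, v), (d1, e1), (d2, e2)]" "[r, s]"] by simp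
  qed
  then obtain f where f: "N d1 = {r, s, f}" "N d2 = {r, s, f}" and fn: "f \<noteq> r" "f \<noteq> s"
    "f \<noteq> b" "f \<noteq> v" "f \<noteq> d1" "f \<noteq> d2"
    and fd: "d1 \<in> N f" "d2 \<in> N f"
    using e1 e2 e1n e1d by blast
  have fa: "f \<noteq> a"
  proof
    assume fa: "f = a"
    have "N a = {v, d1, d2}"
      by (rule three_known) (use fd fa D sym[OF mem(8)] in auto)
    then show False using no_reduction[of "[(a, d1), (b, r), (s, d2)]" "[v]"] v b rs f fa Db vV
      by (simp add: config_def insert_Diff_if)
  qed
  obtain h where h: "N f = {d1, d2, h}" "h \<noteq> d1" "h \<noteq> d2"
    by (rule two_known[OF fd rs(5)]) (use no_square_deg2[of f d1 d2 r] fn rs mem D in auto)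
  have hf: "f \<in> N h" using h sym by blast
  have D2: "distinct [v, a, b, r, s, d1, d2, f]" using D fn fa by auto
  note D2b = distinct_both[OF D2]
  have "f \<notin> N b" "f \<notin> N v" "f \<notin> N r" "f \<notin> N s" using v b rs D2b by simp_all
  then have hn: "h \<noteq> b" "h \<noteq> v" "h \<noteq> r" "h \<noteq> s" "h \<noteq> f" using hf by (metis irr)+
  have "h \<noteq> a"
  proof
    assume ha: "h = a"
    have "config G [(b, r), (s, d1), (f, a)] [v, d2]"
      using D2b v b rs f h ha vV by (simp add: config_def)
    moreover have "budget G {} [b, r, s, d1, f, a] \<le> 14"
      using le2[of f a "{f, d1, s, r, b}"] hf ha b rs f h D2b by (simp add: insert_Diff_if)
    ultimately show False using no_reduction[of "[(b, r), (s, d1), (f, a)]" "[v, d2]"] by simp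
  qed
  then have "distinct [v, a, b, r, s, d1, d2, f, h]" using D2 hn h by auto
  then show ?thesis using f h by blast
qed

lemma no_double_chain:
  assumes v: "N v = {a, b}"
    and a: "N a = {v, p, q}" "N p = {a, c1, c2}" "N q = {a, c1, c2}" "N c1 = {p, q, g}" "N c2 = {p, q, g}"
      "N g = {c1, c2, k}" "distinct [v, b, a, p, q, c1, c2, g, k]"
    and b: "N b = {v, r, s}" "N r = {b, d1, d2}" "N s = {b, d1, d2}" "N d1 = {r, s, f}" "N d2 = {r, s, f}"
      "N f = {d1, d2, h}" "distinct [v, a, b, r, s, d1, d2, f, h]"
  shows False
proof -
  have vV: "v \<in> verts G" "c2 \<in> verts G" "d2 \<in> verts G" "g \<in> verts G" "f \<in> verts G"
    "a \<in> verts G"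
    using inV[of v a] inV[of c2 p] inV[of d2 r] inV[of g c1] inV[of f d1] inV[of a v] v a b by simp_all
  have hf: "f \<in> N h" "g \<in> N k" using sym[of h f] sym[of k g] a b by simp_all
  note Da = distinct_both[OF a(7)] and Db = distinct_both[OF b(7)]
  have "a \<in> N p" "a \<in> N q" "a \<notin> N r" "a \<notin> N s" "a \<notin> N d1" "a \<notin> N d2"
    "a \<notin> N f"
    using a b Da Db by simp_all
  then have 1: "p \<notin> {r, s, d1, d2, f}" "q \<notin> {r, s, d1, d2, f}" by blast+
  have "b \<in> N r" "b \<in> N s" "b \<notin> N p" "b \<notin> N q" "b \<notin> N c1" "b \<notin> N c2"
    "b \<notin> N g"
    using a b Da Db by simp_all
  then have 2: "r \<notin> {p, q, c1, c2, g}" "s \<notin> {p, q, c1, c2, g}" by blast+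
  have "r \<in> N d1" "r \<in> N d2" "r \<notin> N c1" "r \<notin> N c2" using a b 1 2 by simp_all
  then have 3: "c1 \<notin> {d1, d2}" "c2 \<notin> {d1, d2}" by blast+
  have "\<not> {r, s} \<subseteq> N g" "{r, s} \<subseteq> N d1" "{r, s} \<subseteq> N d2" using a b 2 Db by auto
  then have 4: "g \<notin> {d1, d2}" by blast
  have "d1 \<in> N f" "d1 \<notin> N c1" "d1 \<notin> N c2" using a b 1 4 by auto
  then have 5: "f \<notin> {c1, c2}" by blast
  have "\<not> {d1, d2} \<subseteq> N g" "{d1, d2} \<subseteq> N f" using a b 3 Db by auto
  then have 6: "f \<noteq> g" by blast
  have D: "distinct [v, a, b, r, s, d1, d2, f, p, q, c1, c2, g]"
    using Da Db 1 2 3 4 5 6 by auto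
  have "f \<notin> N p" "f \<notin> N q" "f \<notin> N c1" "f \<notin> N c2" using a 5 6 1 Db by auto
  then have hn: "h \<notin> {p, q, c1, c2}" using hf by blast
  have "g \<notin> N r" "g \<notin> N s" "g \<notin> N d1" "g \<notin> N d2" using b 4 6 2 Da by auto
  then have kn: "k \<notin> {r, s, d1, d2}" using hf by blast
  show False
  proof (cases "h = g")
    case True
    then have "f \<in> N g" using hf by simp
    then have "k = f" using a 5 by auto
    then show False
      using no_reduction[of "[(f, g), (a, p), (q, c1), (b, r), (s, d1)]" "[v, c2, d2]"]
      True v a(1-6) b(1-6) distinct_both[OF D] vV
      by (simp add: config_def insert_Diff_if)
  next
    case False
    have "k \<noteq> f"
    proof
      assume "k = f"
      then have "g \<in> N f" using hf by simp
      then show False using b 4 False by auto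
    qed
    then have D': "distinct [v, a, b, r, s, d1, d2, f, p, q, c1, c2, g, h]"
      "distinct [v, a, b, r, s, d1, d2, f, p, q, c1, c2, g, k]"
      using D hn kn False Da Db by auto
    note D1 = distinct_both[OF D'(1)] and D2 = distinct_both[OF D'(2)]
    show False
    proof (cases "h = k")
      case False
      have "card (N k - {g, c1, q, p, a}) \<le> 2" "card (N h - {f, d1, s, r, b, k, g, c1, q, p, a}) \<le> 2"
        using le2[OF hf(1)] le2[OF hf(2)] by simp_all
      then show ?thesis
        using no_reduction[of "[(a, p), (q, c1), (g, k), (b, r), (s, d1), (f, h)]" "[v, c2, d2]"]
        False v a(1-6) b(1-6) D1 D2 vV
        by (simp add: config_def insert_Diff_if)
    next
      case hk: True
      have g: "g \<in> N h" using hf hk by simp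
      show ?thesis
      proof (rule two_known[OF hf(1) g])
        show "f \<noteq> g" by (rule 6)
      next
        assume h: "N h = {f, g}"
        then show ?thesis
          using no_reduction[of "[(h, f), (b, r), (s, d1), (a, p), (q, c1), (c2, g)]" "[v, d2]"]
          hk v a(1-6) b(1-6) D1 vV
          by (simp add: config_def insert_Diff_if)
      next
        fix h' assume h: "N h = {f, g, h'}" "h' \<noteq> f" "h' \<noteq> g"
        then have h': "h \<in> N h'" using sym[of h' h] by simp
        have "h \<notin> N v" "h \<notin> N a" "h \<notin> N b" "h \<notin> N p" "h \<notin> N q"
          "h \<notin> N r" "h \<notin> N s" "h \<notin> N c1" "h \<notin> N c2" "h \<notin> N d1" "h \<notin> N d2"
          using v a(1-5) b(1-5) D1 by simp_all
        then have "h' \<notin> {v, a, b, p, q, r, s, c1, c2, d1, d2, h}" using h' neq[OF h'] by blast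
        then have "distinct [v, a, b, r, s, d1, d2, f, p, q, c1, c2, g, h, h']" using D' h by auto
        note D3 = distinct_both[OF this]
        have "card (N h' - {h, b, v}) \<le> 2" using le2[OF h'] by simp
        then show ?thesis
          using no_reduction[of "[(v, b), (h, h'), (p, c1), (q, c2), (r, d1), (s, d2)]" "[a, g, f]"]
          hk v a(1-6) b(1-6) D3 vV h
          by (simp add: config_def insert_Diff_if)
      qed
    qed
  qed
qed

lemma side_alternatives:
  assumes v: "N v = {a, b}" "a \<noteq> b" and b: "N b = {v, r, s}" "r \<noteq> v" "s \<noteq> v" "r \<noteq> s"
  shows "(\<exists>y\<in>N r. y \<noteq> b \<and> y \<noteq> s \<and> y \<notin> N s) \<or>
    (\<exists>d1 d2. N r = {b, d1, d2} \<and> N s = {b, d1, d2} \<and> d1 \<noteq> b \<and> d2 \<noteq> b \<and> d1 \<noteq> d2)"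
proof (rule ccontr)
  assume n: "\<not> ?thesis"
  have mem: "b \<in> N r" "b \<in> N s" "s \<in> N b" "r \<in> N b" using sym[of r b] sym[of s b] b by simp_all
  show False
  proof (rule one_known[OF mem(1)])
    fix t assume t: "N r = {b, t}" "t \<noteq> b"
    then have "t = s \<or> t \<in> N s" using n by auto
    then show False
    proof
      assume "t = s"
      then show False using no_triangle_deg2[OF t(1)] t mem by simp
    next
      assume "t \<in> N s"
      then show False using no_square_deg2[OF t(1) _ b(4)[symmetric] mem(3)] t(2) sym by blast
    qed
  next
    fix t1 t2 assume t: "N r = {b, t1, t2}" "t1 \<noteq> b" "t2 \<noteq> b" "t2 \<noteq> t1"
    have n': "t1 = s \<or> t1 \<in> N s" "t2 = s \<or> t2 \<in> N s" using n t by auto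
    consider "t1 = s" | "t2 = s" | "t1 \<noteq> s" "t2 \<noteq> s" by blast
    then show False
    proof cases
      case 1
      then show False using no_diamond[OF v b, of t2] t n' by simp
    next
      case 2
      then show False using no_diamond[OF v b, of t1] t n' by (simp add: insert_commute)
    next
      case 3
      then have "t1 \<in> N s" "t2 \<in> N s" using n' by auto
      then have "N s = {b, t1, t2}" using three_known[OF mem(2)] t by simp
      then show False using n t by blast
    qed
  qed
qed

lemma no_twin:
  assumes v: "N v = {a, b}" "a \<noteq> b" and b: "N b = {v, r, s}" "r \<noteq> v" "s \<noteq> v" "r \<noteq> s"
    and rs: "N r = {b, d1, d2}" "N s = {b, d1, d2}" "d1 \<noteq> b" "d2 \<noteq> b" "d1 \<noteq> d2"
  shows False
proof -
  obtain f h where f: "N d1 = {r, s, f}" "N d2 = {r, s, f}" "N f = {d1, d2, h}"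
    and D: "distinct [v, a, b, r, s, d1, d2, f, h]"
    using twin_chain[OF assms] by blast
  note Db = distinct_both[OF D]
  have va: "v \<in> N a" and hf: "f \<in> N h" using sym[of a v] sym[of h f] v f by simp_all
  have vV: "v \<in> verts G" "d2 \<in> verts G" "a \<in> verts G" "f \<in> verts G"
    using inV[OF va] inV[of d2 r] rs inV[of a v] v inV[OF hf] by simp_all
  have an: "a \<notin> N b" "a \<notin> N r" "a \<notin> N s" "a \<notin> N d1" "a \<notin> N d2"
    "a \<notin> N f" using Db b rs f by simp_all
  have fresh: "distinct [v, a, b, r, s, d1, d2, f, h, t]" if "t \<in> N a" "t \<noteq> v" "t \<noteq> h" for t
    using that an sym[OF that(1)] neq[OF that(1)] D by auto
  have step: "card (N a) = 3 \<and> card (N t) = 3 \<and> h \<notin> N a \<and> h \<notin> N t" if t: "t \<in> N a" "t \<noteq> v" "t \<noteq> h" for t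
  proof (rule ccontr)
    assume n: "\<not> ?thesis"
    note Dt = distinct_both[OF fresh[OF t]]
    have at: "a \<in> N t" using sym[OF t(1)] .
    have 2: "card (N a) \<le> 3" "card (N t) \<le> 3" "card (N t - {a}) = card (N t) - 1" using card3 fin at
      by simp_all
    have 3: "card (N h - {f, d1, s, r, b, t, a}) \<le> 2" using le2[OF hf] by simp
    have 4: "h \<in> N a \<or> h \<in> N t \<Longrightarrow> card (N h - {f, d1, s, r, b, t, a}) \<le> 1"
      using le1[OF hf, of a "{f, d1, s, r, b, t, a}"] le1[OF hf, of t "{f, d1, s, r, b, t, a}"] sym[of h a]
      sym[of h t] Dt by auto
    have "budget G {} [a, t, b, r, s, d1, f, h] \<le>
        card (N a) + (card (N t) - 1) + 10 + card (N h - {f, d1, s, r, b, t, a})"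
      using 2(3) b(1) rs f Dt by (simp add: insert_Diff_if)
    then have "budget G {} [a, t, b, r, s, d1, f, h] \<le> 16"
      using 2(1,2) 3 4 n by linarith
    then show False
      using no_reduction[of "[(a, t), (b, r), (s, d1), (f, h)]" "[v, d2]"] Dt v b(1) rs f vV t
      by (simp add: config_def)
  qed
  show False
  proof (cases "N a \<subseteq> {v, h}")
    case True
    have "N a \<noteq> {v}" using deg_ge2[OF vV(3)] by auto
    then have a: "N a = {v, h}" using True va by blast
    then have ha: "a \<in> N h" using sym[of h a] by simp
    show False
    proof (rule two_known[OF ha hf])
      show "a \<noteq> f" using Db by simp
    next
      assume "N h = {a, f}"
      then show False
        using no_reduction[of "[(a, h), (b, r), (s, d1), (d2, f)]" "[v]"] Db v b(1) rs f vV a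
        by (simp add: config_def insert_Diff_if)
    next
      fix g assume g: "N h = {a, f, g}" "g \<noteq> a" "g \<noteq> f"
      have hg: "h \<in> N g" using sym[of g h] g by simp
      have "h \<notin> N v" "h \<notin> N b" "h \<notin> N r" "h \<notin> N s" "h \<notin> N d1"
        "h \<notin> N d2" using Db v b rs f by simp_all
      then have "g \<notin> {v, b, r, s, d1, d2, h}" using hg neq[OF hg] by blast
      then have "distinct [v, a, b, r, s, d1, d2, f, h, g]" using g(2,3) D by auto
      note Dg = distinct_both[OF this]
      have "card (N g - {h}) \<le> 2" using le2[OF hg] by simp
      then show False
        using no_reduction[of "[(h, g), (v, b), (r, d1), (s, d2)]" "[a, f]"] Dg v b(1) rs f vV a g
        by (simp add: config_def insert_Diff_if)
    qed
  next
    case False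
    then obtain p where p: "p \<in> N a" "p \<noteq> v" "p \<noteq> h" by blast
    have a3: "card (N a) = 3" "h \<notin> N a" using step[OF p] by simp_all
    obtain q where a: "N a = {v, p, q}" "q \<noteq> v" "q \<noteq> p"
      by (rule two_known[OF va p(1) p(2)[symmetric]]) (use a3 p in auto)
    have q: "q \<in> N a" "q \<noteq> h" using a a3 by auto
    have hq: "h \<notin> N p" "h \<notin> N q" using step[OF p] step[OF q(1) a(2) q(2)] by simp_all
    have v': "N v = {b, a}" "b \<noteq> a" using v by auto
    have pq: "p \<noteq> q" using a by simp
    from side_alternatives[OF v' a(1) p(2) a(2) pq] show False
    proof
      assume "\<exists>y\<in>N p. y \<noteq> a \<and> y \<noteq> q \<and> y \<notin> N q"
      then obtain y where y: "y \<in> N p" "y \<noteq> a" "y \<noteq> q" "y \<notin> N q" by blast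
      have ap: "a \<in> N p" using sym[OF p(1)] .
      obtain z where z: "N p = {a, y, z}" "z \<noteq> a" "z \<noteq> y"
        by (rule two_known[OF ap y(1) y(2)[symmetric]]) (use step[OF p] y in auto)
      have "distinct [v, a, b, r, s, d1, d2, f, h, p, q]" using fresh[OF p] fresh[OF q(1) a(2) q(2)] a(3) by auto
      note Dq = distinct_both[OF this]
      have pn: "p \<notin> N v" "p \<notin> N b" "p \<notin> N r" "p \<notin> N s" "p \<notin> N d1"
        "p \<notin> N d2" "p \<notin> N f" "p \<notin> N h"
        using Dq v b rs f hq sym[of p h] by auto
      have fr: "w \<notin> set (flat ((a, p) # [(b, r), (s, d1), (f, h)])) \<union> set [v, d2]" if "w \<in> N p" "w \<noteq> a" for w
        using that pn sym[OF that(1)] neq[OF that(1)] by auto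
      show False
      proof (rule one_side[of a p "[(b, r), (s, d1), (f, h)]" "[v, d2]" q y z])
        show "config G ((a, p) # [(b, r), (s, d1), (f, h)]) [v, d2]"
          using Dq v b(1) rs f vV p by (simp add: config_def)
        show "q \<notin> set (flat ((a, p) # [(b, r), (s, d1), (f, h)])) \<union> set [v, d2]" using Dq by simp
        show "budget G {} (flat ((a, p) # [(b, r), (s, d1), (f, h)])) \<le>
          2 * length [(b, r), (s, d1), (f, h)] + 4 * length [v, d2] + 3"
          using le2[OF ap, of "{a}"] le2[OF hf, of "{f, d1, s, r, b, p, a}"] a(1) b(1) rs f Dq
          by (simp add: insert_Diff_if)
        show "p \<notin> N i" if "i \<in> set [v, d2]" for i using that pn by auto
      qed (use fr y z q in simp_all)
    next
      assume "\<exists>c1 c2. N p = {a, c1, c2} \<and> N q = {a, c1, c2} \<and> c1 \<noteq> a \<and> c2 \<noteq> a \<and> c1 \<noteq> c2"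
      then obtain c1 c2 where c: "N p = {a, c1, c2}" "N q = {a, c1, c2}" "c1 \<noteq> a" "c2 \<noteq> a"
        "c1 \<noteq> c2" by blast
      from twin_chain[OF v' a(1) p(2) a(2) pq c] obtain g k where
        "N c1 = {p, q, g}" "N c2 = {p, q, g}" "N g = {c1, c2, k}" "distinct [v, b, a, p, q, c1, c2, g, k]" by blast
      from no_double_chain[OF v(1) a(1) c(1,2) this b(1) rs(1,2) f D] show False .
    qed
  qed
qed

lemma side_valid:
  assumes "N v = {a, b}" "a \<noteq> b" and "N b = {v, r, s}" "r \<noteq> v" "s \<noteq> v" "r \<noteq> s"
  shows "\<exists>y\<in>N r. y \<noteq> b \<and> y \<noteq> s \<and> y \<notin> N s"
  using side_alternatives[OF assms] no_twin[OF assms] by blast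

text \<open>The pattern \<open>q \<in> N r\<close>, \<open>s \<in> N p\<close> treated in the next lemmas is the one in which rewiring at both
  \<open>(a, p)\<close> and \<open>(b, r)\<close> might add the same edge twice.\<close>

lemma cross_fresh:
  assumes v: "N v = {a, b}" and a: "N a = {v, p, q}" and b: "N b = {v, r, s}"
    and D: "distinct [v, a, b, p, q, r, s]"
    and p: "N p = {a, s, y}" "y \<noteq> a" "y \<noteq> s" and pr: "r \<notin> N p"
  shows "distinct [v, a, b, p, r, s, y]"
    and "y \<noteq> q \<Longrightarrow> w \<in> N y \<Longrightarrow> w \<notin> {p, q, r, s} \<Longrightarrow> distinct [v, a, b, p, q, r, s, y, w]"
proof -
  have py: "p \<in> N y" using sym[of y p] p by simp
  have "p \<notin> N v" "p \<notin> N b" "p \<notin> N r" using v b D sym[of p r] pr by auto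
  then have n: "y \<notin> {v, b, r, p}" using py neq[OF py] by blast
  then show d: "distinct [v, a, b, p, r, s, y]" using D p(2,3) by auto
  assume y: "y \<noteq> q" and w: "w \<in> N y" "w \<notin> {p, q, r, s}"
  have "y \<notin> N v" "y \<notin> N a" "y \<notin> N b" using v a b distinct_both[OF d] y by simp_all
  then have "w \<notin> {v, a, b, y}" using sym[OF w(1)] neq[OF w(1)] by blast
  then show "distinct [v, a, b, p, q, r, s, y, w]" using w(2) d y D by auto
qed

lemma cross_inner:
  assumes v: "N v = {a, b}" and a: "N a = {v, p, q}" and b: "N b = {v, r, s}"
    and D: "distinct [v, a, b, p, q, r, s]"
    and p: "N p = {a, s, y}" "y \<noteq> a" "y \<noteq> s" and pr: "r \<notin> N p" and qr: "q \<in> N r"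
    and y: "y \<noteq> q" "N y \<subseteq> {p, q, r, s}"
  shows False
proof -
  have "distinct [v, a, b, p, q, r, s, y]" using cross_fresh(1)[OF v a b D p pr] D y(1) by auto
  note Db = distinct_both[OF this]
  have V: "v \<in> verts G" "y \<in> verts G" "r \<in> N q" using inV[of v a] inV[of y p] a p sym[OF qr]
    by simp_all
  have "a \<in> N q" "b \<in> N s" "p \<in> N s" using sym[of q a] sym[of s b] sym[of s p] a b p by simp_all
  then have "card (N q - {p, a}) \<le> 2" "card (N r - {q, p, a}) \<le> 2" "card (N s - {b, r, q, p, a}) \<le> 1"
    using le2[of a q "{p, a}"] le2[OF qr, of "{q, p, a}"] le1[of b s p "{b, r, q, p, a}"] Db by simp_all
  moreover have "N y \<subseteq> {a, p, q, r, b, s}" using y(2) by blast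
  then have "config G [(a, p), (q, r), (b, s)] [v, y]"
    using Db v a b V by (simp add: config_def)
  ultimately show False
    using no_reduction[of "[(a, p), (q, r), (b, s)]" "[v, y]"] Db a b p(1) by (simp add: insert_Diff_if)
qed

lemma cross_outer:
  assumes a: "N a = {v, p, q}" and b: "N b = {v, r, s}"
    and ps: "config G ([(a, q), (b, s)] @ ps) [v, p, r]"
    and m: "budget G {s, b, q, a} (flat ps) \<le> 2 * length ps + 6"
  shows False
proof -
  have "a \<in> N q" "b \<in> N s" using sym[of q a] sym[of s b] a b by simp_all
  then have "card (N q - {a}) \<le> 2" "card (N s - {b, q, a}) \<le> 2" "card (N a) \<le> 3"
    "card (N b - {q, a}) \<le> 3"
    using le2[of a q "{a}"] le2[of b s "{b, q, a}"] card3 le3 by simp_all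
  then show False using no_reduction[OF ps] m by simp
qed

lemma cross_config:
  assumes v: "N v = {a, b}" and a: "N a = {v, p, q}" and b: "N b = {v, r, s}"
    and p: "N p = {a, s, y}" and r: "N r = {b, q, y'}"
    and ps: "distinct ([a, q, b, s] @ flat ps @ [v, p, r])" "\<forall>(x, x')\<in>set ps. x' \<in> N x"
      "y \<in> set (flat ps) \<or> y = q" "y' \<in> set (flat ps) \<or> y' = s"
  shows "config G ([(a, q), (b, s)] @ ps) [v, p, r]"
proof -
  have "v \<in> verts G" "p \<in> verts G" "r \<in> verts G" using inV[of v a] inV[of p a] inV[of r b] a b
    by simp_all
  moreover have "q \<in> N a" "s \<in> N b" using a b by simp_all
  moreover have "N p \<subseteq> set (flat ([(a, q), (b, s)] @ ps))"
    "N r \<subseteq> set (flat ([(a, q), (b, s)] @ ps))"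
    using p r ps(3,4) by auto
  ultimately show ?thesis using v ps(1,2) by (simp add: config_def)
qed

lemma cross:
  assumes v: "N v = {a, b}" and a: "N a = {v, p, q}" and b: "N b = {v, r, s}"
    and D: "distinct [v, a, b, p, q, r, s]"
    and c: "card (N p) = 3" "card (N r) = 3" and pr: "r \<notin> N p" and qr: "q \<in> N r" and sp: "s \<in> N p"
  shows False
proof -
  note Db = distinct_both[OF D]
  have ad: "a \<in> N p" "b \<in> N r" using sym[of p a] sym[of r b] a b by simp_all
  obtain y where p: "N p = {a, s, y}" "y \<noteq> a" "y \<noteq> s"
    by (rule two_known[OF ad(1) sp]) (use c Db in auto)
  obtain y' where r: "N r = {b, q, y'}" "y' \<noteq> b" "y' \<noteq> q"
    by (rule two_known[OF ad(2) qr]) (use c Db in auto)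
  have v': "N v = {b, a}" "distinct [v, b, a, r, s, p, q]" and pr': "p \<notin> N r" using v D sym[of p r] pr
    by auto
  note fr = cross_fresh[OF v a b D p pr] and fr' = cross_fresh[OF v'(1) b a v'(2) r pr']
  note out = cross_outer[OF a b cross_config[OF v a b p(1) r(1)]]
  have qy: "\<exists>w\<in>N y. w \<notin> {p, q, r, s}" if "y \<noteq> q"
    using cross_inner[OF v a b D p pr qr that] by blast
  have qy': "\<exists>w\<in>N y'. w \<notin> {p, q, r, s}" if "y' \<noteq> s"
    using cross_inner[OF v'(1) b a v'(2) r pr' sp that] by blast
  show False
  proof (cases "y = q"; cases "y' = s")
    assume "y = q" "y' = s"
    then show False using out[of "[]"] Db by simp
  next
    assume y: "y = q" "y' \<noteq> s"
    then obtain w where w: "w \<in> N y'" "w \<notin> {p, q, r, s}" using qy' by blast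
    then have "distinct [v, b, a, r, s, p, q, y', w]" using fr'(2)[OF y(2) w(1)] by blast
    then show False using out[of "[(y', w)]"] w y le2[OF sym[OF w(1)], of "{y', s, b, q, a}"]
      le3[of y' "{s, b, q, a}"] by auto
  next
    assume y: "y \<noteq> q" "y' = s"
    then obtain w where w: "w \<in> N y" "w \<notin> {p, q, r, s}" using qy by blast
    then have "distinct [v, a, b, p, q, r, s, y, w]" using fr(2)[OF y(1) w(1)] by blast
    then show False using out[of "[(y, w)]"] w y le2[OF sym[OF w(1)], of "{y, s, b, q, a}"]
      le3[of y "{s, b, q, a}"] by auto
  next
    assume y: "y \<noteq> q" "y' \<noteq> s"
    obtain w where w: "w \<in> N y" "w \<notin> {p, q, r, s}" using qy[OF y(1)] by blast
    obtain w' where w': "w' \<in> N y'" "w' \<notin> {p, q, r, s}" using qy'[OF y(2)] by blast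
    have Dw: "distinct [v, a, b, p, q, r, s, y, w]" using fr(2)[OF y(1) w] .
    have Dw': "distinct [v, b, a, r, s, p, q, y', w']" using fr'(2)[OF y(2) w'(1)] w'(2) by blast
    have wb: "card (N w - (insert y S)) \<le> 2" for S using le2[OF sym[OF w(1)]] by blast
    have wb': "card (N w' - (insert y' S)) \<le> 2" for S using le2[OF sym[OF w'(1)]] by blast
    show False
    proof (cases "y = y' \<or> y' \<in> N y")
      case True
      then show False
      proof
        assume "y = y'"
        then show False using out[of "[(y, w)]"] w Dw wb[of "{s, b, q, a}"] le3[of y "{s, b, q, a}"] by auto
      next
        assume yy: "y' \<in> N y"
        have "distinct ([a, q, b, s] @ flat [(y, y')] @ [v, p, r])" using Dw Dw' neq[OF yy] by auto
        then show False using out[of "[(y, y')]"] yy le3[of y "{s, b, q, a}"]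
          le2[OF sym[OF yy], of "{y, s, b, q, a}"] by simp
      qed
    next
      case False
      then have wy: "w \<noteq> y'" "w' \<noteq> y" using w w' sym[of y y'] by auto
      show False
      proof (cases "w = w'")
        case False
        have "distinct ([a, q, b, s] @ flat [(y, w), (y', w')] @ [v, p, r])"
          using Dw Dw' wy False \<open>\<not> (y = y' \<or> _)\<close> by auto
        then show False using out[of "[(y, w), (y', w')]"] w w' wb[of "{s, b, q, a}"]
          wb'[of "{w, y, s, b, q, a}"] le3[of y "{s, b, q, a}"] le3[of y' "{w, y, s, b, q, a}"] by simp
      next
        case ww: True
        show False
        proof (cases "N y' \<subseteq> {w, p, q, r, s}")
          case True
          have "y' \<notin> N p" using p False Dw' by auto
          then have "p \<notin> N y'" using sym by blast
          then have "N y' - {w, y, s, b, q, a} \<subseteq> {r}" using True by blast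
          then have 1: "card (N y' - {w, y, s, b, q, a}) \<le> 1" using card_mono[of "{r}"] by fastforce
          have 2: "N r - {y', w, y, s, b, q, a} = {}" using r by auto
          have 3: "card (N q - {a}) \<le> 2" "card (N s - {b, q, a}) \<le> 2"
            using le2[of a q "{a}"] le2[of b s "{b, q, a}"] sym[of q a] sym[of s b] a b by simp_all
          have "distinct [a, q, b, s, y, w, y', r, v, p]" using Dw Dw' wy False by auto
          moreover have "v \<in> verts G" "p \<in> verts G" "r \<in> N y'"
            using inV[of v a] inV[of p a] sym[of y' r] a r by simp_all
          ultimately have "config G [(a, q), (b, s), (y, w), (y', r)] [v, p]"
            using v a b p w by (simp add: config_def)
          then show False
            using no_reduction[of "[(a, q), (b, s), (y, w), (y', r)]" "[v, p]"] 1 2 3 wb[of "{s, b, q, a}"]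
              le3[of y "{s, b, q, a}"] le3[of a "{}"] le3[of b "{q, a}"] by simp
        next
          case no: False
          then obtain u where u: "u \<in> N y'" "u \<notin> {p, q, r, s}" "u \<noteq> w" by blast
          have Du: "distinct [v, b, a, r, s, p, q, y', u]" using fr'(2)[OF y(2) u(1)] u(2) by blast
          have uy: "u \<noteq> y" using False u sym[of y y'] by auto
          have "distinct ([a, q, b, s] @ flat [(y, w), (y', u)] @ [v, p, r])"
            using Dw Du wy uy u(3) False by auto
          then show False using out[of "[(y, w), (y', u)]"] w u wb[of "{s, b, q, a}"]
            le2[OF sym[OF u(1)], of "{y', w, y, s, b, q, a}"] le3[of y "{s, b, q, a}"]
              le3[of y' "{w, y, s, b, q, a}"] by simp
        qed
      qed
    qed
  qed
qed

lemma low_side: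
  assumes v: "N v = {a, b}" "a \<noteq> b" and a': "a' \<in> N a" "a' \<noteq> v"
    and c: "card (N a) + card (N a') \<le> 5"
  shows False
proof -
  have va: "v \<in> N a" "v \<in> N b" "a \<in> N a'" using sym[of a v] sym[of b v] v sym[OF a'(1)] by simp_all
  have ab: "b \<notin> N a" "a \<notin> N b" using no_triangle_deg2[OF v] sym by blast+
  have V: "v \<in> verts G" using inV[OF va(1)] .
  have new: "distinct [v, a, b, a', t]" if "t \<in> N b" "t \<noteq> v" for t
  proof -
    have "t \<noteq> a'" using no_square_deg2[OF v that(2) _ that(1)] a' by blast
    moreover have "t \<noteq> a" "a' \<noteq> b" using that ab a' by blast+
    ultimately show ?thesis
      using that(2) v(2) a'(2) neq[OF that(1)] neq[OF a'(1)] neq[OF va(1)] neq[OF va(2)] by auto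
  qed
  have ca': "card (N a) + card (N a' - {a}) \<le> 4" using card_Suc_Diff1[OF fin va(3)] c by simp
  have step: "card (N b) = 3 \<and> card (N t) = 3 \<and> a' \<notin> N t" if t: "t \<in> N b" "t \<noteq> v" for t
  proof (rule ccontr)
    assume n: "\<not> ?thesis"
    note Dt = distinct_both[OF new[OF t]]
    have bt: "b \<in> N t" using sym[OF t(1)] .
    have 1: "card (N t - {b, a', a}) \<le> card (N t) - 1"
    proof -
      have "card (N t - {b, a', a}) \<le> card (N t - {b})" using fin by (intro card_mono) auto
      then show ?thesis using bt fin by simp
    qed
    have 2: "card (N t - {b, a', a}) \<le> 1" if "a' \<in> N t" using le1[OF bt that, of "{b, a', a}"] Dt by simp
    have 3: "card (N b - {a', a}) \<le> card (N b)" using fin by (intro card_mono) auto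
    have 4: "card (N b) \<le> 3" "card (N t) \<le> 3" using card3 by simp_all
    have 5: "card (N b - {a', a}) + card (N t - {b, a', a}) \<le> 4"
      using 1 2 3 4 n by linarith
    have "config G [(a, a'), (b, t)] [v]" using Dt v a' t V by (simp add: config_def)
    then show False using no_reduction[of "[(a, a'), (b, t)]" "[v]"] 5 ca' by simp
  qed
  have "N b \<noteq> {v}" using deg_ge2[of b] inV[of b v] v by auto
  then obtain r where r: "r \<in> N b" "r \<noteq> v" using va by blast
  obtain s where b: "N b = {v, r, s}" "s \<noteq> v" "s \<noteq> r"
    by (rule two_known[OF va(2) r(1) r(2)[symmetric]]) (use step[OF r] r in auto)
  have s: "s \<in> N b" using b by simp
  have br: "b \<in> N r" using sym[OF r(1)] .
  have rs: "r \<noteq> s" using b by simp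
  from side_valid[OF v b(1) r(2) b(2) rs]
  obtain y where y: "y \<in> N r" "y \<noteq> b" "y \<noteq> s" "y \<notin> N s" by blast
  obtain z where z: "N r = {b, y, z}" "z \<noteq> b" "z \<noteq> y"
    by (rule two_known[OF br y(1) y(2)[symmetric]]) (use step[OF r] y in auto)
  note Dr = distinct_both[OF new[OF r]] and Ds = distinct_both[OF new[OF s b(2)]]
  have "r \<notin> N v" "r \<notin> N a" "r \<notin> N a'"
    using v Dr no_square_deg2[OF v r(2) _ r(1)] step[OF r] sym[of r a'] by auto
  then have fr: "w \<notin> set (flat ((b, r) # [(a, a')])) \<union> set [v]" if "w \<in> N r" "w \<noteq> b" for w
    using that sym[OF that(1)] neq[OF that(1)] by auto
  show False
  proof (rule one_side[of b r "[(a, a')]" "[v]" s y z])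
    show "config G ((b, r) # [(a, a')]) [v]" using Dr v a' r V by (simp add: config_def)
    show "s \<notin> set (flat ((b, r) # [(a, a')])) \<union> set [v]" using Ds b(3) by simp
    have 1: "card (N a - {r, b}) \<le> card (N a)" "card (N a' - {a, r, b}) \<le> card (N a' - {a})"
      using fin by (auto intro: card_mono)
    show "budget G {} (flat ((b, r) # [(a, a')])) \<le> 2 * length [(a, a')] + 4 * length [v] + 3"
      using 1 ca' le2[OF br, of "{b}"] card3[of b] by simp
    show "r \<notin> N i" if "i \<in> set [v]" for i using that \<open>r \<notin> N v\<close> by simp
  qed (use fr y z s in simp_all)
qed

end

locale two_sides = min_counterexample G for G :: "'a ugraph" +
  fixes v a p q b r s :: 'a and W :: "'a set"
  assumes Nv: "N v = {a, b}" and Na: "N a = {v, p, q}" and Nb: "N b = {v, r, s}"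
    and D: "distinct [v, a, b, p, q, r, s]"
    and c: "card (N p) = 3" "card (N r) = 3" and pr: "r \<notin> N p"
    and nc: "\<not> (q \<in> N r \<and> s \<in> N p)"
    and W: "W = verts G - {a, p, b, r, v}"
begin

abbreviation reach :: "'a \<Rightarrow> 'a \<Rightarrow> bool" where
  "reach u w \<equiv> (u, w) \<in> (adj_rel (ind G W))\<^sup>*"

definition low :: "'a \<Rightarrow> bool" where
  "low w \<longleftrightarrow> w \<in> W \<and> card (N w) \<le> 2"

lemma adj: "p \<in> N a" "q \<in> N a" "v \<in> N a" "r \<in> N b" "s \<in> N b" "v \<in> N b"
    "a \<in> N p" "a \<in> N q" "a \<in> N v" "b \<in> N r" "b \<in> N s" "b \<in> N v"
  using Na Nb Nv sym[of p a] sym[of q a] sym[of r b] sym[of s b] by simp_all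

lemma in_verts: "v \<in> verts G" "p \<in> verts G" "q \<in> verts G" "r \<in> verts G" "s \<in> verts G"
  using adj inV by blast+

lemma qsW: "q \<in> W" "s \<in> W"
  using W in_verts distinct_both[OF D] by simp_all

lemma pW: "w \<in> W" if "w \<in> N p" "w \<noteq> a"
proof -
  have "p \<notin> N v" "p \<notin> N b" "p \<notin> N r" using Nv Nb distinct_both[OF D] sym[of p r] pr by auto
  then have "w \<noteq> v" "w \<noteq> b" "w \<noteq> r" using sym[OF that(1)] by blast+
  then show ?thesis using W inV[OF that(1)] neq[OF that(1)] that(2) by simp
qed

lemma rW: "w \<in> W" if "w \<in> N r" "w \<noteq> b"
proof -
  have "r \<notin> N v" "r \<notin> N a" "r \<notin> N p" using Nv Na distinct_both[OF D] pr by auto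
  then have "w \<noteq> v" "w \<noteq> a" "w \<noteq> p" using sym[OF that(1)] by blast+
  then show ?thesis using W inV[OF that(1)] neq[OF that(1)] that(2) by simp
qed

lemma swap: "two_sides G v b r s a p q W"
proof unfold_locales
  show "distinct [v, b, a, r, s, p, q]" using D by auto
  show "N v = {b, a}" using Nv by auto
  show "p \<notin> N r" using pr sym by blast
qed (use Na Nb c nc W in auto)

lemma two_edges:
  assumes y: "N p = {a, y, z}" "y \<noteq> a" "z \<noteq> a" "z \<noteq> y" "y \<noteq> q" "y \<notin> N q"
    and t: "N r = {b, t, t'}" "t \<noteq> b" "t' \<noteq> b" "t' \<noteq> t" "t \<noteq> s" "t \<notin> N s"
    and F: "F = add_edges G W {{q, y}, {s, t}}"
    and rq: "\<exists>w. (q, w) \<in> (adj_rel F)\<^sup>* \<and> (w = z \<or> w = t' \<or> low w)"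
    and rs: "\<exists>w. (s, w) \<in> (adj_rel F)\<^sup>* \<and> (w = z \<or> w = t' \<or> low w)"
  shows False
proof -
  note Db = distinct_both[OF D]
  have mem: "y \<in> N p" "z \<in> N p" "t \<in> N r" "t' \<in> N r" using y t by simp_all
  have yz: "y \<in> W" "z \<in> W" "t \<in> W" "t' \<in> W" using pW rW mem y t by blast+
  have nW: "u \<notin> W" if "u \<in> {a, p, b, r, v}" for u using that W by blast
  interpret R: rewiring G a p q y
    using G adj mem Db y(2,5,6) by unfold_locales simp_all
  let ?R = "rewire G a p q y"
  have eR: "edges ?R = insert {q, y} {e \<in> edges G. e \<inter> {a, p} = {}}" by (simp add: rewire_def)
  have yn: "y \<notin> {a, p, b, r, v}" using yz W by blast
  have R1: "nbr ?R u = N u - {a, p}" if "u \<in> {b, r, v}" for u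
  proof -
    have "u \<noteq> a" "u \<noteq> p" "u \<noteq> q" "u \<noteq> y" using that Db yn by auto
    then show ?thesis by (simp add: R.nbr_rewire)
  qed
  have nst: "t \<notin> nbr ?R s"
  proof
    assume ts: "t \<in> nbr ?R s"
    have "s \<notin> {a, p}" "s \<noteq> q" using Db by auto
    then have "s = y \<and> t = q" using ts t(6) by (simp add: R.nbr_rewire split: if_splits)
    then show False using nc mem by blast
  qed
  have tn: "t \<notin> {a, p}" "t' \<notin> {a, p}" using yz W by blast+
  interpret S: rewiring ?R b r s t
  proof
    show "simple_graph ?R" by (rule R.simple)
    show "r \<in> nbr ?R b" "s \<in> nbr ?R b" using R1[of b] adj Db by auto
    show "t \<in> nbr ?R r" using R1[of r] mem tn by blast
  qed (use nst t Db in auto)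
  let ?S = "rewire ?R b r s t"
  have WS: "W \<subseteq> verts ?S" using W by (auto simp: rewire_def)
  have vS: "v \<in> verts ?S" using in_verts Db by (simp add: rewire_def)
  have eS: "e \<in> edges ?S \<longleftrightarrow> e = {s, t} \<or> (e = {q, y} \<or> e \<in> edges G \<and> e \<inter> {a, p} = {}) \<and> e \<inter> {b, r} = {}" for e
    unfolding rewire_def[of ?R] by (simp add: eR)
  have TW: "{q, y} \<subseteq> W" "{s, t} \<subseteq> W" using yz qsW by simp_all
  have dj: "e \<inter> {a, p} = {} \<and> e \<inter> {b, r} = {}" if "e \<subseteq> W" for e using nW that by blast
  have "e \<in> edges ?S \<and> e \<subseteq> W \<longleftrightarrow> (e = {q, y} \<or> e = {s, t}) \<or> e \<in> edges G \<and> e \<subseteq> W" for e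
    using eS[of e] dj[of e] TW by metis
  then have "{e \<in> edges ?S. e \<subseteq> W} = {{q, y}, {s, t}} \<union> {e \<in> edges G. e \<subseteq> W}"
    by auto
  then have SF: "ind ?S W = F" unfolding F by (simp only: ind_def[of ?S W] add_edges_def)
  have sF: "simple_graph F" "subcubic F"
    using simple_ind[OF S.simple WS] subcubic_ind[OF S.simple S.subcubic_rewire[OF R.subcubic_rewire[OF sc]] WS]
    SF by simp_all
  have dle: "degree F u \<le> card (nbr ?S u)" for u
    using degree_ind_le[OF S.simple WS, of u] degree_nbr[OF S.simple, of u] SF by simp
  have lowF: "w \<in> W \<and> degree F w \<le> 2" if "w = z \<or> w = t' \<or> low w" for w
  proof -
    have le: "card (nbr ?S w) \<le> card (nbr ?R w)" "card (nbr ?R w) \<le> card (N w)"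
      by (rule S.card_nbr_rewire_le, rule R.card_nbr_rewire_le)
    have "card (nbr ?S w) \<le> 2"
    proof -
      have "card (nbr ?R z) < card (N z)" using R.card_nbr_rewire_less[of z] mem(2) y(4) by blast
      moreover have "t' \<in> nbr ?R r" using R1[of r] mem tn by blast
      then have "card (nbr ?S t') < card (nbr ?R t')" using S.card_nbr_rewire_less[of t'] t(4) by blast
      ultimately show ?thesis using that le card3[of w] by (auto simp: low_def)
    qed
    then show ?thesis using dle[of w] that yz by (auto simp: low_def)
  qed
  have adF: "(y, q) \<in> adj_rel F" "(t, s) \<in> adj_rel F" by (auto simp: F adj_rel_def add_edges_def)
  have dF: "deficient F"
    unfolding F
  proof (rule deficient_add)
    show "deficient (ind G W)" using W by (intro deficient_ind[OF G sc dG]) blast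
    fix u assume "u \<in> \<Union>{{q, y}, {s, t}}"
    then have "u = q \<or> u = y \<or> u = s \<or> u = t" by blast
    moreover obtain w1 where w1: "(q, w1) \<in> (adj_rel F)\<^sup>*" "w1 \<in> W \<and> degree F w1 \<le> 2"
      using rq lowF by blast
    moreover obtain w2 where w2: "(s, w2) \<in> (adj_rel F)\<^sup>*" "w2 \<in> W \<and> degree F w2 \<le> 2"
      using rs lowF by blast
    ultimately have "\<exists>z\<in>W. (u, z) \<in> (adj_rel F)\<^sup>* \<and> degree F z \<le> 2"
      using adF converse_rtrancl_into_rtrancl by metis
    then show "\<exists>z\<in>W. (u, z) \<in> (adj_rel (add_edges G W {{q, y}, {s, t}}))\<^sup>* \<and>
      degree (add_edges G W {{q, y}, {s, t}}) z \<le> 2" unfolding F .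
  qed
  have "W \<subset> verts G" using W in_verts by blast
  then have "card W < card (verts G)" using finite_verts by (rule psubset_card_mono[rotated])
  then have bF: "bnd (ind ?S W) (phi F)"
    using IH[OF sF dF] unfolding SF by (simp add: F add_edges_def)
  interpret C: split_config ?S "[]" "[v]" W "{}"
  proof unfold_locales
    show "simple_graph ?S" by (rule S.simple)
    have vn: "v \<notin> {b, r}" "v \<noteq> s" "v \<noteq> t" using Db yz W by auto
    have "nbr ?R v - {b, r} = {}" using R1[of v] Nv by blast
    then have "nbr ?S v = {}" unfolding S.nbr_rewire using vn by auto
    then show "config ?S [] [v]" using vS by (simp add: config_def)
    show "W \<union> {} = verts ?S - set (flat []) - set [v]" using W by (auto simp: rewire_def)
  qed auto
  from C.bnd_split[OF bF bnd_ind_empty[OF S.simple]] have "bnd ?S (phi F)" by simp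
  from R.bnd_rewire[OF S.bnd_rewire[OF this]] have b: "bnd G (phi F + 6 + 6)" .
  interpret A: split_config G "[(a, p), (b, r)]" "[v]" W "{}"
  proof unfold_locales
    show "config G [(a, p), (b, r)] [v]" using Db adj in_verts Nv by (simp add: config_def)
    show "W \<union> {} = verts G - set (flat [(a, p), (b, r)]) - set [v]" using W by auto
  qed (use G in auto)
  have m: "meet G (set (flat [(a, p), (b, r)])) \<le> 10"
    using meet_le_budget[OF G, of "flat [(a, p), (b, r)]"] card3[of a] le3[of b "{p, a}"]
      le2[OF adj(7), of "{a}"] le2[OF adj(10), of "{b, p, a}"] by simp
  have "{q, y} \<noteq> {s, t}" using nc mem(1,3) Db by (metis distinct_length_2_or_more doubleton_eq_iff)
  moreover have "{q, y} \<notin> edges G" "{s, t} \<notin> edges G" using y(6) t(6) by (simp_all add: nbr_def)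
  ultimately have "card ({{q, y}, {s, t}} \<union> {e \<in> edges G. e \<subseteq> W}) = 2 + card {e \<in> edges G. e \<subseteq> W}"
    using finite_edges[OF G] by (subst card_Un_disjoint) auto
  then have "phi F = phi (ind G W) - 2" by (simp add: F phi_def add_edges_def)
  then have "phi F + 6 + 6 \<le> phi G" using A.phi_split m G by simp
  with b bnd_mono no_bnd show False by blast
qed

lemma two_edges_reach:
  assumes y: "N p = {a, y, z}" "y \<noteq> a" "z \<noteq> a" "z \<noteq> y" "y \<noteq> q" "y \<notin> N q"
    and t: "N r = {b, t, t'}" "t \<noteq> b" "t' \<noteq> b" "t' \<noteq> t" "t \<noteq> s" "t \<notin> N s"
    and rq: "(reach q w \<or> reach y w) \<and> (w = z \<or> w = t' \<or> low w) \<or> reach q t"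
    and rs: "(reach s w' \<or> reach t w') \<and> (w' = z \<or> w' = t' \<or> low w')"
  shows False
proof -
  define F where "F = add_edges G W {{q, y}, {s, t}}"
  have lift: "(u, w) \<in> (adj_rel F)\<^sup>*" if "reach u w" for u w using reach_add[OF that]
    by (simp add: F_def)
  have adF: "(q, y) \<in> adj_rel F" "(s, t) \<in> adj_rel F" "(t, s) \<in> adj_rel F"
    by (auto simp: F_def adj_rel_def add_edges_def)
  have s: "(s, w') \<in> (adj_rel F)\<^sup>*"
    using rs lift adF(2) converse_rtrancl_into_rtrancl by metis
  have q: "(q, w) \<in> (adj_rel F)\<^sup>*" if "reach q w \<or> reach y w"
    using that lift adF(1) converse_rtrancl_into_rtrancl by metis
  have qt: "(q, w') \<in> (adj_rel F)\<^sup>*" if "reach q t"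
    using lift[OF that] adF(3) s by (meson converse_rtrancl_into_rtrancl rtrancl_trans)
  show False
    by (rule two_edges[OF y t F_def]) (use s q qt rq rs in blast)+
qed

lemma reach_W: "reach u w \<Longrightarrow> u \<in> W \<Longrightarrow> w \<in> W"
  by (induction rule: rtrancl_induct) (auto simp: adj_rel_def)

lemma reach_nbr: "reach u w \<Longrightarrow> u \<in> W \<Longrightarrow> x \<in> N w \<Longrightarrow> x \<in> W \<Longrightarrow> reach u x"
  using reach_step[of u w W x] reach_W by blast

lemma no_single_hit:
  assumes p: "\<And>y. y \<in> N p \<Longrightarrow> y \<noteq> a \<Longrightarrow> \<not> reach q y"
    and l: "\<And>w. reach q w \<Longrightarrow> \<not> low w"
    and r: "\<And>t. t \<in> N r \<Longrightarrow> t \<noteq> b \<Longrightarrow> \<not> reach q t"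
    and s: "\<not> reach q s"
  shows False
proof -
  note Db = distinct_both[OF D]
  define K where "K = {w \<in> W. reach q w}"
  have K: "q \<in> K" "K \<subseteq> W" "s \<notin> K" using qsW s by (auto simp: K_def)
  have ab: "a \<notin> W" "b \<notin> W" "p \<notin> W" "r \<notin> W" using W by auto
  have nK: "w \<notin> N p" "w \<notin> N r" "p \<notin> N w" "r \<notin> N w" if "w \<in> K" for w
    using that p[of w] r[of w] ab sym[of p w] sym[of r w] unfolding K_def by blast+
  have cl: "x \<in> K" if "w \<in> K" "x \<in> N w" "x \<in> W" for w x
    using that reach_nbr[of q w x] qsW unfolding K_def by blast
  have "q \<notin> N b" "q \<notin> N v" using Nb Nv Db by simp_all
  then have "N q \<subseteq> insert a W" using nK[OF K(1)] W inV[of _ q] sym[of _ q] by blast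
  then have qK: "N q \<inter> K = N q - {a}" using cl[OF K(1)] K(2) ab by blast
  have qW: "3 \<le> card (N q)" using l[of q] qsW by (auto simp: low_def)
  have c2: "card (N q \<inter> K) = 2" unfolding qK using card_Diff_singleton[OF adj(8)] qW card3[of q] by simp
  have vV: "v \<in> verts G" using in_verts by blast
  have c: "config G [(a, p), (b, r)] [v]" "config G [(a, q), (b, r)] [v]"
    using Db adj Nv vV by (simp_all add: config_def)
  have m: "meet G (set (flat [(a, p), (b, r)])) \<le> 10" "meet G (set (flat [(a, q), (b, r)])) \<le> 10"
    using meet_le_budget[OF G, of "flat [(a, p), (b, r)]"] meet_le_budget[OF G, of "flat [(a, q), (b, r)]"]
      card3[of a] le3[of b "{p, a}"] le3[of b "{q, a}"] le2[OF adj(7), of "{a}"] le2[OF adj(8), of "{a}"]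
      le2[OF adj(10), of "{b, p, a}"] le2[OF adj(10), of "{b, q, a}"] by simp_all
  show False
  proof (rule swap_parity[OF c(1) _ _ _ _ _ c(2), of K "W - K" q "insert p (W - K)"])
    show "K \<union> (W - K) = verts G - set (flat [(a, p), (b, r)]) - set [v]" using K(2) W by auto
    show "N u \<inter> (W - K) = {}" if "u \<in> K" for u using cl[OF that] by blast
    show "N u \<inter> insert p (W - K) = {}" if "u \<in> K - {q}" for u using cl[of u] nK[of u] that by blast
    show "(K - {q}) \<union> insert p (W - K) = verts G - set (flat [(a, q), (b, r)]) - set [v]"
      using K(1,2) W in_verts(2) Db by auto
    show "(K - {q}) \<inter> insert p (W - K) = {}" using K(2) ab by blast
  qed (use K c2 m in auto)
qed

lemma no_double_hit:
  assumes p: "\<And>y. y \<in> N p \<Longrightarrow> y \<noteq> a \<Longrightarrow> \<not> reach q y"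
    and l: "\<And>w. reach q w \<Longrightarrow> \<not> low w"
    and r: "\<And>t. t \<in> N r \<Longrightarrow> t \<noteq> b \<Longrightarrow> \<not> reach q t"
    and s: "reach q s"
  shows False
proof -
  note Db = distinct_both[OF D]
  define K where "K = {w \<in> W. reach q w}"
  have K: "q \<in> K" "K \<subseteq> W" "s \<in> K" using qsW s by (auto simp: K_def)
  have ab: "a \<notin> W" "b \<notin> W" "p \<notin> W" "r \<notin> W" using W by auto
  have nK: "w \<notin> N p" "w \<notin> N r" "p \<notin> N w" "r \<notin> N w" if "w \<in> K" for w
    using that p[of w] r[of w] ab sym[of p w] sym[of r w] unfolding K_def by blast+
  have cl: "x \<in> K" if "w \<in> K" "x \<in> N w" "x \<in> W" for w x
    using that reach_nbr[of q w x] qsW unfolding K_def by blast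
  have "q \<notin> N b" "q \<notin> N v" "s \<notin> N a" "s \<notin> N v" using Na Nb Nv Db by simp_all
  then have "N q \<subseteq> insert a W" "N s \<subseteq> insert b W"
    using nK[OF K(1)] nK[OF K(3)] W inV[of _ q] sym[of _ q] inV[of _ s] sym[of _ s] by blast+
  then have qK: "N q \<inter> K = N q - {a}" and sK: "N s \<inter> K = N s - {b}"
    using cl[OF K(1)] cl[OF K(3)] K(2) ab by blast+
  have q3: "card (N q) = 3" "card (N s) = 3"
    using l[of q] l[OF s] qsW card3[of q] card3[of s] by (auto simp: low_def)
  have c2: "card (N q \<inter> K) = 2" "card (N s \<inter> K) = 2"
    unfolding qK sK using card_Diff_singleton[OF adj(8)] card_Diff_singleton[OF adj(11)] q3 by simp_all
  have vV: "v \<in> verts G" using in_verts by blast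
  have c: "config G [(a, p), (b, r)] [v]" "config G [(a, q), (b, s)] [v]"
    using Db adj Nv vV by (simp_all add: config_def)
  have "meet G (set (flat [(a, p), (b, r)])) \<le> 10"
    using meet_le_budget[OF G, of "flat [(a, p), (b, r)]"] 
      card3[of a] le3[of b "{p, a}"] le2[OF adj(7), of "{a}"] le2[OF adj(10), of "{b, p, a}"] by simp
  moreover have "phi (ind G K) mod 6 + phi (ind G (W - K)) mod 6 <
    int (meet G (set (flat [(a, p), (b, r)]))) - 2 * int (length [(a, p), (b, r)]) - 4 * int (length [v])"
  proof (rule parity[OF c(1)])
    show "K \<union> (W - K) = verts G - set (flat [(a, p), (b, r)]) - set [v]" using K(2) W by auto
    show "N u \<inter> (W - K) = {}" if "u \<in> K" for u using cl[OF that] by blast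
  qed auto
  moreover have "0 \<le> phi (ind G (W - K)) mod 6" by simp
  ultimately have p1: "phi (ind G K) mod 6 < 2" by simp
  let ?K = "K - {q} - {s}" and ?Q = "insert p (insert r (W - K))"
  have "phi (ind G ?K) mod 6 + phi (ind G ?Q) mod 6 <
    int (meet G (set (flat [(a, q), (b, s)]))) - 2 * int (length [(a, q), (b, s)]) - 4 * int (length [v])"
  proof (rule parity[OF c(2)])
    show "?K \<union> ?Q = verts G - set (flat [(a, q), (b, s)]) - set [v]" using K W in_verts(2,4) Db by auto
    show "?K \<inter> ?Q = {}" using K(2) ab by blast
    show "N u \<inter> ?Q = {}" if "u \<in> ?K" for u using cl[of u] nK[of u] that by blast
  qed auto
  moreover have "0 \<le> phi (ind G ?Q) mod 6" by simp
  ultimately have p2: "phi (ind G ?K) mod 6 < int (meet G (set (flat [(a, q), (b, s)]))) - 8" by simp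
  have m: "meet G (set (flat [(a, q), (b, s)])) \<le> 8 + card (N s - {b, q, a})"
    using meet_le_budget[OF G, of "flat [(a, q), (b, s)]"] 
      card3[of a] le3[of b "{q, a}"] le2[OF adj(8), of "{a}"] by simp
  have KV: "K \<subseteq> verts G" using K(2) W by blast
  have e1: "phi (ind G K) = phi (ind G (K - {q})) + 2" using phi_remove[OF G K(1) KV] c2 by simp
  have "s \<in> K - {q}" "K - {q} \<subseteq> verts G" using K Db KV by auto
  from phi_remove[OF G this] have e2: "phi (ind G (K - {q})) = phi (ind G ?K) + 4 - int (card (N s \<inter> (K - {q})))" .
  show False
  proof (cases "q \<in> N s")
    case True
    have "N s \<inter> (K - {q}) = N s \<inter> K - {q}" by blast
    then have "card (N s \<inter> (K - {q})) = 1" using c2(2) True K(1) by simp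
    moreover have "card (N s - {b, q, a}) \<le> 1" using le1[OF adj(11) True, of "{b, q, a}"] Db by simp
    ultimately have "phi (ind G K) = phi (ind G ?K) + 5" "phi (ind G ?K) mod 6 < 1" using e1 e2 p2 m by linarith+
    then show False using p1 by presburger
  next
    case False
    have "N s \<inter> (K - {q}) = N s \<inter> K" using False by blast
    then have "card (N s \<inter> (K - {q})) = 2" using c2(2) by simp
    moreover have "card (N s - {b, q, a}) \<le> 2" using le2[OF adj(11), of "{b, q, a}"] by simp
    ultimately have "phi (ind G K) = phi (ind G ?K) + 4" "phi (ind G ?K) mod 6 < 2" using e1 e2 p2 m by linarith+
    then show False using p1 by presburger
  qed
qed

definition good :: bool where
  "good \<longleftrightarrow> (\<exists>y z w. N p = {a, y, z} \<and> y \<noteq> a \<and> z \<noteq> a \<and> z \<noteq> y \<and> y \<noteq> q \<and> y \<notin> N q \<and>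
     (reach q w \<or> reach y w) \<and> (w = z \<or> low w))"

lemma not_good:
  assumes n: "\<not> good" and y: "N p = {a, y, z}" "y \<noteq> a" "z \<noteq> a" "z \<noteq> y"
  shows "y \<noteq> q" "y \<notin> N q" "\<not> reach q y" "\<not> reach q z" "\<not> reach y z"
    "reach q w \<Longrightarrow> \<not> low w" "reach y w \<Longrightarrow> \<not> low w"
proof -
  have v': "N v = {b, a}" "b \<noteq> a" "p \<noteq> v" "q \<noteq> v" "p \<noteq> q"
    using Nv distinct_both[OF D] by auto
  have yz: "y \<in> W" "z \<in> W" using pW y by auto
  have sw: "N p = {a, z, y}" using y by auto
  have n1: False if "y \<noteq> q" "y \<notin> N q" "reach q w \<or> reach y w" "w = z \<or> low w" for w
    using n y that unfolding good_def by blast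
  have n2: False if "z \<noteq> q" "z \<notin> N q" "reach q w \<or> reach z w" "w = y \<or> low w" for w
    using n sw y(2-4) that unfolding good_def by blast
  have conn: "reach q x" if "x = q \<or> x \<in> N q" "x \<in> W" for x
    using that reach_nbr[of q q x] qsW by blast
  from side_valid[OF v'(1,2) Na v'(3,4,5)] obtain x where x: "x \<in> N p" "x \<noteq> a" "x \<noteq> q"
    "x \<notin> N q" by blast
  then have "x = y \<or> x = z" using y by auto
  then have ok: "y \<noteq> q \<and> y \<notin> N q" "z \<noteq> q \<and> z \<notin> N q"
    using x n1[of z] n2[of y] conn[of y] conn[of z] yz by blast+
  then show "y \<noteq> q" "y \<notin> N q" by blast+
  show "\<not> reach q y" "\<not> reach q z" "\<not> reach y z" "reach q w \<Longrightarrow> \<not> low w"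
    "reach y w \<Longrightarrow> \<not> low w"
    using n1 n2 ok by blast+
qed

lemma not_both_good:
  assumes "good" "two_sides.good G b r s W"
  shows False
proof -
  interpret S: two_sides G v b r s a p q W by (rule swap)
  obtain y z w where y: "N p = {a, y, z}" "y \<noteq> a" "z \<noteq> a" "z \<noteq> y" "y \<noteq> q"
    "y \<notin> N q"
    "reach q w \<or> reach y w" "w = z \<or> low w"
    using assms(1) unfolding good_def by blast
  obtain t t' w' where t: "N r = {b, t, t'}" "t \<noteq> b" "t' \<noteq> b" "t' \<noteq> t" "t \<noteq> s"
    "t \<notin> N s"
    "reach s w' \<or> reach t w'" "w' = t' \<or> low w'"
    using assms(2) unfolding S.good_def by blast
  show False using two_edges_reach[OF y(1-6) t(1-6), of w w'] y t by blast
qed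

lemma is_good: good
proof (rule ccontr)
  assume n: "\<not> good"
  interpret S: two_sides G v b r s a p q W by (rule swap)
  have rs: "reach x y \<Longrightarrow> reach y x" for x y by (rule reach_sym)
  have rt: "reach x y \<Longrightarrow> reach y z \<Longrightarrow> reach x z" for x y z by (rule rtrancl_trans)
  have ab: "a \<in> N p" "b \<in> N r" using adj by blast+
  obtain y z where y: "N p = {a, y, z}" "y \<noteq> a" "z \<noteq> a" "z \<noteq> y"
    by (rule one_known[OF ab(1)]) (use c in auto)
  have z: "N p = {a, z, y}" "z \<noteq> a" "y \<noteq> a" "y \<noteq> z" using y by auto
  note Y = not_good[OF n y] and Z = not_good[OF n z]
  have p1: "\<not> reach q u" if "u \<in> N p" "u \<noteq> a" for u using that y Y Z by blast
  have TE: False if "N r = {b, t, t'}" "t \<noteq> b" "t' \<noteq> b" "t' \<noteq> t" "t \<noteq> s"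
    "t \<notin> N s"
      "reach q w \<and> (w = t' \<or> low w) \<or> reach q t"
      "(reach s w' \<or> reach t w') \<and> (w' = y \<or> w' = z \<or> w' = t' \<or> low w')" for t t' w w'
    using two_edges_reach[OF y Y(1,2) that(1-6), of w w'] two_edges_reach[OF z Z(1,2) that(1-6), of w w']
    that(7,8) by blast
  show False
  proof (cases "\<exists>t\<in>N r. t \<noteq> b \<and> reach q t")
    case False
    then show False using no_single_hit[OF p1 Y(6)] no_double_hit[OF p1 Y(6)] by blast
  next
    case True
    then obtain t where t: "t \<in> N r" "t \<noteq> b" "reach q t" by blast
    obtain t' where t': "N r = {b, t, t'}" "t' \<noteq> b" "t' \<noteq> t"
      by (rule two_known[OF ab(2) t(1) t(2)[symmetric]]) (use c t in auto)
    have t's: "N r = {b, t', t}" using t' by auto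
    have W: "t \<in> W" "t' \<in> W" using rW t' t by auto
    have conn: "reach s x" if "x = s \<or> x \<in> N s" "x \<in> W" for x
      using that reach_nbr[of s s x] qsW by blast
    show False
    proof (cases "reach q s")
      case qs: True
      have st: "reach s t" using rt[OF rs[OF qs] t(3)] .
      show False
      proof (cases "t' \<noteq> s \<and> t' \<notin> N s")
        case True
        then show False using TE[OF t's t'(2) t(2), of t t] t'(3) t(3) st by blast
      next
        case False
        then have st': "reach s t'" using conn W by blast
        have v': "b \<noteq> a" "r \<noteq> v" "s \<noteq> v" "r \<noteq> s" using distinct_both[OF D] by auto
        from side_valid[OF Nv v'(1)[symmetric] Nb v'(2-4)] obtain x where "x \<in> N r" "x \<noteq> b"
          "x \<noteq> s" "x \<notin> N s" by blast
        then have "t \<noteq> s" "t \<notin> N s" using t' False by auto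
        then show False using TE[OF t'(1) t(2) t'(2,3), of t t'] t(3) st' by blast
      qed
    next
      case qs: False
      have tn: "t \<noteq> s" "t \<notin> N s" "\<not> reach s t"
        using qs t(3) rt rs conn[of t] W by blast+
      have st': "\<not> reach s t'" using TE[OF t'(1) t(2) t'(2,3) tn(1,2), of t t'] t(3) by blast
      have t'n: "t' \<noteq> s" "t' \<notin> N s" using st' conn W by blast+
      note T = TE[OF t's t'(2) t(2) t'(3)[symmetric] t'n, of t]
      have pt: "\<not> reach s u" if "u \<in> N r" "u \<noteq> b" for u using that t' tn st' by blast
      have pl: "\<not> low w" if "reach s w" for w using T[of w] t(3) that by blast
      have pu: "\<not> reach s u" if "u \<in> N p" "u \<noteq> a" for u using T[of u] t(3) that y by blast
      have sq: "\<not> reach s q" using qs rs by blast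
      from S.no_single_hit[OF pt pl pu sq] show False .
    qed
  qed
qed

lemma absurd: False
proof -
  interpret S: two_sides G v b r s a p q W by (rule swap)
  show False using not_both_good is_good S.is_good by blast
qed

end

context min_counterexample
begin

lemma adjacent_pair:
  assumes "N v = {a, b}" "N a = {v, p, q}" "N b = {v, r, s}" "distinct [v, a, b, p, q, r, s]"
    "card (N p) = 3" "card (N r) = 3"
  shows "r \<in> N p"
proof (rule ccontr)
  assume pr: "r \<notin> N p"
  have "\<not> (q \<in> N r \<and> s \<in> N p)" using cross[OF assms pr] by blast
  then interpret two_sides G v a p q b r s "verts G - {a, p, b, r, v}"
    using assms pr by unfold_locales simp_all
  show False by (rule absurd)
qed

lemma not_all_cubic:
  assumes v: "N v = {a, b}" "a \<noteq> b" and a: "N a = {v, p, q}" "p \<noteq> v" "q \<noteq> v" "p \<noteq> q"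
    and b: "N b = {v, r, s}" "r \<noteq> v" "s \<noteq> v" "r \<noteq> s"
    and c: "card (N p) = 3" "card (N q) = 3" "card (N r) = 3" "card (N s) = 3"
  shows False
proof -
  have mem: "p \<in> N a" "q \<in> N a" "r \<in> N b" "s \<in> N b" "a \<in> N v" "b \<in> N v" using v a b
    by simp_all
  have ab: "b \<notin> N a" "a \<notin> N b" using no_triangle_deg2[OF v] sym by blast+
  have "w \<notin> N b" if "w \<in> N a" "w \<noteq> v" for w using no_square_deg2[OF v that(2,1)] by blast
  then have "p \<notin> N b" "q \<notin> N b" using mem a by blast+
  then have n: "p \<noteq> r" "p \<noteq> s" "q \<noteq> r" "q \<noteq> s" using mem by blast+
  have "p \<noteq> b" "q \<noteq> b" "r \<noteq> a" "s \<noteq> a" using mem ab by blast+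
  then have D: "distinct [v, a, b, p, q, r, s]" "distinct [v, a, b, q, p, r, s]"
    "distinct [v, a, b, p, q, s, r]" "distinct [v, a, b, q, p, s, r]"
    using n v(2) a(2-4) b(2-4) neq[OF mem(1)] neq[OF mem(2)] neq[OF mem(3)] neq[OF mem(4)] neq[OF mem(5)]
    neq[OF mem(6)] by auto
  have a': "N a = {v, q, p}" and b': "N b = {v, s, r}" using a b by auto
  have e: "r \<in> N p" "r \<in> N q" "s \<in> N p" "s \<in> N q"
    using adjacent_pair[OF v(1) a(1) b(1) D(1)] adjacent_pair[OF v(1) a' b(1) D(2)]
      adjacent_pair[OF v(1) a(1) b' D(3)] adjacent_pair[OF v(1) a' b' D(4)] c by blast+
  have N: "N p = {a, r, s}" "N q = {a, r, s}"
    using three_known[OF sym[OF mem(1)] e(1,3)] three_known[OF sym[OF mem(2)] e(2,4)] D by auto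
  have v': "N v = {b, a}" "b \<noteq> a" using v by auto
  show False by (rule no_twin[OF v' a N]) (use D in auto)
qed

lemma contradiction: False
proof -
  have "verts G \<noteq> {}"
  proof
    assume V: "verts G = {}"
    then have "edges G = {}" using G by (auto simp: simple_graph_def)
    then have "covering_matching G {}" by (simp add: covering_matching_def matching_def)
    then have "bnd G (phi G)" unfolding bnd_def
      using V \<open>edges G = {}\<close> by (intro exI[of _ "{}"]) (simp add: phi_def)
    with no_bnd show False by blast
  qed
  then obtain v where v: "v \<in> verts G" "card (N v) \<le> 2"
    using dG degree_nbr[OF G] by (force simp: deficient_def)
  then have "card (N v) = 2" using deg_ge2[OF v(1)] by simp
  then obtain a b where ab: "N v = {a, b}" "a \<noteq> b" by (auto simp: card_2_iff)
  have ab': "N v = {b, a}" "b \<noteq> a" using ab by auto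
  have va: "v \<in> N a" "v \<in> N b" using ab sym by blast+
  have three: "\<exists>p q. N x = {v, p, q} \<and> p \<noteq> v \<and> q \<noteq> v \<and> p \<noteq> q \<and> card (N p) = 3 \<and> card (N q) = 3"
    if x: "N v = {x, x'}" "x \<noteq> x'" "v \<in> N x" for x x'
  proof -
    have low: "4 \<le> card (N t)" if "t \<in> N x" "t \<noteq> v" "card (N x) = 2" for t
      using low_side[OF x(1,2) that(1,2)] that(3) by (cases "4 \<le> card (N t)") auto
    show ?thesis
    proof (rule one_known[OF x(3)])
      fix t assume t: "N x = {v, t}" "t \<noteq> v"
      then have "4 \<le> card (N t)" using low[of t] by simp
      then show ?thesis using card3[of t] by simp
    next
      fix t u assume t: "N x = {v, t, u}" "t \<noteq> v" "u \<noteq> v" "u \<noteq> t"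
      then have "card (N x) = 3" by simp
      then have "3 \<le> card (N t)" "3 \<le> card (N u)"
        using low_side[OF x(1,2), of t] low_side[OF x(1,2), of u] t by force+
      then show ?thesis using t card3 le_antisym by metis
    qed
  qed
  show False using three[OF ab va(1)] three[OF ab' va(2)] not_all_cubic[OF ab] by blast
qed

end

theorem deficient_bnd:
  fixes G :: "'a ugraph"
  assumes "simple_graph G" "subcubic G" "deficient G"
  shows "bnd G (phi G)"
  using assms
proof (induction "card (verts G)" arbitrary: G rule: less_induct)
  case less
  show ?case
  proof (rule ccontr)
    assume "\<not> bnd G (phi G)"
    then interpret min_counterexample G using less by unfold_locales auto
    show False by (rule contradiction)
  qed
qed

section \<open>Connected graphs\<close>

lemma connected_deficient:
  assumes "connected_graph G" "subcubic G" "\<not> cubic G"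
  shows "deficient G"
proof -
  obtain w where w: "w \<in> verts G" "degree G w \<noteq> 3" using assms(3) by (auto simp: cubic_def)
  then have "degree G w \<le> 2" using assms(2) unfolding subcubic_def by fastforce
  then show ?thesis using w assms(1) unfolding deficient_def connected_graph_def adj_rel_def by blast
qed

lemma deficient_ind_connected:
  assumes G: "simple_graph G" "subcubic G" "connected_graph G" and S: "S \<subset> verts G"
  shows "deficient (ind G S)"
  unfolding deficient_def
proof
  fix u assume "u \<in> verts (ind G S)"
  then have u: "u \<in> S" by simp
  obtain w where w: "w \<in> verts G" "w \<notin> S" using S by blast
  have "(u, w) \<in> (adj_rel G)\<^sup>*"
    using G(3) u S w unfolding connected_graph_def adj_rel_def by blast
  moreover have sI: "simple_graph (ind G S)" using G(1) S simple_ind by blast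
  ultimately have "(w \<in> S \<and> (u, w) \<in> (adj_rel (ind G S))\<^sup>*) \<or>
    (\<exists>z\<in>S. (u, z) \<in> (adj_rel (ind G S))\<^sup>* \<and> degree (ind G S) z \<le> 2)"
  proof (induction rule: rtrancl_induct)
    case base
    then show ?case using u by simp
  next
    case (step y z)
    show ?case
    proof (cases "y \<in> S \<and> (u, y) \<in> (adj_rel (ind G S))\<^sup>* \<and> z \<notin> S")
      case True
      then have "nbr G y \<inter> S \<subset> nbr G y" using step(2) by (auto simp: adj_rel_iff)
      then have "card (nbr G y \<inter> S) < card (nbr G y)"
        using nbr_props(4)[OF G(1)] by (meson psubset_card_mono)
      moreover have "card (nbr G y) \<le> 3" using G subcubic_nbr by blast
      ultimately have "degree (ind G S) y \<le> 2"
        using True degree_nbr[OF sI] by (simp add: nbr_ind)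
      then show ?thesis using True by blast
    next
      case False
      have "(y, z) \<in> adj_rel (ind G S)" if "y \<in> S" "z \<in> S"
        using that step(2) nbr_ind[of y S G] by (simp add: adj_rel_iff)
      then show ?thesis using False step by (metis rtrancl.rtrancl_into_rtrancl)
    qed
  qed
  then show "\<exists>w\<in>verts (ind G S). (u, w) \<in> (adj_rel (ind G S))\<^sup>* \<and> degree (ind G S) w \<le> 2"
    using w(2) by simp
qed

lemma edges_complete_bipartite:
  "{p, q} \<in> edges (complete_bipartite m n) \<longleftrightarrow>
    (\<exists>i<m. \<exists>j<n. p = Inl i \<and> q = Inr j \<or> p = Inr j \<and> q = Inl i)"
  by (auto simp: complete_bipartite_def doubleton_eq_iff)

locale connected_cubic =
  fixes G :: "'a ugraph"
  assumes G: "simple_graph G" and con: "connected_graph G" and cub: "cubic G"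
begin

abbreviation N :: "'a \<Rightarrow> 'a set" where "N \<equiv> nbr G"

lemma sc: "subcubic G"
  using cub by (simp add: cubic_def subcubic_def)

lemma fin: "finite (N v)"
  using nbr_props(4)[OF G] .

lemma sym: "u \<in> N v \<Longrightarrow> v \<in> N u"
  by (rule nbr_symD)

lemma inV: "u \<in> N v \<Longrightarrow> u \<in> verts G"
  using nbr_props[OF G] by blast

lemma neq: "u \<in> N v \<Longrightarrow> u \<noteq> v"
  using nbr_props(1)[OF G] .

lemma c3: "v \<in> verts G \<Longrightarrow> card (N v) = 3"
  using cub degree_nbr[OF G] by (simp add: cubic_def)

lemma ind_bnd:
  assumes "W \<subset> verts G"
  shows "bnd (ind G W) (phi (ind G W) - phi (ind G W) mod 6)"
proof -
  have WV: "W \<subseteq> verts G" using assms by blast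
  have "bnd (ind G W) (phi (ind G W))"
    using deficient_bnd[OF simple_ind[OF G WV] subcubic_ind[OF G sc WV] deficient_ind_connected[OF G sc con assms]] .
  then show ?thesis by (rule bnd_minus_mod)
qed

lemma parity:
  assumes c: "config G ps js" and ne: "ps \<noteq> []"
    and KQ: "K \<union> Q = verts G - set (flat ps) - set js" "K \<inter> Q = {}"
    and sep: "\<And>u. u \<in> K \<Longrightarrow> N u \<inter> Q = {}"
  shows "bnd G (phi G + int (meet G (set (flat ps))) - 2 * int (length ps) - 4 * int (length js)
    - phi (ind G K) mod 6 - phi (ind G Q) mod 6)"
proof -
  interpret split_config G ps js K Q
    using G c KQ sep by unfold_locales
  obtain z where z: "z \<in> set (flat ps)"
    using ne by (cases ps) fastforce+
  then have "z \<in> verts G" using flat_subset by blast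
  then have "K \<subset> verts G" "Q \<subset> verts G" using KQ z by blast+
  from bnd_split[OF ind_bnd[OF this(1)] ind_bnd[OF this(2)]]
  show ?thesis by (rule bnd_mono) (use phi_split in linarith)
qed

lemma other_nbrs:
  assumes "u' \<in> N u"
  obtains x x2 where "N u = {u', x, x2}" "x \<noteq> u'" "x2 \<noteq> u'" "x \<noteq> x2"
proof -
  have "card (N u) = 3" using c3 inV[OF sym[OF assms]] .
  then have "card (N u - {u'}) = 2" using card_Diff_singleton[OF assms] by simp
  then obtain x x2 where "N u - {u'} = {x, x2}" "x \<noteq> x2" by (auto simp: card_2_iff)
  then have "N u = {u', x, x2}" "x \<noteq> u'" "x2 \<noteq> u'" "x \<noteq> x2" using assms by auto
  then show thesis by (rule that)
qed

lemma three_known: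
  assumes "u \<in> N x" "w \<in> N x" "t \<in> N x" "u \<noteq> w" "t \<noteq> u" "t \<noteq> w"
  shows "N x = {u, w, t}"
proof -
  have "card (N x) = 3" using c3 inV[OF sym[OF assms(1)]] .
  then show ?thesis using card_subset_eq[OF fin, of "{u, w, t}" x] assms by simp
qed

lemma rewired:
  assumes u: "N u = {u', x, x2}" "x \<noteq> u'" "x2 \<noteq> u'" "x \<noteq> x2"
    and u': "N u' = {u, y, y2}" "y \<noteq> u" "y2 \<noteq> u" "y \<noteq> y2"
    and xy: "x \<noteq> y" "y \<notin> N x"
    and W: "W = verts G - {u, u'}"
    and r: "(\<alpha>, \<beta>) \<in> (adj_rel (ind G W))\<^sup>*" "\<alpha> = x \<or> \<alpha> = y"
    "\<beta> = x2 \<or> \<beta> = y2"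
  shows "bnd G (phi G + 2)"
proof -
  have mem: "u' \<in> N u" "x \<in> N u" "x2 \<in> N u" "y \<in> N u'" "y2 \<in> N u'" "u \<in> N u'" using u u'
    by simp_all
  interpret R: rewiring G u u' x y
    using G mem u(2) u'(2) xy by unfold_locales
  let ?R = "rewire G u u' x y"
  have V: "u \<in> verts G" "u' \<in> verts G" "x \<in> W" "y \<in> W" "x2 \<in> W" "y2 \<in> W"
    using inV[OF mem(6)] inV[OF mem(1)] inV[OF mem(2)] inV[OF mem(3)] inV[OF mem(4)] inV[OF mem(5)]
      neq[OF mem(2)] neq[OF mem(3)] neq[OF mem(4)] neq[OF mem(5)] u(2,3) u'(2,3) W by simp_all
  have "{e \<in> edges G. e \<inter> {u, u'} = {}} = {e \<in> edges G. e \<subseteq> W}"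
    using G W by (auto simp: simple_graph_def)
  then have RF: "?R = add_edges G W {{x, y}}" by (simp add: rewire_def add_edges_def W)
  have WV: "W \<subset> verts G" using W V by blast
  have d3: "card (nbr ?R x2) \<le> 2" "card (nbr ?R y2) \<le> 2"
    using R.card_nbr_rewire_less[of x2] R.card_nbr_rewire_less[of y2] mem u(4) u'(4)
      c3[OF inV[OF mem(3)]] c3[OF inV[OF mem(5)]] by force+
  then have b2: "degree ?R \<beta> \<le> 2" "\<beta> \<in> W" using r(3) degree_nbr[OF R.simple] V by auto
  have dR: "deficient ?R"
    unfolding RF
  proof (rule deficient_add)
    show "deficient (ind G W)" using deficient_ind_connected[OF G sc con WV] .
    fix w assume w: "w \<in> \<Union>{{x, y}}"
    have ad: "(x, y) \<in> adj_rel (add_edges G W {{x, y}})" "(y, x) \<in> adj_rel (add_edges G W {{x, y}})"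
      by (simp_all add: adj_rel_def add_edges_def insert_commute)
    have "(\<alpha>, \<beta>) \<in> (adj_rel (add_edges G W {{x, y}}))\<^sup>*" using reach_add[OF r(1)] .
    then have "(w, \<beta>) \<in> (adj_rel (add_edges G W {{x, y}}))\<^sup>*"
      using ad w r(2) by (auto intro: converse_rtrancl_into_rtrancl)
    then show "\<exists>z\<in>W. (w, z) \<in> (adj_rel (add_edges G W {{x, y}}))\<^sup>* \<and> degree (add_edges G W {{x, y}}) z \<le> 2"
      using b2 RF by auto
  qed
  have "bnd ?R (phi ?R)" using deficient_bnd[OF R.simple R.subcubic_rewire[OF sc] dR] .
  from R.bnd_rewire[OF this] have b: "bnd G (phi ?R + 6)" .
  interpret split_config G "[(u, u')]" "[]" W "{}"
    using G mem W neq[OF mem(1)] by unfold_locales (auto simp: config_def)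
  have "card (N u) \<le> 3" "card (N u' - {u}) \<le> 2"
    using c3[OF V(1)] c3[OF V(2)] card_Diff_singleton[OF mem(6)] by simp_all
  then have m: "meet G (set (flat [(u, u')])) \<le> 5"
    using meet_le_budget[OF G, of "flat [(u, u')]"] by simp
  have "{x, y} \<notin> edges G" using xy by (simp add: nbr_def)
  then have "phi ?R = phi (ind G W) - 1"
    using finite_edges[OF G] by (simp add: RF phi_def add_edges_def)
  then have "phi ?R + 6 \<le> phi G + 2" using phi_split m G by simp
  with b show ?thesis by (rule bnd_mono)
qed

lemma disconnected_pair:
  assumes u: "N u = {u', x, x2}" "x \<noteq> u'" "x2 \<noteq> u'" "x \<noteq> x2"
    and u': "N u' = {u, y, y2}" "y \<noteq> u" "y2 \<noteq> u" "y \<noteq> y2"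
    and xy: "x \<noteq> y" "y \<notin> N x"
  shows "bnd G (phi G + 2)"
proof (rule ccontr)
  assume n: "\<not> ?thesis"
  define W where "W = verts G - {u, u'}"
  let ?r = "\<lambda>\<alpha> \<beta>. (\<alpha>, \<beta>) \<in> (adj_rel (ind G W))\<^sup>*"
  have u2: "N u = {u', x2, x}" "x2 \<noteq> u'" "x \<noteq> u'" "x2 \<noteq> x" using u by auto
  have mem: "u' \<in> N u" "x \<in> N u" "x2 \<in> N u" "y \<in> N u'" "y2 \<in> N u'" "u \<in> N u'" using u u'
    by simp_all
  have V: "u \<in> verts G" "u' \<in> verts G" "x \<in> W" "y \<in> W" "x2 \<in> W" "y2 \<in> W"
    using inV[OF mem(6)] inV[OF mem(1)] inV[OF mem(2)] inV[OF mem(3)] inV[OF mem(4)] inV[OF mem(5)]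
      neq[OF mem(2)] neq[OF mem(3)] neq[OF mem(4)] neq[OF mem(5)] u(2,3) u'(2,3) W_def by simp_all
  have step: "?r z t" if "?r z w" "w \<in> W" "t \<in> N w" "t \<in> W" for z w t
  proof -
    have "(w, t) \<in> adj_rel (ind G W)" using that nbr_ind[of w W G] by (simp add: adj_rel_iff)
    with that(1) show ?thesis by (rule rtrancl_into_rtrancl)
  qed
  have R: "\<not> ?r \<alpha> \<beta>" if "\<alpha> = x \<or> \<alpha> = y"
    "\<beta> = x2 \<or> \<beta> = y2" for \<alpha> \<beta>
    using rewired[OF u u' xy W_def _ that] n by blast
  have "\<not> ?r y x2" using R by blast
  then have "\<not> ?r x2 y" using reach_sym by metis
  then have xy2: "x2 \<noteq> y" "y \<notin> N x2" using step[of x2 x2 y] V by auto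
  have "\<not> ?r y x" using rewired[OF u2 u' xy2 W_def] n by blast
  then have nr: "\<not> ?r x y" "\<not> ?r x x2" "\<not> ?r x y2" using R reach_sym by metis+
  define K where "K = {w \<in> W. ?r x w}"
  have K: "x \<in> K" "K \<subseteq> W" "y \<notin> K" "x2 \<notin> K" "y2 \<notin> K" using V nr
    by (auto simp: K_def)
  have cl: "t \<in> K" if "w \<in> K" "t \<in> N w" "t \<in> W" for w t
    using that step[of x w t] unfolding K_def by blast
  have nu': "u' \<notin> N w" if "w \<in> K" for w
  proof
    assume "u' \<in> N w"
    then have "w \<in> N u'" by (rule sym)
    then show False using u' K that W_def by auto
  qed
  have xu: "u \<in> N x" using sym[OF mem(2)] .
  have "N x \<subseteq> insert u W" using nu'[OF K(1)] inV W_def by blast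
  then have "N x \<inter> K = N x - {u}" using cl[OF K(1)] K(2) W_def by blast
  then have c2: "card (N x \<inter> K) = 2" using card_Diff_singleton[OF xu] c3[of x] V W_def by simp
  have cu: "card (N u) = 3" "card (N u' - {u}) = 2" "card (N x - {u}) = 2"
    using c3[of u] c3[of u'] c3[of x] card_Diff_singleton[OF mem(6)] card_Diff_singleton[OF xu] V W_def by simp_all
  have c: "config G [(u, u')] []" "config G [(u, x)] []"
    using mem neq[OF mem(1)] neq[OF mem(2)] by (simp_all add: config_def)
  have m: "meet G (set (flat [(u, u')])) \<le> 5" "meet G (set (flat [(u, x)])) \<le> 5"
    using meet_le_budget[OF G, of "flat [(u, u')]"] meet_le_budget[OF G, of "flat [(u, x)]"] cu by simp_all
  have "bnd G (phi G + int (meet G (set (flat [(u, u')]))) - 2 * int (length [(u, u')]) - 4 * int (length ([] :: 'a list))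
    - phi (ind G K) mod 6 - phi (ind G (W - K)) mod 6)"
  proof (rule parity[OF c(1)])
    show "K \<union> (W - K) = verts G - set (flat [(u, u')]) - set []" using K(2) W_def by auto
    show "N w \<inter> (W - K) = {}" if "w \<in> K" for w using cl[OF that] by blast
  qed auto
  then have "\<not> phi G + int (meet G (set (flat [(u, u')]))) - 2 * int (length [(u, u')]) - 4 * int (length ([] :: 'a list))
    - phi (ind G K) mod 6 - phi (ind G (W - K)) mod 6 \<le> phi G + 2"
    using n bnd_mono by blast
  moreover have "0 \<le> phi (ind G (W - K)) mod 6" by simp
  ultimately have p1: "phi (ind G K) mod 6 < 1" using m by simp
  let ?Q = "insert u' (W - K)"
  have "bnd G (phi G + int (meet G (set (flat [(u, x)]))) - 2 * int (length [(u, x)]) - 4 * int (length ([] :: 'a list))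
    - phi (ind G (K - {x})) mod 6 - phi (ind G ?Q) mod 6)"
  proof (rule parity[OF c(2)])
    show "(K - {x}) \<union> ?Q = verts G - set (flat [(u, x)]) - set []"
      using K(1,2) W_def V(2) u(2) neq[OF mem(1)] by auto
    show "(K - {x}) \<inter> ?Q = {}" using K(2) W_def by blast
    show "N w \<inter> ?Q = {}" if "w \<in> K - {x}" for w using cl[of w] nu'[of w] that by blast
  qed auto
  then have "\<not> phi G + int (meet G (set (flat [(u, x)]))) - 2 * int (length [(u, x)]) - 4 * int (length ([] :: 'a list))
    - phi (ind G (K - {x})) mod 6 - phi (ind G ?Q) mod 6 \<le> phi G + 2"
    using n bnd_mono by blast
  moreover have "0 \<le> phi (ind G ?Q) mod 6" by simp
  ultimately have p2: "phi (ind G (K - {x})) mod 6 < 1" using m by simp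
  have "K \<subseteq> verts G" using K(2) W_def by blast
  from phi_remove[OF G K(1) this] have "phi (ind G K) = phi (ind G (K - {x})) + 2" using c2 by simp
  with p1 p2 show False by presburger
qed

lemma k4:
  assumes u: "N u = {u', x, x2}" "x \<noteq> u'" "x2 \<noteq> u'" "x \<noteq> x2" and x: "u' \<in> N x"
    "u' \<in> N x2" "x2 \<in> N x"
  shows "bnd G (phi G + 2)"
proof -
  have mem: "u \<in> N u'" "u \<in> N x" "u \<in> N x2" using sym[of _ u] u by auto
  have D: "distinct [u, u', x, x2]" using u(2-) neq[OF mem(1)] neq[OF mem(2)] neq[OF mem(3)] by auto
  have N: "N u' = {u, x, x2}" "N x = {u, u', x2}" "N x2 = {u, u', x}"
    using three_known[OF mem(1) sym[OF x(1)] sym[OF x(2)]] three_known[OF mem(2) x(1,3)]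
      three_known[OF mem(3) x(2) sym[OF x(3)]] D by auto
  have c: "config G [(u, u'), (x, x2)] []" using distinct_both[OF D] u N by (simp add: config_def)
  have m: "meet G (set (flat [(u, u'), (x, x2)])) \<le> 6"
    using meet_le_budget[OF G, of "flat [(u, u'), (x, x2)]"] distinct_both[OF D] u N by (simp add: insert_Diff_if)
  have "bnd G (phi G + int (meet G (set (flat [(u, u'), (x, x2)]))) - 2 * int (length [(u, u'), (x, x2)]) - 4 * int (length ([] :: 'a list))
    - phi (ind G (verts G - set (flat [(u, u'), (x, x2)]) - set [])) mod 6 - phi (ind G {}) mod 6)"
    by (rule parity[OF c]) auto
  moreover have "0 \<le> phi (ind G (verts G - set (flat [(u, u'), (x, x2)]) - set [])) mod 6" by simp
  ultimately show ?thesis using m G by (elim bnd_mono) simp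
qed

lemma k33:
  assumes D: "distinct [u, y, y2, u', x, x2]"
    and N: "N u = {u', x, x2}" "N y = {u', x, x2}" "N y2 = {u', x, x2}"
      "N u' = {u, y, y2}" "N x = {u, y, y2}" "N x2 = {u, y, y2}"
  shows "bnd G (phi G + 3)" "graph_isomorphic G (complete_bipartite 3 3)"
proof -
  note Db = distinct_both[OF D]
  let ?S = "{u, y, y2, u', x, x2}"
  have SV: "?S \<subseteq> verts G"
    using inV[of u u'] inV[of y u'] inV[of y2 u'] inV[of u' u] inV[of x u] inV[of x2 u] N by simp
  have V: "verts G = ?S"
  proof (rule ccontr)
    assume "verts G \<noteq> ?S"
    then have "?S \<subset> verts G" using SV by blast
    from deficient_ind_connected[OF G sc con this]
    have "\<forall>z\<in>?S. \<exists>w\<in>?S. (z, w) \<in> (adj_rel (ind G ?S))\<^sup>* \<and> degree (ind G ?S) w \<le> 2"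
      by (simp only: deficient_def verts_ind)
    from bspec[OF this insertI1] obtain w where w: "w \<in> ?S" "degree (ind G ?S) w \<le> 2" by (elim bexE conjE)
    have "N w \<subseteq> ?S" using w(1) N by auto
    then have "nbr (ind G ?S) w = N w" using nbr_ind[OF w(1), of G] by blast
    then have "degree (ind G ?S) w = 3" using degree_nbr[OF simple_ind[OF G SV]] c3[of w] w SV by auto
    with w show False by simp
  qed
  have c: "config G [(u, u'), (x, y), (x2, y2)] []" using Db N by (simp add: config_def)
  have m: "meet G (set (flat [(u, u'), (x, y), (x2, y2)])) \<le> 9"
    using meet_le_budget[OF G, of "flat [(u, u'), (x, y), (x2, y2)]"] Db N by (simp add: insert_Diff_if)
  have "bnd G (phi G + int (meet G (set (flat [(u, u'), (x, y), (x2, y2)]))) - 2 * int (length [(u, u'), (x, y), (x2, y2)]) - 4 * int (length ([] :: 'a list))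
    - phi (ind G {}) mod 6 - phi (ind G {}) mod 6)"
    by (rule parity[OF c]) (use V in auto)
  then show "bnd G (phi G + 3)" using m G by (elim bnd_mono) simp
  define f :: "'a \<Rightarrow> nat + nat" where "f w = (if w = u then Inl 0 else if w = y then Inl 1 else if w = y2 then Inl 2
    else if w = u' then Inr 0 else if w = x then Inr 1 else Inr 2)" for w
  have f: "f u = Inl 0" "f y = Inl 1" "f y2 = Inl 2" "f u' = Inr 0" "f x = Inr 1" "f x2 = Inr 2"
    using Db by (simp_all add: f_def)
  have "inj_on f ?S" using f by (simp add: inj_on_def)
  moreover have "f ` ?S = verts (complete_bipartite 3 3)"
    using f by (auto simp: complete_bipartite_def numeral_eq_Suc lessThan_Suc)
  ultimately have "bij_betw f (verts G) (verts (complete_bipartite 3 3))" by (simp add: V bij_betw_def)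
  moreover have "{w, w'} \<in> edges G \<longleftrightarrow> {f w, f w'} \<in> edges (complete_bipartite 3 3)" if "w \<in> ?S" "w' \<in> ?S" for w w'
  proof -
    define A B where "A = {u, y, y2}" and "B = {u', x, x2}"
    have NA: "z \<in> A \<Longrightarrow> N z = B" and NB: "z \<in> B \<Longrightarrow> N z = A" for z using N
      by (auto simp: A_def B_def)
    have fA: "z \<in> A \<Longrightarrow> \<exists>i<3. f z = Inl i"
      and fB: "z \<in> B \<Longrightarrow> \<exists>i<3. f z = Inr i" for z using f by (auto simp: A_def B_def)
    have AB: "A \<inter> B = {}" "w \<in> A \<or> w \<in> B" "w' \<in> A \<or> w' \<in> B" using Db that
      by (auto simp: A_def B_def)
    have "{w, w'} \<in> edges G \<longleftrightarrow> w' \<in> N w" by (simp add: nbr_def)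
    also have "\<dots> \<longleftrightarrow> w \<in> A \<and> w' \<in> B \<or> w \<in> B \<and> w' \<in> A"
      using NA[of w] NB[of w] AB by blast
    also have "\<dots> \<longleftrightarrow> {f w, f w'} \<in> edges (complete_bipartite 3 3)"
      unfolding edges_complete_bipartite using fA[of w] fA[of w'] fB[of w] fB[of w'] AB by fastforce
    finally show ?thesis .
  qed
  ultimately show "graph_isomorphic G (complete_bipartite 3 3)"
    unfolding graph_isomorphic_def V by blast
qed

lemma cubic_bnd:
  "bnd G (phi G + 2) \<or> bnd G (phi G + 3) \<and> graph_isomorphic G (complete_bipartite 3 3)"
proof (rule disjCI)
  assume n: "\<not> (bnd G (phi G + 3) \<and> graph_isomorphic G (complete_bipartite 3 3))"
  obtain u where "u \<in> verts G" using con by (auto simp: connected_graph_def)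
  then have "N u \<noteq> {}" using c3[of u] by auto
  then obtain u' where uu': "u' \<in> N u" by blast
  obtain x x2 where u: "N u = {u', x, x2}" "x \<noteq> u'" "x2 \<noteq> u'" "x \<noteq> x2"
    using other_nbrs[OF uu'] .
  obtain y y2 where u': "N u' = {u, y, y2}" "y \<noteq> u" "y2 \<noteq> u" "y \<noteq> y2"
    using other_nbrs[OF sym[OF uu']] .
  have sw: "N u = {u', x2, x}" "x2 \<noteq> x" "N u' = {u, y2, y}" "y2 \<noteq> y" using u u' by auto
  have mem: "u \<in> N x" "u \<in> N x2" "u' \<in> N y" "u' \<in> N y2"
    using sym[of x u] sym[of x2 u] sym[of y u'] sym[of y2 u'] u u' by simp_all
  show "bnd G (phi G + 2)"
  proof (cases "(x = y \<or> y \<in> N x) \<and> (x = y2 \<or> y2 \<in> N x) \<and> (x2 = y \<or> y \<in> N x2) \<and> (x2 = y2 \<or> y2 \<in> N x2)")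
    case False
    then show ?thesis
      using disconnected_pair[OF u u'] disconnected_pair[OF sw(1) u(3,2) sw(2) u']
        disconnected_pair[OF u sw(3) u'(3,2) sw(4)] disconnected_pair[OF sw(1) u(3,2) sw(2) sw(3) u'(3,2) sw(4)]
          by blast
  next
    case True
    have eq: "bnd G (phi G + 2)" if "N u = {u', a, b}" "a \<noteq> u'" "b \<noteq> u'" "a \<noteq> b"
      "u' \<in> N a" "u' \<in> N c" "u \<in> N a" "u \<in> N b" "a \<noteq> c" "c \<noteq> u"
      "c \<in> N a" "a \<in> N b" for a b c
    proof -
      have "N a = {u, u', c}" using three_known[OF that(7,5,11)] neq[OF that(6)] that(10) neq[OF uu'] by auto
      then have "b = c" using sym[OF that(12)] that neq[of u b] by auto
      then show ?thesis using k4[OF that(1-5)] that(6) sym[OF that(12)] by blast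
    qed
    consider "x = y" | "x = y2" | "x2 = y" | "x2 = y2" | "x \<noteq> y" "x \<noteq> y2" "x2 \<noteq> y"
      "x2 \<noteq> y2" by blast
    then show ?thesis
    proof cases
      case 1
      then show ?thesis using eq[OF u, of y2] True mem u u' by auto
    next
      case 2
      then show ?thesis using eq[OF u, of y] True mem u u' by auto
    next
      case 3
      then show ?thesis using eq[OF sw(1) u(3,2) sw(2), of y2] True mem u u' by auto
    next
      case 4
      then show ?thesis using eq[OF sw(1) u(3,2) sw(2), of y] True mem u u' by auto
    next
      case 5
      have e: "y \<in> N x" "y2 \<in> N x" "y \<in> N x2" "y2 \<in> N x2" using True 5 by blast+
      have D: "distinct [u, y, y2, u', x, x2]"
        using 5 u(2-) u'(2-) neq[OF mem(1)] neq[OF mem(2)] neq[OF mem(3)] neq[OF mem(4)] neq[OF uu'] by auto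
      have "N x = {u, y, y2}" "N x2 = {u, y, y2}" "N y = {u', x, x2}" "N y2 = {u', x, x2}"
        using three_known[OF mem(1) e(1,2)] three_known[OF mem(2) e(3,4)]
        three_known[OF mem(3) sym[OF e(1)] sym[OF e(3)]]
          three_known[OF mem(4) sym[OF e(2)] sym[OF e(4)]] distinct_both[OF D] by simp_all
      then show ?thesis using k33[OF D u(1)] u'(1) n by blast
    qed
  qed
qed

end

lemma gamma_le_bnd:
  assumes G: "simple_graph G" and "bnd G z"
  shows "6 * int (\<gamma> G) \<le> z"
proof -
  obtain M where M: "covering_matching G M" "6 * int (card M) \<le> z" using assms(2) by (auto simp: bnd_def)
  have "\<not> (\<exists>M'. matching G M' \<and> M \<subset> M')"
  proof
    assume "\<exists>M'. matching G M' \<and> M \<subset> M'"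
    then obtain M' e where M': "matching G M'" "M \<subset> M'" "e \<in> M'" "e \<notin> M" by blast
    have "e \<inter> f = {}" if "f \<in> M" for f
    proof -
      have "f \<in> M'" "e \<noteq> f" using that M'(2,4) by auto
      then show ?thesis using M'(1,3) by (simp add: matching_def)
    qed
    moreover have "e \<in> edges G" using M'(1,3) by (auto simp: matching_def)
    then have "e \<inter> \<Union>M \<noteq> {}" using M(1) by (simp add: covering_matching_def)
    ultimately show False by blast
  qed
  then have "maximal_matching G M" using M(1) by (simp add: maximal_matching_def covering_matching_def)
  then have "\<gamma> G \<le> card M"
    unfolding min_maximal_matching_def using maximal_matchings_finite_nonempty(1)[OF G] by (intro Min_le) auto
  with M(2) show ?thesis by linarith
qed

lemma gamma_attained:
  assumes G: "simple_graph G"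
  obtains M where "covering_matching G M" "card M = \<gamma> G"
proof -
  have "\<gamma> G \<in> card ` {M. maximal_matching G M}"
    unfolding min_maximal_matching_def using maximal_matchings_finite_nonempty[OF G] by (intro Min_in) auto
  then obtain M where M: "maximal_matching G M" "card M = \<gamma> G" by auto
  have m: "matching G M" using M(1) by (simp add: maximal_matching_def)
  have "e \<inter> \<Union>M \<noteq> {}" if e: "e \<in> edges G" for e
  proof
    assume d: "e \<inter> \<Union>M = {}"
    have "e \<noteq> {}" using edge_pair[OF G e] by blast
    then have "e \<notin> M" using d by blast
    moreover have "matching G (insert e M)" by (rule matching_insert[OF m e]) (use d in blast)
    ultimately show False using M(1) unfolding maximal_matching_def by blast
  qed
  with m M(2) show thesis by (intro that) (simp_all add: covering_matching_def)
qed

lemma k33_gamma: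
  assumes G: "simple_graph G" and iso: "graph_isomorphic G (complete_bipartite 3 3)"
  shows "card (verts G) = 6" "card (edges G) = 9" "3 \<le> \<gamma> G"
proof -
  obtain f where f: "bij_betw f (verts G) ({..<3} <+> {..<3})"
    "\<And>u w. u \<in> verts G \<Longrightarrow> w \<in> verts G \<Longrightarrow> {u, w} \<in> edges G \<longleftrightarrow> {f u, f w} \<in> edges (complete_bipartite 3 3)"
    using iso by (auto simp: graph_isomorphic_def complete_bipartite_def)
  define L R where "L = {w \<in> verts G. f w \<in> Inl ` {..<3}}"
    and "R = {w \<in> verts G. f w \<in> Inr ` {..<3}}"
  have inj: "inj_on f (verts G)" and im: "f ` verts G = Inl ` {..<3} \<union> Inr ` {..<3}"
    using f(1) by (auto simp: bij_betw_def Plus_def)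
  have V: "verts G = L \<union> R" "L \<inter> R = {}" using im by (auto simp: L_def R_def)
  have fin: "finite L" "finite R" using G V(1) by (auto simp: simple_graph_def)
  have "f ` {w \<in> verts G. f w \<in> S} = f ` verts G \<inter> S" for S by blast
  then have "f ` L = Inl ` {..<3}" "f ` R = Inr ` {..<3}" unfolding L_def R_def im by auto
  moreover have "card (f ` L) = card L" "card (f ` R) = card R"
    using inj V(1) by (auto intro!: card_image inj_on_subset[OF inj])
  ultimately have c: "card L = 3" "card R = 3" by (simp_all add: card_image)
  show "card (verts G) = 6" using c fin V by (simp add: card_Un_disjoint)
  have E1: "{a, b} \<in> edges G" if "a \<in> L" "b \<in> R" for a b
    using that f(2)[of a b] by (auto simp: L_def R_def edges_complete_bipartite)
  have E2: "\<exists>a\<in>L. \<exists>b\<in>R. e = {a, b}" if e: "e \<in> edges G" for e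
  proof -
    obtain u w where uw: "e = {u, w}" "u \<in> verts G" "w \<in> verts G" using edge_pair[OF G e] by metis
    then have "u \<in> L \<and> w \<in> R \<or> u \<in> R \<and> w \<in> L"
      using f(2)[of u w] e by (auto simp: L_def R_def edges_complete_bipartite)
    then show ?thesis using uw(1) by blast
  qed
  have "edges G = (\<lambda>(a, b). {a, b}) ` (L \<times> R)" using E1 E2 by fastforce
  moreover have "inj_on (\<lambda>(a, b). {a, b}) (L \<times> R)"
    using V(2) by (auto simp: inj_on_def doubleton_eq_iff)
  ultimately show "card (edges G) = 9" using c by (simp add: card_image card_cartesian_product)
  obtain M where M: "covering_matching G M" "card M = \<gamma> G" using gamma_attained[OF G] .
  have ME: "M \<subseteq> edges G" using M(1) by (simp add: covering_matching_def matching_def)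
  then have finM: "finite M" using finite_edges[OF G] finite_subset by blast
  have le: "card (S \<inter> \<Union>M) \<le> card M" if "\<And>e. e \<in> M \<Longrightarrow> card (S \<inter> e) \<le> 1" for S
  proof -
    have "S \<inter> \<Union>M = (\<Union>e\<in>M. S \<inter> e)" by blast
    then have "card (S \<inter> \<Union>M) \<le> (\<Sum>e\<in>M. card (S \<inter> e))" using card_UN_le[OF finM]
      by metis
    also have "\<dots> \<le> (\<Sum>e\<in>M. 1)" by (rule sum_mono) (rule that)
    finally show ?thesis by simp
  qed
  show "3 \<le> \<gamma> G"
  proof (rule ccontr)
    assume n: "\<not> 3 \<le> \<gamma> G"
    have 1: "card (L \<inter> e) \<le> 1 \<and> card (R \<inter> e) \<le> 1" if "e \<in> M" for e
    proof -
      obtain a b where ab: "a \<in> L" "b \<in> R" "e = {a, b}" using E2 ME \<open>e \<in> M\<close> by blast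
      then have "L \<inter> e = {a}" "R \<inter> e = {b}" using V(2) by auto
      then show ?thesis by simp
    qed
    have "card (L \<inter> \<Union>M) < card L" "card (R \<inter> \<Union>M) < card R"
      using le[of L] le[of R] 1 n c M(2) by auto
    then have "L \<inter> \<Union>M \<noteq> L" "R \<inter> \<Union>M \<noteq> R" by auto
    then obtain a b where ab: "a \<in> L" "a \<notin> \<Union>M" "b \<in> R" "b \<notin> \<Union>M" by blast
    have "\<forall>e\<in>edges G. e \<inter> \<Union>M \<noteq> {}" using M(1) unfolding covering_matching_def
      by blast
    from bspec[OF this E1[OF ab(1,3)]] ab show False by blast
  qed
qed

theorem theorem1p3:
  fixes G :: "'a ugraph" and n m :: nat
  assumes "simple_graph G"
    and "connected_graph G"
    and "subcubic G"
    and "card (verts G) = n"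
    and "card (edges G) = m"
  shows "real (\<gamma> G) \<le> (4 * real n - real m) / 6 + 1 / 2 \<and>
    (real (\<gamma> G) = (4 * real n - real m) / 6 + 1 / 2 \<longleftrightarrow>
      graph_isomorphic G (complete_bipartite 3 3)) \<and>
    (\<not> cubic G \<longrightarrow> real (\<gamma> G) \<le> (4 * real n - real m) / 6)"
proof -
  let ?K = "graph_isomorphic G (complete_bipartite 3 3)"
  have phi: "phi G = 4 * int n - int m" using assms(4,5) by (simp add: phi_def)
  have nc: "6 * int (\<gamma> G) \<le> phi G" if "\<not> cubic G"
    using gamma_le_bnd[OF assms(1)] deficient_bnd[OF assms(1,3)] connected_deficient[OF assms(2,3) that] by blast
  have c: "6 * int (\<gamma> G) \<le> phi G + 2 \<or> 6 * int (\<gamma> G) \<le> phi G + 3 \<and> ?K" if "cubic G"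
  proof -
    interpret connected_cubic G using assms that by unfold_locales
    show ?thesis using cubic_bnd gamma_le_bnd[OF assms(1)] by blast
  qed
  have all: "6 * int (\<gamma> G) \<le> phi G + 3" using nc c by fastforce
  have eq: "6 * int (\<gamma> G) = phi G + 3 \<longleftrightarrow> ?K"
  proof
    assume "6 * int (\<gamma> G) = phi G + 3"
    then show ?K using nc c by fastforce
  next
    assume ?K
    from k33_gamma[OF assms(1) this] have "phi G = 15" "3 \<le> \<gamma> G" by (simp_all add: phi_def)
    with all show "6 * int (\<gamma> G) = phi G + 3" by linarith
  qed
  have "real (\<gamma> G) \<le> (4 * real n - real m) / 6 + 1 / 2 \<longleftrightarrow> real_of_int (6 * int (\<gamma> G)) \<le> real_of_int (phi G + 3)"
    "real (\<gamma> G) = (4 * real n - real m) / 6 + 1 / 2 \<longleftrightarrow> real_of_int (6 * int (\<gamma> G)) = real_of_int (phi G + 3)"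
    "real (\<gamma> G) \<le> (4 * real n - real m) / 6 \<longleftrightarrow> real_of_int (6 * int (\<gamma> G)) \<le> real_of_int (phi G)"
    by (auto simp: phi field_simps)
  then show ?thesis unfolding of_int_le_iff of_int_eq_iff using all eq nc by blast
qed
end
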